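(* Let $\varphi$ be a parallel calibration on a Riemannian manifold $(M,g)$. A deformation of a closed $\varphi$-calibrated submanifold inside the class of $\hat\varphi$-submanifolds remains in the subclass of $\varphi$-calibrated submanifolds; that is, if $(L_t)_{t\in[0,1]}$ is a one-parameter deformation of a closed $\varphi$-calibrated submanifold $L_0$ such that each $L_t$ is a $\hat\varphi$-submanifold, then each $L_t$, $t\in[0,1]$, is $\varphi$-calibrated.
   Context: Parallel means $\nabla\varphi=0$ for the Levi-Civita connection. A calibration is a closed form of comass one; an oriented $l$-dimensional submanifold ($l=\deg\varphi$) is $\varphi$-calibrated if $\varphi$ restricts to its Riemannian volume form. Closed submanifold means compact without boundary. $\hat\varphi=\sum_i(\iota_{e_i}\varphi)\otimes e_i\in\Omega^{l-1}(M,TM)$ with $(e_i)$ a local orthonormal frame. A submanifold $L$ is a $\hat\varphi$-submanifold if $\dim L\ge l-1$ and $\hat\varphi_{|L}\in\Omega^{l-1}(L,TL)$. A deformation is a continuous family of closed submanifolds $L_t=f_t(L_0)$, with $f_t:L_0\to M$ embeddings varying continuously with $t\in[0,1]$ (in the $C^\infty$ topology) and $f_0$ the inclusion; $L_t$ carries the orientation transported from $L_0$. *)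

theory Defs
  imports "HOL-Analysis.Analysis" "HOL-Library.Extended_Real"
begin

section \<open>Smooth maps between Euclidean spaces\<close>

text \<open>\<open>iter_deriv [v1, ..., vk] f\<close> is the iterated directional derivative of \<open>f\<close>, first along \<open>vk\<close>
  and last along \<open>v1\<close>.\<close>

primrec iter_deriv :: "'a list \<Rightarrow> ('a::real_normed_vector \<Rightarrow> 'b::real_normed_vector) \<Rightarrow> 'a \<Rightarrow> 'b" where
  "iter_deriv [] f = f"
| "iter_deriv (v # vs) f = (\<lambda>x. frechet_derivative (iter_deriv vs f) (at x) v)"

text \<open>Meant for open \<open>S\<close>. Differentiability of every iterated derivative gives continuity of every one
  of them, so this is \<open>C\<^sup>\<infinity>\<close>.\<close>

definition smooth_on :: "'a::real_normed_vector set \<Rightarrow> ('a \<Rightarrow> 'b::real_normed_vector) \<Rightarrow> bool" where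
  "smooth_on S f \<longleftrightarrow> (\<forall>vs. \<forall>x\<in>S. iter_deriv vs f differentiable (at x))"


section \<open>Manifolds\<close>

text \<open>The manifold is the whole topological type \<open>'m\<close>, modelled on the Euclidean space \<open>'e\<close>. A chart is
  its domain together with its coordinate map, whose values off the domain are irrelevant.\<close>

type_synonym ('m, 'e) chart = "'m set \<times> ('m \<Rightarrow> 'e)"

definition transition :: "('m, 'e) chart \<Rightarrow> ('m, 'e) chart \<Rightarrow> 'e \<Rightarrow> 'e" where
  "transition c d = snd d \<circ> inv_into (fst c) (snd c)"

definition smooth_atlas ::
  "('m::{t2_space,second_countable_topology}, 'e::euclidean_space) chart set \<Rightarrow> bool" where
  "smooth_atlas A \<longleftrightarrow>
     (\<Union>c\<in>A. fst c) = UNIV \<and>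
     (\<forall>c\<in>A. open (fst c) \<and> open (snd c ` fst c) \<and>
        homeomorphism (fst c) (snd c ` fst c) (snd c) (inv_into (fst c) (snd c))) \<and>
     (\<forall>c\<in>A. \<forall>d\<in>A. smooth_on (snd c ` (fst c \<inter> fst d)) (transition c d))"

text \<open>Smoothness and differentials of maps from an open subset \<open>S\<close> of a Euclidean space into the manifold.\<close>

definition smooth_into ::
  "('m::topological_space, 'e::euclidean_space) chart set \<Rightarrow> 'a::euclidean_space set \<Rightarrow> ('a \<Rightarrow> 'm) \<Rightarrow> bool" where
  "smooth_into A S F \<longleftrightarrow>
     continuous_on S F \<and> (\<forall>c\<in>A. smooth_on {x\<in>S. F x \<in> fst c} (snd c \<circ> F))"

definition immersion_into ::
  "('m::topological_space, 'e::euclidean_space) chart set \<Rightarrow> 'a::euclidean_space set \<Rightarrow> ('a \<Rightarrow> 'm) \<Rightarrow> bool" where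
  "immersion_into A S F \<longleftrightarrow>
     smooth_into A S F \<and>
     (\<forall>c\<in>A. \<forall>x\<in>S. F x \<in> fst c \<longrightarrow> inj (frechet_derivative (snd c \<circ> F) (at x)))"


section \<open>Metrics and differential forms\<close>

text \<open>A tensor field is given by its coordinate expressions: for every chart \<open>c\<close>, a function of the
  coordinates \<open>x \<in> snd c ` fst c\<close>, subject to the transformation law of covariant tensors. A tuple
  of tangent vectors is a list of coordinate vectors.\<close>

type_synonym ('m, 'e) metric = "('m, 'e) chart \<Rightarrow> 'e \<Rightarrow> 'e \<Rightarrow> 'e \<Rightarrow> real"
type_synonym ('m, 'e) dform = "('m, 'e) chart \<Rightarrow> 'e \<Rightarrow> 'e list \<Rightarrow> real"

definition riemannian_metric ::
  "('m, 'e::euclidean_space) chart set \<Rightarrow> ('m, 'e) metric \<Rightarrow> bool" where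
  "riemannian_metric A g \<longleftrightarrow>
     (\<forall>c\<in>A. (\<forall>x\<in>snd c ` fst c.
          bilinear (g c x) \<and> (\<forall>u v. g c x u v = g c x v u) \<and> (\<forall>v. v \<noteq> 0 \<longrightarrow> 0 < g c x v v)) \<and>
        (\<forall>u v. smooth_on (snd c ` fst c) (\<lambda>x. g c x u v))) \<and>
     (\<forall>c\<in>A. \<forall>d\<in>A. \<forall>x\<in>snd c ` (fst c \<inter> fst d). \<forall>u v.
        g c x u v = g d (transition c d x) (frechet_derivative (transition c d) (at x) u)
                                           (frechet_derivative (transition c d) (at x) v))"

definition alternating_form_on :: "'e::real_vector set \<Rightarrow> nat \<Rightarrow> ('e list \<Rightarrow> real) \<Rightarrow> bool" where
  "alternating_form_on T l \<omega> \<longleftrightarrow>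
     (\<forall>vs. length vs = l \<and> set vs \<subseteq> T \<longrightarrow>
        (\<forall>i<l. \<forall>u\<in>T. \<forall>v\<in>T. \<forall>a b.
           \<omega> (vs[i := a *\<^sub>R u + b *\<^sub>R v]) = a * \<omega> (vs[i := u]) + b * \<omega> (vs[i := v])) \<and>
        (\<forall>i j. i < j \<and> j < l \<and> vs ! i = vs ! j \<longrightarrow> \<omega> vs = 0))"

definition differential_form ::
  "('m, 'e::euclidean_space) chart set \<Rightarrow> nat \<Rightarrow> ('m, 'e) dform \<Rightarrow> bool" where
  "differential_form A l \<phi> \<longleftrightarrow>
     (\<forall>c\<in>A. (\<forall>x\<in>snd c ` fst c. alternating_form_on UNIV l (\<phi> c x)) \<and>
        (\<forall>vs. length vs = l \<longrightarrow> smooth_on (snd c ` fst c) (\<lambda>x. \<phi> c x vs))) \<and>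
     (\<forall>c\<in>A. \<forall>d\<in>A. \<forall>x\<in>snd c ` (fst c \<inter> fst d). \<forall>vs. length vs = l \<longrightarrow>
        \<phi> c x vs = \<phi> d (transition c d x) (map (frechet_derivative (transition c d) (at x)) vs))"

text \<open>The coordinate expression of \<open>d\<phi>\<close>, evaluated on constant vector fields.\<close>

definition ext_deriv :: "('m, 'e::euclidean_space) dform \<Rightarrow> ('m, 'e) dform" where
  "ext_deriv \<phi> c x vs =
     (\<Sum>i<length vs. (-1) ^ i *
        frechet_derivative (\<lambda>y. \<phi> c y (take i vs @ drop (Suc i) vs)) (at x) (vs ! i))"

definition closed_form ::
  "('m, 'e::euclidean_space) chart set \<Rightarrow> nat \<Rightarrow> ('m, 'e) dform \<Rightarrow> bool" where
  "closed_form A l \<phi> \<longleftrightarrow>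
     (\<forall>c\<in>A. \<forall>x\<in>snd c ` fst c. \<forall>vs. length vs = Suc l \<longrightarrow> ext_deriv \<phi> c x vs = 0)"

definition orthonormal_list :: "('e \<Rightarrow> 'e \<Rightarrow> real) \<Rightarrow> 'e list \<Rightarrow> bool" where
  "orthonormal_list G es \<longleftrightarrow>
     (\<forall>i<length es. \<forall>j<length es. G (es ! i) (es ! j) = (if i = j then 1 else 0))"

text \<open>Unit simple \<open>l\<close>-vectors are the wedge products of orthonormal \<open>l\<close>-tuples.\<close>

definition comass ::
  "('m, 'e::euclidean_space) chart set \<Rightarrow> ('m, 'e) metric \<Rightarrow> nat \<Rightarrow> ('m, 'e) dform \<Rightarrow> ereal" where
  "comass A g l \<phi> =
     Sup {ereal (\<phi> c x es) | c x es.
            c \<in> A \<and> x \<in> snd c ` fst c \<and> length es = l \<and> orthonormal_list (g c x) es}"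

definition calibration ::
  "('m, 'e::euclidean_space) chart set \<Rightarrow> ('m, 'e) metric \<Rightarrow> nat \<Rightarrow> ('m, 'e) dform \<Rightarrow> bool" where
  "calibration A g l \<phi> \<longleftrightarrow> differential_form A l \<phi> \<and> closed_form A l \<phi> \<and> comass A g l \<phi> = 1"

text \<open>The Levi-Civita connection in a chart is \<open>\<nabla>\<^sub>w v = D\<^sub>w v + \<Gamma> w v\<close>, where symmetry of \<open>\<Gamma>\<close> says that
  it is torsion-free and the last clause that it is compatible with the metric.\<close>

definition christoffel :: "('m, 'e::euclidean_space) metric \<Rightarrow> ('m, 'e) chart \<Rightarrow> 'e \<Rightarrow> 'e \<Rightarrow> 'e \<Rightarrow> 'e" where
  "christoffel g c x =
     (THE \<Gamma>. bilinear \<Gamma> \<and> (\<forall>u v. \<Gamma> u v = \<Gamma> v u) \<and>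
        (\<forall>w u v. frechet_derivative (\<lambda>y. g c y u v) (at x) w =
                 g c x (\<Gamma> w u) v + g c x u (\<Gamma> w v)))"

definition cov_deriv ::
  "('m, 'e::euclidean_space) metric \<Rightarrow> ('m, 'e) dform \<Rightarrow> ('m, 'e) chart \<Rightarrow> 'e \<Rightarrow> 'e \<Rightarrow> 'e list \<Rightarrow> real" where
  "cov_deriv g \<phi> c x w vs =
     frechet_derivative (\<lambda>y. \<phi> c y vs) (at x) w -
     (\<Sum>i<length vs. \<phi> c x (vs[i := christoffel g c x w (vs ! i)]))"

definition parallel_form ::
  "('m, 'e::euclidean_space) chart set \<Rightarrow> ('m, 'e) metric \<Rightarrow> nat \<Rightarrow> ('m, 'e) dform \<Rightarrow> bool" where
  "parallel_form A g l \<phi> \<longleftrightarrow>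
     (\<forall>c\<in>A. \<forall>x\<in>snd c ` fst c. \<forall>w vs. length vs = l \<longrightarrow> cov_deriv g \<phi> c x w vs = 0)"

text \<open>The vector-valued form \<open>\<Sum>\<^sub>i (\<iota>\<^bsub>e\<^sub>i\<^esub> \<phi>) \<otimes> e\<^sub>i\<close> does not depend on the orthonormal frame.\<close>

definition orthonormal_frame :: "('e::euclidean_space \<Rightarrow> 'e \<Rightarrow> real) \<Rightarrow> 'e list" where
  "orthonormal_frame G = (SOME es. length es = DIM('e) \<and> orthonormal_list G es)"

definition form_hat ::
  "('m, 'e::euclidean_space) metric \<Rightarrow> ('m, 'e) dform \<Rightarrow> ('m, 'e) chart \<Rightarrow> 'e \<Rightarrow> 'e list \<Rightarrow> 'e" where
  "form_hat g \<phi> c x ws = (\<Sum>e\<leftarrow>orthonormal_frame (g c x). \<phi> c x (e # ws) *\<^sub>R e)"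


section \<open>Submanifolds\<close>

text \<open>A local parametrization \<open>\<rho> : W \<rightarrow> L\<close> of \<open>L\<close> by an open subset of the model space \<open>'k\<close>. The
  dimension of a submanifold is that of \<open>'k\<close>.\<close>

definition local_param ::
  "('m::topological_space, 'e::euclidean_space) chart set \<Rightarrow> 'm set \<Rightarrow>
   'k::euclidean_space set \<Rightarrow> ('k \<Rightarrow> 'm) \<Rightarrow> bool" where
  "local_param A L W \<rho> \<longleftrightarrow>
     open W \<and> immersion_into A W \<rho> \<and> openin (top_of_set L) (\<rho> ` W) \<and>
     (\<exists>\<sigma>. homeomorphism W (\<rho> ` W) \<rho> \<sigma>)"

definition submanifold ::
  "'k::euclidean_space itself \<Rightarrow> ('m::topological_space, 'e::euclidean_space) chart set \<Rightarrow>
   'm set \<Rightarrow> bool" where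
  "submanifold K A L \<longleftrightarrow>
     (\<forall>p\<in>L. \<exists>(W :: 'k set) \<rho>. local_param A L W \<rho> \<and> p \<in> \<rho> ` W)"

definition closed_submanifold ::
  "'k::euclidean_space itself \<Rightarrow> ('m::topological_space, 'e::euclidean_space) chart set \<Rightarrow>
   'm set \<Rightarrow> bool" where
  "closed_submanifold K A L \<longleftrightarrow> submanifold K A L \<and> compact L"

text \<open>Tangent vectors of \<open>L\<close> are the velocities of smooth curves in \<open>L\<close>, read in a chart.\<close>

definition curve_in ::
  "('m::topological_space, 'e::euclidean_space) chart set \<Rightarrow> 'm set \<Rightarrow> 'm \<Rightarrow> (real \<Rightarrow> 'm) \<Rightarrow> bool" where
  "curve_in A L p \<gamma> \<longleftrightarrow>
     \<gamma> 0 = p \<and> (\<exists>\<epsilon>>0. \<gamma> ` {-\<epsilon><..<\<epsilon>} \<subseteq> L \<and> smooth_into A {-\<epsilon><..<\<epsilon>} \<gamma>)"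

definition velocity :: "('m, 'e::real_normed_vector) chart \<Rightarrow> (real \<Rightarrow> 'm) \<Rightarrow> 'e" where
  "velocity c \<gamma> = vector_derivative (snd c \<circ> \<gamma>) (at 0)"

definition tangent_space ::
  "('m::topological_space, 'e::euclidean_space) chart set \<Rightarrow> 'm set \<Rightarrow>
   ('m, 'e) chart \<Rightarrow> 'm \<Rightarrow> 'e set" where
  "tangent_space A L c p = velocity c ` {\<gamma>. curve_in A L p \<gamma>}"

text \<open>\<open>differential_rel A L f c d p u v\<close>: the differential at \<open>p\<close> of \<open>f\<close> restricted to \<open>L\<close> maps the
  tangent vector with coordinates \<open>u\<close> in \<open>c\<close> to the one with coordinates \<open>v\<close> in \<open>d\<close>.\<close>

definition differential_rel ::
  "('m::topological_space, 'e::euclidean_space) chart set \<Rightarrow> 'm set \<Rightarrow> ('m \<Rightarrow> 'm) \<Rightarrow>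
   ('m, 'e) chart \<Rightarrow> ('m, 'e) chart \<Rightarrow> 'm \<Rightarrow> 'e \<Rightarrow> 'e \<Rightarrow> bool" where
  "differential_rel A L f c d p u v \<longleftrightarrow>
     (\<exists>\<gamma>. curve_in A L p \<gamma> \<and> velocity c \<gamma> = u \<and> velocity d (f \<circ> \<gamma>) = v)"

definition form_hat_submanifold ::
  "'k::euclidean_space itself \<Rightarrow> ('m::topological_space, 'e::euclidean_space) chart set \<Rightarrow>
   ('m, 'e) metric \<Rightarrow> nat \<Rightarrow> ('m, 'e) dform \<Rightarrow> 'm set \<Rightarrow> bool" where
  "form_hat_submanifold K A g l \<phi> L \<longleftrightarrow>
     submanifold K A L \<and> l \<le> DIM('k) + 1 \<and>
     (\<forall>c\<in>A. \<forall>p\<in>L \<inter> fst c. \<forall>ws.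
        Suc (length ws) = l \<and> set ws \<subseteq> tangent_space A L c p \<longrightarrow>
        form_hat g \<phi> c (snd c p) ws \<in> tangent_space A L c p)"


section \<open>Orientations and calibrated submanifolds\<close>

text \<open>An orientation is given by its positively oriented bases: \<open>Or c p vs\<close> says that \<open>vs\<close>, read in the
  chart \<open>c\<close>, is a positive basis of the tangent space at \<open>p\<close>. Locally these have to be the bases on
  which some continuous nowhere vanishing top-degree form is positive.\<close>

type_synonym ('m, 'e) orient = "('m, 'e) chart \<Rightarrow> 'm \<Rightarrow> 'e list \<Rightarrow> bool"

definition basis_list :: "'e::euclidean_space set \<Rightarrow> 'e list \<Rightarrow> bool" where
  "basis_list T vs \<longleftrightarrow> distinct vs \<and> independent (set vs) \<and> span (set vs) = T"

definition orientation ::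
  "('m::topological_space, 'e::euclidean_space) chart set \<Rightarrow> nat \<Rightarrow> 'm set \<Rightarrow> ('m, 'e) orient \<Rightarrow> bool" where
  "orientation A l L Or \<longleftrightarrow>
     (\<forall>c\<in>A. \<forall>d\<in>A. \<forall>p\<in>L \<inter> fst c \<inter> fst d. \<forall>vs.
        Or c p vs \<longleftrightarrow> Or d p (map (frechet_derivative (transition c d) (at (snd c p))) vs)) \<and>
     (\<forall>p\<in>L. \<exists>c\<in>A. \<exists>U \<omega>. open U \<and> p \<in> U \<and> U \<subseteq> fst c \<and>
        (\<forall>x\<in>snd c ` U. alternating_form_on UNIV l (\<omega> x)) \<and>
        (\<forall>vs. length vs = l \<longrightarrow> continuous_on (snd c ` U) (\<lambda>x. \<omega> x vs)) \<and>
        (\<forall>q\<in>L \<inter> U. \<forall>vs.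
           (basis_list (tangent_space A L c q) vs \<longrightarrow> \<omega> (snd c q) vs \<noteq> 0) \<and>
           (Or c q vs \<longleftrightarrow> basis_list (tangent_space A L c q) vs \<and> 0 < \<omega> (snd c q) vs)))"

text \<open>The Riemannian volume form on an oriented tangent space \<open>T\<close> of dimension \<open>l\<close> with set \<open>P\<close> of
  positive bases: the \<open>l\<close>-form with value \<open>1\<close> on positive orthonormal bases.\<close>

definition is_volume_form ::
  "('e::real_vector \<Rightarrow> 'e \<Rightarrow> real) \<Rightarrow> nat \<Rightarrow> 'e set \<Rightarrow> ('e list \<Rightarrow> bool) \<Rightarrow> ('e list \<Rightarrow> real) \<Rightarrow> bool" where
  "is_volume_form G l T P \<omega> \<longleftrightarrow>
     alternating_form_on T l \<omega> \<and> (\<forall>es. P es \<and> orthonormal_list G es \<longrightarrow> \<omega> es = 1)"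

definition calibrated_submanifold ::
  "'k::euclidean_space itself \<Rightarrow> ('m::topological_space, 'e::euclidean_space) chart set \<Rightarrow>
   ('m, 'e) metric \<Rightarrow> nat \<Rightarrow> ('m, 'e) dform \<Rightarrow> 'm set \<Rightarrow> ('m, 'e) orient \<Rightarrow> bool" where
  "calibrated_submanifold K A g l \<phi> L Or \<longleftrightarrow>
     submanifold K A L \<and> DIM('k) = l \<and> orientation A l L Or \<and>
     (\<forall>c\<in>A. \<forall>p\<in>L \<inter> fst c.
        is_volume_form (g c (snd c p)) l (tangent_space A L c p) (Or c p) (\<phi> c (snd c p)))"


section \<open>Deformations\<close>

definition smooth_embedding ::
  "'k::euclidean_space itself \<Rightarrow> ('m::topological_space, 'e::euclidean_space) chart set \<Rightarrow>
   'm set \<Rightarrow> ('m \<Rightarrow> 'm) \<Rightarrow> bool" where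
  "smooth_embedding K A L f \<longleftrightarrow>
     (\<forall>(W :: 'k set) \<rho>. local_param A L W \<rho> \<longrightarrow> immersion_into A W (f \<circ> \<rho>)) \<and>
     (\<exists>h. homeomorphism L (f ` L) f h)"

text \<open>Continuity of \<open>t \<mapsto> f t\<close> on \<open>[0,1]\<close> into the smooth maps from \<open>L\<close> to the manifold with the
  \<open>C\<^sup>\<infinity>\<close> topology, whose subbasic neighbourhoods ask for closeness of all derivatives up to order \<open>r\<close>
  on a compact set, in a local parametrization of the source and a chart of the target.\<close>

definition Cinf_continuous_family ::
  "'k::euclidean_space itself \<Rightarrow> ('m::topological_space, 'e::euclidean_space) chart set \<Rightarrow>
   'm set \<Rightarrow> (real \<Rightarrow> 'm \<Rightarrow> 'm) \<Rightarrow> bool" where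
  "Cinf_continuous_family K A L f \<longleftrightarrow>
     (\<forall>s\<in>{0..1}. \<forall>(W :: 'k set) \<rho> C. \<forall>c\<in>A. \<forall>r. \<forall>\<epsilon>>0.
        local_param A L W \<rho> \<and> compact C \<and> C \<subseteq> W \<and> f s ` \<rho> ` C \<subseteq> fst c \<longrightarrow>
        (\<forall>\<^sub>F t in at s within {0..1}.
           f t ` \<rho> ` C \<subseteq> fst c \<and>
           (\<forall>x\<in>C. \<forall>vs. length vs \<le> r \<and> set vs \<subseteq> Basis \<longrightarrow>
              dist (iter_deriv vs (snd c \<circ> f t \<circ> \<rho>) x) (iter_deriv vs (snd c \<circ> f s \<circ> \<rho>) x) < \<epsilon>)))"

definition deformation ::
  "'k::euclidean_space itself \<Rightarrow> ('m::topological_space, 'e::euclidean_space) chart set \<Rightarrow>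
   'm set \<Rightarrow> (real \<Rightarrow> 'm \<Rightarrow> 'm) \<Rightarrow> bool" where
  "deformation K A L f \<longleftrightarrow>
     closed_submanifold K A L \<and>
     (\<forall>t\<in>{0..1}. smooth_embedding K A L (f t)) \<and>
     (\<forall>p\<in>L. f 0 p = p) \<and>
     Cinf_continuous_family K A L f"

definition transported_orientation ::
  "('m::topological_space, 'e::euclidean_space) chart set \<Rightarrow> 'm set \<Rightarrow> ('m \<Rightarrow> 'm) \<Rightarrow>
   ('m, 'e) orient \<Rightarrow> ('m, 'e) orient" where
  "transported_orientation A L f Or d q vs \<longleftrightarrow>
     (\<exists>p\<in>L. f p = q \<and>
        (\<exists>c\<in>A. p \<in> fst c \<and> (\<exists>us. Or c p us \<and> list_all2 (differential_rel A L f c d p) us vs)))"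

end

theory Submission
  imports Defs
begin

text \<open>
  Fix a point \<open>p\<close> of the initial submanifold \<open>L\<close> and a basis of its tangent space there. Push the basis
  forward by the differential of \<open>f t\<close>, orthonormalise it, and let \<open>\<lambda>(t)\<close> be the value of \<open>\<phi>\<close> on the
  resulting orthonormal frame (\<open>frame_value\<close> below). As the initial submanifold is calibrated,
  \<open>\<lambda>(0) = \<plusminus>1\<close>, and the theorem amounts to \<open>\<lambda>\<close> being constant.

  Let \<open>T\<close> be the tangent plane of \<open>f t ` L\<close> at \<open>f t p\<close>. That \<open>\<phi>\<close>-hat maps \<open>T\<close> to itself means
  \<open>\<phi>(n, w\<^sub>2, \<dots>, w\<^sub>l) = 0\<close> for \<open>n\<close> normal and \<open>w\<^sub>i\<close> tangent, in other words that \<open>T\<close> is a critical point of \<open>\<phi>\<close>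
  on the Grassmannian of the ambient tangent space (\<open>form_hat_critical\<close>). As \<open>\<phi>\<close> and the metric
  are parallel, the derivative of \<open>\<phi>\<close> in horizontal directions vanishes as well, and \<open>T\<close> is
  critical in the whole Grassmannian bundle. With a Lagrange multiplier for the
  normalisation of frames this becomes a statement about an ordinary smooth function
  \<open>H(x, v, \<lambda>) = \<phi>\<^sub>x(v) - \<lambda>/2 \<Sum>\<^sub>i (g\<^sub>x(v\<^sub>i, v\<^sub>i) - 1)\<close> on an open subset of a Euclidean space: an orthonormal
  frame of \<open>T\<close>, taken with \<open>\<lambda> = \<phi>\<^sub>x(v)\<close>, is a critical point of \<open>H\<close> with critical value \<open>\<lambda>\<close>
  (\<open>lagrangian_critical\<close>).

  So \<open>\<lambda>(t)\<close> is a smooth function evaluated along a path of its critical points. The path is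
  merely continuous in \<open>t\<close>, so the chain rule says nothing. Instead Sard's theorem applies: critical
  values form a null set, whereas \<open>\<lambda>\<close> maps intervals to intervals, hence to points
  (\<open>smooth_constant_on_critical_path\<close>). This is a statement inside one chart, but \<open>\<lambda>\<close> does not depend on
  the chart, and \<open>[0,1]\<close> is connected (\<open>frame_value_constant\<close>).

  Orthonormalisation preserves the sign of \<open>\<phi>\<close> on a basis. Therefore the transported orientation
  consists of the bases on which \<open>\<phi>\<close> is positive (\<open>transported_orientation_iff\<close>); the form \<open>\<phi>\<close> itself
  exhibits it as an orientation, and on its orthonormal bases \<open>\<phi>\<close> has the value \<open>\<bar>\<lambda>\<bar> = 1\<close>.
\<close>

section \<open>Smooth functions\<close>

text \<open>Products and compositions are differentiated by rules that involve the functions themselves as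
  well as their derivatives, so closure of smoothness under them is proved by induction on the order of
  differentiability. The clause for order \<open>0\<close> is trivial, which makes the base cases so.\<close>

primrec kdiff :: "nat \<Rightarrow> 'a set \<Rightarrow> ('a::real_normed_vector \<Rightarrow> 'b::real_normed_vector) \<Rightarrow> bool" where
  "kdiff 0 S f = True"
| "kdiff (Suc k) S f \<longleftrightarrow>
     (\<forall>x\<in>S. f differentiable (at x)) \<and> (\<forall>v. kdiff k S (\<lambda>x. frechet_derivative f (at x) v))"

lemma iter_deriv_append: "iter_deriv (us @ vs) f = iter_deriv us (iter_deriv vs f)"
  by (induction us) auto

lemma smooth_on_iff_kdiff: "smooth_on S f \<longleftrightarrow> (\<forall>k. kdiff k S f)"
proof
  assume sm: "smooth_on S f"
  have "kdiff k S (iter_deriv vs f)" for k vs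
  proof (induction k arbitrary: vs)
    case (Suc k)
    have "kdiff k S (\<lambda>x. frechet_derivative (iter_deriv vs f) (at x) v)" for v
      using Suc[of "v # vs"] by simp
    moreover have "\<forall>x\<in>S. iter_deriv vs f differentiable (at x)"
      using sm by (simp add: smooth_on_def)
    ultimately show ?case by simp
  qed simp
  from this[of _ "[]"] show "\<forall>k. kdiff k S f" by simp
next
  have "\<forall>x\<in>S. iter_deriv vs f differentiable (at x)" if "\<forall>k. kdiff k S f" for vs and f :: "'a \<Rightarrow> 'b"
    using that
  proof (induction vs arbitrary: f rule: rev_induct)
    case Nil
    have "kdiff (Suc 0) S f" using Nil by (rule spec)
    then show ?case by simp
  next
    case (snoc v vs)
    have "kdiff k S (\<lambda>x. frechet_derivative f (at x) v)" for k
      using snoc.prems[rule_format, of "Suc k"] by simp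
    then have "\<forall>k. kdiff k S (\<lambda>x. frechet_derivative f (at x) v)" by simp
    from snoc.IH[OF this] show ?case by (simp add: iter_deriv_append)
  qed
  then show "\<forall>k. kdiff k S f \<Longrightarrow> smooth_on S f"
    by (simp add: smooth_on_def)
qed

lemma frechet_derivative_cong_open:
  assumes "open S" "x \<in> S" "\<And>y. y \<in> S \<Longrightarrow> f y = g y"
  shows "frechet_derivative f (at x) = frechet_derivative g (at x)"
proof -
  have "(f has_derivative D) (at x) \<longleftrightarrow> (g has_derivative D) (at x)" for D
    using assms has_derivative_transform_within_open[of f D x UNIV S g]
      has_derivative_transform_within_open[of g D x UNIV S f] by auto
  then show ?thesis unfolding frechet_derivative_def by simp
qed

lemma kdiff_cong:
  assumes "open S" "\<And>x. x \<in> S \<Longrightarrow> f x = g x" "kdiff k S f"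
  shows "kdiff k S g"
  using assms(2,3)
proof (induction k arbitrary: f g)
  case (Suc k)
  have eq: "frechet_derivative f (at x) = frechet_derivative g (at x)" if "x \<in> S" for x
    by (rule frechet_derivative_cong_open[OF assms(1) that]) (use Suc.prems in auto)
  have "g differentiable (at x)" if "x \<in> S" for x
  proof -
    have "(f has_derivative frechet_derivative f (at x)) (at x)"
      using Suc.prems that by (simp add: frechet_derivative_works)
    from has_derivative_transform_within_open[OF this assms(1) that Suc.prems(1)]
    show ?thesis unfolding differentiable_def by blast
  qed
  moreover have "kdiff k S (\<lambda>x. frechet_derivative g (at x) v)" for v
    by (rule Suc.IH[of "\<lambda>x. frechet_derivative f (at x) v"]) (use Suc.prems eq in auto)
  ultimately show ?case by simp
qed simp

lemma kdiff_Suc_intro: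
  assumes "open S" "\<And>x. x \<in> S \<Longrightarrow> (f has_derivative f' x) (at x)" "\<And>v. kdiff k S (\<lambda>x. f' x v)"
  shows "kdiff (Suc k) S f"
proof -
  have "kdiff k S (\<lambda>x. frechet_derivative f (at x) v)" for v
    by (rule kdiff_cong[OF assms(1) _ assms(3)[of v]]) (simp add: frechet_derivative_at[OF assms(2), symmetric])
  moreover have "\<forall>x\<in>S. f differentiable (at x)"
    using assms(2) unfolding differentiable_def by blast
  ultimately show ?thesis by simp
qed

lemma kdiff_SucD: "kdiff (Suc k) S f \<Longrightarrow> kdiff k S f"
proof (induction k arbitrary: f)
  case (Suc k)
  then show ?case by (metis kdiff.simps(2))
qed simp

lemma kdiff_has_derivative:
  "kdiff (Suc k) S f \<Longrightarrow> x \<in> S \<Longrightarrow> (f has_derivative frechet_derivative f (at x)) (at x)"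
  by (simp add: frechet_derivative_works)

lemma kdiff_const: "open S \<Longrightarrow> kdiff k S (\<lambda>x. c)"
proof (induction k arbitrary: c)
  case (Suc k)
  show ?case by (rule kdiff_Suc_intro[where f' = "\<lambda>x v. 0"]) (use Suc in auto)
qed simp

lemma kdiff_bounded_linear:
  assumes "bounded_linear L" "open S" "kdiff k S f"
  shows "kdiff k S (\<lambda>x. L (f x))"
  using assms(3)
proof (induction k arbitrary: f)
  case (Suc k)
  show ?case
  proof (rule kdiff_Suc_intro[OF \<open>open S\<close>])
    show "((\<lambda>x. L (f x)) has_derivative (\<lambda>v. L (frechet_derivative f (at x) v))) (at x)" if "x \<in> S" for x
      by (rule bounded_linear.has_derivative[OF assms(1) kdiff_has_derivative[OF Suc.prems that]])
  qed (use Suc in auto)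
qed simp

lemma kdiff_id: "open S \<Longrightarrow> kdiff k S (\<lambda>x. x)"
proof (cases k)
  case (Suc n)
  assume "open S"
  then show ?thesis unfolding Suc
    by (intro kdiff_Suc_intro[where f' = "\<lambda>x v. v"]) (auto intro: kdiff_const)
qed simp

lemma kdiff_linear: "bounded_linear L \<Longrightarrow> open S \<Longrightarrow> kdiff k S L"
  using kdiff_bounded_linear[of L S k "\<lambda>x. x"] kdiff_id by auto

lemma kdiff_add:
  assumes "open S" "kdiff k S f" "kdiff k S g"
  shows "kdiff k S (\<lambda>x. f x + g x)"
  using assms(2,3)
proof (induction k arbitrary: f g)
  case (Suc k)
  show ?case
  proof (rule kdiff_Suc_intro[OF \<open>open S\<close>])
    show "((\<lambda>x. f x + g x) has_derivative (\<lambda>v. frechet_derivative f (at x) v + frechet_derivative g (at x) v)) (at x)" if "x \<in> S" for x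
      by (intro has_derivative_add kdiff_has_derivative[OF Suc.prems(1) that] kdiff_has_derivative[OF Suc.prems(2) that])
  qed (use Suc in auto)
qed simp

lemma kdiff_sum:
  assumes "open S" "\<And>i. i \<in> I \<Longrightarrow> kdiff k S (f i)"
  shows "kdiff k S (\<lambda>x. \<Sum>i\<in>I. f i x)"
  using assms(2) by (induction I rule: infinite_finite_induct) (auto simp: assms(1) kdiff_const intro: kdiff_add)

lemma kdiff_bilinear:
  assumes "bounded_bilinear P" "open S" "kdiff k S f" "kdiff k S g"
  shows "kdiff k S (\<lambda>x. P (f x) (g x))"
  using assms(3,4)
proof (induction k arbitrary: f g)
  case (Suc k)
  show ?case
  proof (rule kdiff_Suc_intro[OF \<open>open S\<close>])
    show "((\<lambda>x. P (f x) (g x)) has_derivative (\<lambda>v. P (f x) (frechet_derivative g (at x) v) + P (frechet_derivative f (at x) v) (g x))) (at x)" if "x \<in> S" for x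
      by (rule bounded_bilinear.FDERIV[OF assms(1)])
        (intro kdiff_has_derivative[OF Suc.prems(1) that] kdiff_has_derivative[OF Suc.prems(2) that])+
  next
    show "kdiff k S (\<lambda>x. P (f x) (frechet_derivative g (at x) v) + P (frechet_derivative f (at x) v) (g x))" for v
      using Suc.prems kdiff_SucD[of k S f] kdiff_SucD[of k S g]
      by (intro kdiff_add Suc.IH \<open>open S\<close>) auto
  qed
qed simp

lemmas kdiff_scaleR = kdiff_bilinear[OF bounded_bilinear_scaleR]
lemmas kdiff_mult = kdiff_bilinear[OF bounded_bilinear_mult]
lemmas kdiff_inner = kdiff_bilinear[OF bounded_bilinear_inner]

lemma kdiff_uminus: "open S \<Longrightarrow> kdiff k S f \<Longrightarrow> kdiff k S (\<lambda>x. - f x)"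
  by (rule kdiff_bounded_linear) (auto intro: bounded_linear_minus)

lemma kdiff_diff: "open S \<Longrightarrow> kdiff k S f \<Longrightarrow> kdiff k S g \<Longrightarrow> kdiff k S (\<lambda>x. f x - g x)"
  using kdiff_add[of S k f "\<lambda>x. - g x"] kdiff_uminus by auto

text \<open>The derivative of \<open>1/f\<close> is again a product with factors \<open>1/f\<close>, to which the induction
  hypothesis applies; the same device proves smoothness of compositions and of local inverses.\<close>
lemma kdiff_inverse:
  fixes f :: "'a::real_normed_vector \<Rightarrow> real"
  assumes "open S" "kdiff k S f" "\<And>x. x \<in> S \<Longrightarrow> f x \<noteq> 0"
  shows "kdiff k S (\<lambda>x. inverse (f x))"
  using assms(2)
proof (induction k)
  case (Suc k)
  show ?case
  proof (rule kdiff_Suc_intro[OF \<open>open S\<close>])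
    show "((\<lambda>x. inverse (f x)) has_derivative (\<lambda>v. - (inverse (f x) * frechet_derivative f (at x) v * inverse (f x)))) (at x)" if "x \<in> S" for x
      by (rule Deriv.has_derivative_inverse[OF assms(3)[OF that] kdiff_has_derivative[OF Suc.prems that]])
  next
    have "kdiff k S (\<lambda>x. inverse (f x))" using Suc kdiff_SucD by blast
    then show "kdiff k S (\<lambda>x. - (inverse (f x) * frechet_derivative f (at x) v * inverse (f x)))" for v
      using Suc.prems by (intro kdiff_uminus kdiff_mult \<open>open S\<close>) auto
  qed
qed simp

lemma linear_Basis_expand:
  fixes D :: "'a::euclidean_space \<Rightarrow> 'b::real_vector"
  assumes "linear D" shows "D v = (\<Sum>b\<in>Basis. (v \<bullet> b) *\<^sub>R D b)"
proof -
  have "D v = D (\<Sum>b\<in>Basis. (v \<bullet> b) *\<^sub>R b)" by (simp add: euclidean_representation)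
  also have "\<dots> = (\<Sum>b\<in>Basis. (v \<bullet> b) *\<^sub>R D b)"
    by (simp add: linear_sum[OF assms] linear_scale[OF assms])
  finally show ?thesis .
qed

lemma kdiff_compose:
  fixes F :: "'a::real_normed_vector \<Rightarrow> 'b::euclidean_space"
  assumes "open S" "kdiff k T f" "kdiff k S F" "F ` S \<subseteq> T"
  shows "kdiff k S (\<lambda>x. f (F x))"
  using assms(2,3)
proof (induction k arbitrary: f)
  case (Suc k)
  show ?case
  proof (rule kdiff_Suc_intro[OF \<open>open S\<close>])
    show "((\<lambda>x. f (F x)) has_derivative (\<lambda>v. \<Sum>b\<in>Basis. (frechet_derivative F (at x) v \<bullet> b) *\<^sub>R frechet_derivative f (at (F x)) b)) (at x)"
      if "x \<in> S" for x
    proof -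
      have d: "(f has_derivative frechet_derivative f (at (F x))) (at (F x))"
        using kdiff_has_derivative[OF Suc.prems(1)] assms(4) that by auto
      have "linear (frechet_derivative f (at (F x)))" using d has_derivative_linear by blast
      then have "(\<lambda>v. frechet_derivative f (at (F x)) (frechet_derivative F (at x) v)) =
        (\<lambda>v. \<Sum>b\<in>Basis. (frechet_derivative F (at x) v \<bullet> b) *\<^sub>R frechet_derivative f (at (F x)) b)"
        by (intro ext linear_Basis_expand)
      with has_derivative_compose[OF kdiff_has_derivative[OF Suc.prems(2) that] d]
      show ?thesis by (rule subst[rotated])
    qed
  next
    have "kdiff k S (\<lambda>x. frechet_derivative f (at (F x)) b)" for b
      using Suc.prems kdiff_SucD[OF Suc.prems(2)] by (intro Suc.IH) auto
    then show "kdiff k S (\<lambda>x. \<Sum>b\<in>Basis. (frechet_derivative F (at x) v \<bullet> b) *\<^sub>R frechet_derivative f (at (F x)) b)" for v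
      using Suc.prems by (intro kdiff_sum kdiff_scaleR kdiff_inner kdiff_const \<open>open S\<close>) auto
  qed
qed simp

lemma smooth_on_continuous:
  assumes "smooth_on S f" shows "continuous_on S f"
proof -
  have "kdiff (Suc 0) S f" using assms unfolding smooth_on_iff_kdiff by (rule spec)
  then have "f differentiable (at x)" if "x \<in> S" for x
    using that by simp
  then show ?thesis
    by (meson continuous_at_imp_continuous_on differentiable_imp_continuous_within)
qed

lemma smooth_on_has_derivative:
  assumes "smooth_on S f" "x \<in> S" shows "(f has_derivative frechet_derivative f (at x)) (at x)"
proof -
  have "kdiff (Suc 0) S f" using assms(1) unfolding smooth_on_iff_kdiff by (rule spec)
  then show ?thesis by (rule kdiff_has_derivative[OF _ assms(2)])
qed

lemma smooth_on_directional_derivative: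
  assumes "smooth_on S f" shows "smooth_on S (\<lambda>x. frechet_derivative f (at x) v)"
  unfolding smooth_on_iff_kdiff
proof
  fix k
  have "kdiff (Suc k) S f" using assms unfolding smooth_on_iff_kdiff by (rule spec)
  then show "kdiff k S (\<lambda>x. frechet_derivative f (at x) v)" by simp
qed

lemma smooth_on_iter_deriv: "smooth_on S f \<Longrightarrow> smooth_on S (iter_deriv vs f)"
  by (induction vs) (auto intro: smooth_on_directional_derivative)

lemma smooth_on_compose:
  fixes F :: "'a::real_normed_vector \<Rightarrow> 'b::euclidean_space"
  assumes "open S" "smooth_on T f" "smooth_on S F" "F ` S \<subseteq> T"
  shows "smooth_on S (\<lambda>x. f (F x))"
  using assms kdiff_compose unfolding smooth_on_iff_kdiff by blast

lemma smooth_on_add: "open S \<Longrightarrow> smooth_on S f \<Longrightarrow> smooth_on S h \<Longrightarrow> smooth_on S (\<lambda>x. f x + h x)"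
  unfolding smooth_on_iff_kdiff using kdiff_add[of S _ f h] by blast

lemma smooth_on_sum:
  "open S \<Longrightarrow> (\<And>i. i \<in> I \<Longrightarrow> smooth_on S (f i)) \<Longrightarrow> smooth_on S (\<lambda>x. \<Sum>i\<in>I. f i x)"
  unfolding smooth_on_iff_kdiff using kdiff_sum[of S I _ f] by blast

lemma smooth_on_mult:
  fixes f h :: "'a::real_normed_vector \<Rightarrow> real"
  shows "open S \<Longrightarrow> smooth_on S f \<Longrightarrow> smooth_on S h \<Longrightarrow> smooth_on S (\<lambda>x. f x * h x)"
  unfolding smooth_on_iff_kdiff using kdiff_mult[of S _ f h] by blast

lemma smooth_on_diff: "open S \<Longrightarrow> smooth_on S f \<Longrightarrow> smooth_on S h \<Longrightarrow> smooth_on S (\<lambda>x. f x - h x)"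
  unfolding smooth_on_iff_kdiff using kdiff_diff[of S _ f h] by blast

lemma smooth_on_inner:
  "open S \<Longrightarrow> smooth_on S f \<Longrightarrow> smooth_on S h \<Longrightarrow> smooth_on S (\<lambda>x. f x \<bullet> h x)"
  unfolding smooth_on_iff_kdiff using kdiff_inner[of S _ f h] by blast

lemma smooth_on_const: "open S \<Longrightarrow> smooth_on S (\<lambda>x. c)"
  unfolding smooth_on_iff_kdiff using kdiff_const by blast

lemma smooth_on_linear: "bounded_linear L \<Longrightarrow> open S \<Longrightarrow> smooth_on S L"
  unfolding smooth_on_iff_kdiff using kdiff_linear by blast

lemma smooth_on_cong:
  assumes "open S" "smooth_on S f" "\<And>x. x \<in> S \<Longrightarrow> f x = h x" shows "smooth_on S h"
  using assms kdiff_cong[of S f h] unfolding smooth_on_iff_kdiff by blast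

section \<open>Sard's theorem for real-valued functions\<close>

text \<open>In dimension \<open>n\<close>, a grid of mesh \<open>1/m\<close> on a bounded set has \<open>O(m\<^sup>n)\<close> cells, and the image of each has length
  \<open>O(1/m\<^sup>n\<^sup>+\<^sup>1)\<close>.\<close>
lemma negligible_image_flat:
  fixes f :: "'a::euclidean_space \<Rightarrow> real"
  assumes "bounded X"
    and flat: "\<And>x y. x \<in> X \<Longrightarrow> y \<in> X \<Longrightarrow> \<bar>f y - f x\<bar> \<le> M * norm (y - x) ^ (DIM('a) + 1)"
  shows "negligible (f ` X)"
proof -
  define N where "N = DIM('a)"
  obtain R0 where R0: "\<And>x. x \<in> X \<Longrightarrow> norm x \<le> R0"
    using \<open>bounded X\<close> bounded_iff by blast
  define R where "R = max R0 1"
  have R: "R > 0" "\<And>x. x \<in> X \<Longrightarrow> norm x \<le> R"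
    using R0 unfolding R_def by (auto simp: le_max_iff_disj)
  define K where "K = max M 0"
  have flatK: "\<bar>f y - f x\<bar> \<le> K * norm (y - x) ^ (N + 1)" if "x \<in> X" "y \<in> X" for x y
  proof -
    have "M * norm (y - x) ^ (N + 1) \<le> K * norm (y - x) ^ (N + 1)"
      by (rule mult_right_mono) (auto simp: K_def)
    then show ?thesis using flat[OF that] unfolding N_def by linarith
  qed
  define C where "C = 3 ^ N * (2 * K * (real N * R) ^ (N + 1))"
  have cover: "\<exists>T. f ` X \<subseteq> T \<and> T \<in> lmeasurable \<and> measure lebesgue T \<le> C / real m"
    if "m > 0" for m :: nat
  proof -
    \<comment> \<open>The cell of \<open>x\<close>: the coordinates range over \<open>[-R, R]\<close>, cut into intervals of length \<open>R/m\<close>.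
      The right end point accounts for the index \<open>2 * m\<close>.\<close>
    define \<iota> where "\<iota> x = (\<lambda>b\<in>Basis. nat \<lfloor>(x \<bullet> b + R) * real m / R\<rfloor>)" for x :: 'a
    define I where "I = PiE (Basis :: 'a set) (\<lambda>_. {..2 * m})"
    define \<delta> where "\<delta> = K * (real N * R / real m) ^ (N + 1)"
    have "\<delta> \<ge> 0" unfolding \<delta>_def K_def using R that by simp
    define c where "c i = f (SOME x. x \<in> X \<and> \<iota> x = i)" for i
    define T where "T = (\<Union>i\<in>I. cbox (c i - \<delta>) (c i + \<delta>))"
    have finI: "finite I" unfolding I_def by (intro finite_PiE) auto
    have cardI: "card I = (2 * m + 1) ^ N"
      unfolding I_def N_def by (simp add: card_PiE)
    have inI: "\<iota> x \<in> I" if "x \<in> X" for x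
    proof -
      have "nat \<lfloor>(x \<bullet> b + R) * real m / R\<rfloor> \<le> 2 * m" if "b \<in> Basis" for b
      proof -
        have "\<bar>x \<bullet> b\<bar> \<le> R" using Basis_le_norm[OF that, of x] R(2)[OF \<open>x \<in> X\<close>] by linarith
        then have "(x \<bullet> b + R) * real m \<le> (2 * R) * real m"
          by (intro mult_right_mono) auto
        then have "(x \<bullet> b + R) * real m / R \<le> real (2 * m)"
          using R(1) by (simp add: field_simps)
        then show ?thesis by (simp add: nat_le_iff floor_le_iff) 
      qed
      then show ?thesis unfolding \<iota>_def I_def by auto
    qed
    have close: "norm (y - x) \<le> real N * R / real m" if "x \<in> X" "y \<in> X" "\<iota> x = \<iota> y" for x y
    proof -
      have "\<bar>(y - x) \<bullet> b\<bar> \<le> R / real m" if b: "b \<in> Basis" for b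
      proof -
        have "\<bar>x \<bullet> b\<bar> \<le> R" "\<bar>y \<bullet> b\<bar> \<le> R"
          using Basis_le_norm[OF b, of x] R(2)[OF \<open>x \<in> X\<close>] Basis_le_norm[OF b, of y] R(2)[OF \<open>y \<in> X\<close>] by linarith+
        then have p: "(x \<bullet> b + R) * real m / R \<ge> 0" "(y \<bullet> b + R) * real m / R \<ge> 0"
          using R(1) by auto
        have "nat \<lfloor>(x \<bullet> b + R) * real m / R\<rfloor> = nat \<lfloor>(y \<bullet> b + R) * real m / R\<rfloor>"
          using fun_cong[OF \<open>\<iota> x = \<iota> y\<close>, of b] b unfolding \<iota>_def by simp
        then have "\<lfloor>(x \<bullet> b + R) * real m / R\<rfloor> = \<lfloor>(y \<bullet> b + R) * real m / R\<rfloor>"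
          using p by (metis eq_nat_nat_iff zero_le_floor)
        then have "\<bar>(y \<bullet> b + R) * real m / R - (x \<bullet> b + R) * real m / R\<bar> \<le> 1"
          by linarith
        moreover have "(y \<bullet> b + R) * real m / R - (x \<bullet> b + R) * real m / R = ((y - x) \<bullet> b) * (real m / R)"
          using R(1) by (simp add: field_simps inner_diff_left)
        ultimately have "\<bar>(y - x) \<bullet> b\<bar> * (real m / R) \<le> 1"
          using R(1) by (simp add: abs_mult)
        then show ?thesis using R(1) \<open>m > 0\<close> by (simp add: field_simps)
      qed
      then have "(\<Sum>b\<in>Basis. \<bar>(y - x) \<bullet> b\<bar>) \<le> real N * (R / real m)"
        using sum_bounded_above[of Basis "\<lambda>b. \<bar>(y - x) \<bullet> b\<bar>" "R / real m"] unfolding N_def by simp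
      then show ?thesis using norm_le_l1[of "y - x"] by simp
    qed
    have "f ` X \<subseteq> T"
    proof
      fix z assume "z \<in> f ` X"
      then obtain x where x: "x \<in> X" "z = f x" by blast
      define x' where "x' = (SOME x'. x' \<in> X \<and> \<iota> x' = \<iota> x)"
      have x': "x' \<in> X \<and> \<iota> x' = \<iota> x" unfolding x'_def by (rule someI[of _ x]) (use x in auto)
      have "\<bar>f x - f x'\<bar> \<le> K * norm (x - x') ^ (N + 1)" using flatK x x' by blast
      also have "\<dots> \<le> \<delta>" unfolding \<delta>_def
        using close[of x' x] x x' by (intro mult_left_mono power_mono) (auto simp: K_def)
      finally have "\<bar>f x - f x'\<bar> \<le> \<delta>" .
      moreover have "c (\<iota> x) = f x'" unfolding c_def x'_def ..
      ultimately have "z \<in> cbox (c (\<iota> x) - \<delta>) (c (\<iota> x) + \<delta>)"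
        using x by (simp add: abs_le_iff)
      then show "z \<in> T" unfolding T_def using inI[OF x(1)] by blast
    qed
    moreover have "T \<in> lmeasurable"
      unfolding T_def by (intro fmeasurable.finite_UN finI) auto
    moreover have "measure lebesgue T \<le> C / real m"
    proof -
      have "measure lebesgue T \<le> (\<Sum>i\<in>I. measure lebesgue (cbox (c i - \<delta>) (c i + \<delta>)))"
        unfolding T_def by (intro measure_UNION_le finI) auto
      also have "\<dots> = real ((2 * m + 1) ^ N) * (2 * \<delta>)"
        using \<open>\<delta> \<ge> 0\<close> cardI by simp
      also have "\<dots> \<le> (3 * real m) ^ N * (2 * \<delta>)"
      proof (rule mult_right_mono)
        show "real ((2 * m + 1) ^ N) \<le> (3 * real m) ^ N"
          unfolding of_nat_power by (rule power_mono) (use that in auto)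
      qed (use \<open>\<delta> \<ge> 0\<close> in auto)
      also have "\<dots> = C / real m"
        using that unfolding C_def \<delta>_def by (simp add: power_mult_distrib power_divide field_simps)
      finally show ?thesis .
    qed
    ultimately show ?thesis by blast
  qed
  show ?thesis
    unfolding negligible_outer_le
  proof (intro allI impI)
    fix e :: real assume "e > 0"
    obtain m :: nat where m: "m > 0" "C / e < real m"
      by (metis gt_ex less_trans not_gr_zero of_nat_0 of_nat_less_iff reals_Archimedean2 zero_less_Suc neq0_conv order_less_trans)
    then have "C / real m \<le> e" using \<open>e > 0\<close> by (simp add: field_simps)
    then show "\<exists>T. f ` X \<subseteq> T \<and> T \<in> lmeasurable \<and> measure lebesgue T \<le> e"
      using cover[OF m(1)] order_trans by blast
  qed
qed

text \<open>The increments are restricted to the coordinate plane spanned by \<open>B\<close>, so only the partial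
  derivatives along \<open>B\<close> enter.\<close>
lemma coordinate_plane_mean_value:
  fixes h :: "'a::euclidean_space \<Rightarrow> real"
  assumes "smooth_on S h" "convex K" "K \<subseteq> S" "x \<in> K" "y \<in> K" "B \<subseteq> Basis"
    and plane: "\<forall>b\<in>Basis - B. (y - x) \<bullet> b = 0"
    and bound: "\<And>z b. z \<in> closed_segment x y \<Longrightarrow> b \<in> B \<Longrightarrow> \<bar>frechet_derivative h (at z) b\<bar> \<le> C"
  shows "\<bar>h y - h x\<bar> \<le> real (card B) * C * norm (y - x)"
proof -
  define p where "p s = x + s *\<^sub>R (y - x)" for s :: real
  have seg: "p s \<in> closed_segment x y" if "s \<in> {0..1}" for s
    using that unfolding p_def closed_segment_def by (auto simp: algebra_simps intro!: exI[of _ s])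
  have segK: "closed_segment x y \<subseteq> K"
    using assms closed_segment_subset by blast
  have "((\<lambda>s. h (p s)) has_derivative (\<lambda>s. frechet_derivative h (at (p s0)) (s *\<^sub>R (y - x)))) (at s0 within {0..1})"
    if "s0 \<in> {0..1}" for s0
  proof -
    have "(p has_derivative (\<lambda>s. s *\<^sub>R (y - x))) (at s0 within {0..1})"
      unfolding p_def by (auto intro!: derivative_eq_intros)
    moreover have "(h has_derivative frechet_derivative h (at (p s0))) (at (p s0))"
      by (rule smooth_on_has_derivative[OF assms(1)]) (use seg[OF that] segK assms in blast)
    ultimately show ?thesis by (rule has_derivative_compose)
  qed
  then obtain s where s: "s \<in> {0<..<1}"
    "h (p 1) - h (p 0) = frechet_derivative h (at (p s)) ((1 - 0) *\<^sub>R (y - x))"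
    using mvt_simple[of 0 1 "\<lambda>s. h (p s)" "\<lambda>s0 s. frechet_derivative h (at (p s0)) (s *\<^sub>R (y - x))"]
    by (force simp: has_derivative_at_withinI)
  have ps: "p s \<in> closed_segment x y" using seg s by auto
  have "linear (frechet_derivative h (at (p s)))"
    using smooth_on_has_derivative[OF assms(1), of "p s"] ps segK assms(3) has_derivative_linear by blast
  then have "h y - h x = (\<Sum>b\<in>Basis. ((y - x) \<bullet> b) * frechet_derivative h (at (p s)) b)"
    using s(2) linear_Basis_expand[of "frechet_derivative h (at (p s))" "y - x"] unfolding p_def by simp
  also have "\<dots> = (\<Sum>b\<in>B. ((y - x) \<bullet> b) * frechet_derivative h (at (p s)) b)"
    using assms plane by (intro sum.mono_neutral_right) auto
  finally have eq: "h y - h x = (\<Sum>b\<in>B. ((y - x) \<bullet> b) * frechet_derivative h (at (p s)) b)" .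
  have "\<bar>h y - h x\<bar> \<le> (\<Sum>b\<in>B. \<bar>((y - x) \<bullet> b) * frechet_derivative h (at (p s)) b\<bar>)"
    unfolding eq by (rule sum_abs)
  also have "\<dots> \<le> (\<Sum>b\<in>B. C * norm (y - x))"
  proof (rule sum_mono)
    fix b assume b: "b \<in> B"
    have "\<bar>(y - x) \<bullet> b\<bar> \<le> norm (y - x)" using b assms by (intro Basis_le_norm) auto
    moreover have "\<bar>frechet_derivative h (at (p s)) b\<bar> \<le> C" by (rule bound[OF ps b])
    ultimately have "\<bar>(y - x) \<bullet> b\<bar> * \<bar>frechet_derivative h (at (p s)) b\<bar> \<le> norm (y - x) * C"
      by (intro mult_mono) auto
    then show "\<bar>((y - x) \<bullet> b) * frechet_derivative h (at (p s)) b\<bar> \<le> C * norm (y - x)"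
      by (simp add: abs_mult mult.commute)
  qed
  also have "\<dots> = real (card B) * C * norm (y - x)" by simp
  finally show ?thesis .
qed

text \<open>Where all derivatives of order \<open>1\<close> to \<open>j\<close> along the plane vanish, the induction hypothesis bounds each first
  derivative by a multiple of the \<open>(j+1)\<close>-st power of the distance along the whole segment, and
  the mean value theorem gains one more power. The constant is uniform on \<open>K\<close>.\<close>
lemma taylor_bound_coordinate_plane:
  fixes h :: "'a::euclidean_space \<Rightarrow> real"
  assumes "smooth_on S h" "compact K" "convex K" "K \<subseteq> S" "B \<subseteq> Basis"
  shows "\<exists>M\<ge>0. \<forall>x\<in>K. \<forall>y\<in>K. (\<forall>b\<in>Basis - B. (y - x) \<bullet> b = 0) \<longrightarrow>
     (\<forall>bs. set bs \<subseteq> B \<and> bs \<noteq> [] \<and> length bs \<le> j \<longrightarrow> iter_deriv bs h x = 0) \<longrightarrow>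
     \<bar>h y - h x\<bar> \<le> M * norm (y - x) ^ (j + 1)"
  using assms(1)
proof (induction j arbitrary: h)
  case 0
  have "\<exists>M. \<forall>z\<in>K. \<bar>frechet_derivative h (at z) b\<bar> \<le> M" for b
  proof -
    have "continuous_on K (\<lambda>z. frechet_derivative h (at z) b)"
      using smooth_on_continuous[OF smooth_on_directional_derivative[OF 0]] assms(4) continuous_on_subset by blast
    then have "bounded ((\<lambda>z. frechet_derivative h (at z) b) ` K)"
      using assms(2) compact_continuous_image compact_imp_bounded by blast
    then show ?thesis by (auto simp: bounded_iff)
  qed
  then obtain M where M: "\<And>z b. z \<in> K \<Longrightarrow> \<bar>frechet_derivative h (at z) b\<bar> \<le> M b" by metis
  define C where "C = (\<Sum>b\<in>B. \<bar>M b\<bar>)"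
  have "finite B" using assms(5) finite_Basis finite_subset by blast
  have C: "\<bar>frechet_derivative h (at z) b\<bar> \<le> C" if "z \<in> K" "b \<in> B" for z b
  proof -
    have "\<bar>M b\<bar> \<le> C" unfolding C_def by (rule member_le_sum) (use that \<open>finite B\<close> in auto)
    with M[OF that(1), of b] show ?thesis by linarith
  qed
  have "C \<ge> 0" unfolding C_def by (simp add: sum_nonneg)
  show ?case
  proof (intro exI[of _ "real (card B) * C"] conjI ballI impI)
    fix x y assume xy: "x \<in> K" "y \<in> K" "\<forall>b\<in>Basis - B. (y - x) \<bullet> b = 0"
    have "closed_segment x y \<subseteq> K" using xy assms closed_segment_subset by blast
    then show "\<bar>h y - h x\<bar> \<le> real (card B) * C * norm (y - x) ^ (0 + 1)"
      using coordinate_plane_mean_value[OF 0 assms(3,4) xy(1,2) assms(5) xy(3), of C] C by auto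
  qed (use \<open>C \<ge> 0\<close> in auto)
next
  case (Suc j)
  have "\<exists>M\<ge>0. \<forall>x\<in>K. \<forall>y\<in>K. (\<forall>b\<in>Basis - B. (y - x) \<bullet> b = 0) \<longrightarrow>
     (\<forall>bs. set bs \<subseteq> B \<and> bs \<noteq> [] \<and> length bs \<le> j \<longrightarrow> iter_deriv bs (\<lambda>x. frechet_derivative h (at x) b) x = 0) \<longrightarrow>
     \<bar>frechet_derivative h (at y) b - frechet_derivative h (at x) b\<bar> \<le> M * norm (y - x) ^ (j + 1)" for b
    using Suc.IH[OF smooth_on_directional_derivative[OF Suc.prems]] .
  then obtain M where M: "\<And>b. M b \<ge> 0" "\<And>b x y. x \<in> K \<Longrightarrow> y \<in> K \<Longrightarrow> (\<forall>b\<in>Basis - B. (y - x) \<bullet> b = 0) \<Longrightarrow>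
     (\<And>bs. set bs \<subseteq> B \<Longrightarrow> bs \<noteq> [] \<Longrightarrow> length bs \<le> j \<Longrightarrow> iter_deriv bs (\<lambda>x. frechet_derivative h (at x) b) x = 0) \<Longrightarrow>
     \<bar>frechet_derivative h (at y) b - frechet_derivative h (at x) b\<bar> \<le> M b * norm (y - x) ^ (j + 1)"
    by metis
  define C where "C = (\<Sum>b\<in>B. M b)"
  have "finite B" using assms(5) finite_Basis finite_subset by blast
  have C: "M b \<le> C" if "b \<in> B" for b
    unfolding C_def by (rule member_le_sum) (use that \<open>finite B\<close> M in auto)
  have "C \<ge> 0" unfolding C_def using M by (simp add: sum_nonneg)
  show ?case
  proof (intro exI[of _ "real (card B) * C"] conjI ballI impI)
    fix x y assume xy: "x \<in> K" "y \<in> K" "\<forall>b\<in>Basis - B. (y - x) \<bullet> b = 0"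
      and van: "\<forall>bs. set bs \<subseteq> B \<and> bs \<noteq> [] \<and> length bs \<le> Suc j \<longrightarrow> iter_deriv bs h x = 0"
    have segK: "closed_segment x y \<subseteq> K" using xy assms closed_segment_subset by blast
    have "\<bar>frechet_derivative h (at z) b\<bar> \<le> C * norm (y - x) ^ (j + 1)"
      if z: "z \<in> closed_segment x y" and b: "b \<in> B" for z b
    proof -
      obtain s where s: "0 \<le> s" "s \<le> 1" "z = (1 - s) *\<^sub>R x + s *\<^sub>R y"
        using z unfolding closed_segment_def by blast
      then have zx: "z - x = s *\<^sub>R (y - x)" by (simp add: algebra_simps)
      have "frechet_derivative h (at x) b = 0"
        using van[rule_format, of "[b]"] b by simp
      moreover have "iter_deriv bs (\<lambda>x. frechet_derivative h (at x) b) x = 0"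
        if "set bs \<subseteq> B" "bs \<noteq> []" "length bs \<le> j" for bs
        using van[rule_format, of "bs @ [b]"] b that by (simp add: iter_deriv_append)
      ultimately have "\<bar>frechet_derivative h (at z) b\<bar> \<le> M b * norm (z - x) ^ (j + 1)"
        using M(2)[of x z b] xy z segK by (auto simp: zx)
      also have "\<dots> \<le> C * norm (y - x) ^ (j + 1)"
      proof (intro mult_mono power_mono)
        show "norm (z - x) \<le> norm (y - x)"
          unfolding zx using s by (simp add: mult_left_le_one_le)
      qed (use C[OF b] \<open>C \<ge> 0\<close> in auto)
      finally show ?thesis .
    qed
    then have "\<bar>h y - h x\<bar> \<le> real (card B) * (C * norm (y - x) ^ (j + 1)) * norm (y - x)"
      by (rule coordinate_plane_mean_value[OF Suc.prems assms(3,4) xy(1,2) assms(5) xy(3)])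
    then show "\<bar>h y - h x\<bar> \<le> real (card B) * C * norm (y - x) ^ (Suc j + 1)"
      by (simp add: mult_ac)
  qed (use \<open>C \<ge> 0\<close> in auto)
qed

text \<open>Replacing the coordinate along \<open>b\<close> by \<open>w\<close> gives local coordinates \<open>\<Phi>(x) = x + (w x - x \<bullet> b) b\<close>
  in which the hypersurface \<open>w = 0\<close> is a coordinate hyperplane. The inverse \<open>\<Psi>\<close> exists by
  the inverse function theorem; its derivative is a rational expression in derivatives of \<open>w\<close> composed
  with \<open>\<Psi>\<close>, and so \<open>\<Psi>\<close> is as often differentiable as one likes.\<close>
lemma smooth_local_straightening:
  fixes w :: "'a::euclidean_space \<Rightarrow> real"
  assumes "open S" "smooth_on S w" "p \<in> S" "b \<in> Basis" "frechet_derivative w (at p) b \<noteq> 0"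
  obtains U V \<Psi> where "open U" "p \<in> U" "U \<subseteq> S" "open V" "\<Psi> ` V \<subseteq> U" "smooth_on V \<Psi>"
    "\<And>x. x \<in> U \<Longrightarrow> x + (w x - x \<bullet> b) *\<^sub>R b \<in> V \<and> \<Psi> (x + (w x - x \<bullet> b) *\<^sub>R b) = x"
    "\<And>y v. y \<in> V \<Longrightarrow> (\<Psi> has_derivative
       (\<lambda>v. v + ((v \<bullet> b - frechet_derivative w (at (\<Psi> y)) v) / frechet_derivative w (at (\<Psi> y)) b) *\<^sub>R b)) (at y)"
proof -
  define \<Phi> where "\<Phi> x = x + (w x - x \<bullet> b) *\<^sub>R b" for x
  define d where "d x = frechet_derivative w (at x)" for x
  define S0 where "S0 = {x \<in> S. d x b \<noteq> 0}"
  have contd: "continuous_on S (\<lambda>x. d x v)" for v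
    unfolding d_def by (intro smooth_on_continuous smooth_on_directional_derivative assms)
  have "S0 = S \<inter> (\<lambda>x. d x b) -` (- {0})" unfolding S0_def by auto
  then have "open S0" using continuous_open_preimage[OF contd \<open>open S\<close>, of "- {0}" b] by auto
  have hd: "(w has_derivative d x) (at x)" if "x \<in> S" for x
    unfolding d_def by (rule smooth_on_has_derivative[OF assms(2) that])
  have bld: "bounded_linear (d x)" if "x \<in> S" for x
    using hd[OF that] has_derivative_bounded_linear by blast
  define f' where "f' x = Blinfun (\<lambda>v. v + (d x v - v \<bullet> b) *\<^sub>R b)" for x
  have f': "blinfun_apply (f' x) = (\<lambda>v. v + (d x v - v \<bullet> b) *\<^sub>R b)" if "x \<in> S" for x
    unfolding f'_def
    by (intro bounded_linear_Blinfun_apply bounded_linear_add bounded_linear_ident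
        bounded_linear_scaleR_const bounded_linear_sub bounded_linear_inner_left bld[OF that])
  \<comment> \<open>The inverse of \<open>f' x\<close>: it can change a vector only along \<open>b\<close>, and solving for that multiple needs
    \<open>d x b \<noteq> 0\<close>.\<close>
  define k where "k x v = v + ((v \<bullet> b - d x v) / d x b) *\<^sub>R b" for x v
  have bb: "b \<bullet> b = 1" using \<open>b \<in> Basis\<close> by simp
  have kf: "k x (f' x v) = v" "f' x (k x v) = v" if "x \<in> S0" for x v
  proof -
    have "x \<in> S" "d x b \<noteq> 0" using that unfolding S0_def by auto
    interpret D: bounded_linear "d x" by (rule bld[OF \<open>x \<in> S\<close>])
    define a where "a = d x v - v \<bullet> b"
    have "(v + a *\<^sub>R b) \<bullet> b - d x (v + a *\<^sub>R b) = - a * d x b"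
      by (simp add: D.add D.scaleR inner_add_left bb) (simp add: a_def)
    then show "k x (f' x v) = v"
      unfolding f'[OF \<open>x \<in> S\<close>] k_def a_def[symmetric] using \<open>d x b \<noteq> 0\<close> by simp
    define c where "c = (v \<bullet> b - d x v) / d x b"
    have "c * d x b = v \<bullet> b - d x v" using \<open>d x b \<noteq> 0\<close> unfolding c_def by simp
    then have "d x (v + c *\<^sub>R b) - (v + c *\<^sub>R b) \<bullet> b = - c"
      by (simp add: D.add D.scaleR inner_add_left bb)
    then show "f' x (k x v) = v"
      unfolding f'[OF \<open>x \<in> S\<close>] k_def c_def[symmetric] by simp
  qed
  have "p \<in> S0" using assms unfolding S0_def d_def by auto
  have blk: "bounded_linear (k p)"
  proof -
    have "k p = (\<lambda>v. v + (inverse (d p b) * (v \<bullet> b - d p v)) *\<^sub>R b)"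
      unfolding k_def by (simp add: divide_inverse mult.commute)
    then show ?thesis
      by (simp, intro bounded_linear_add bounded_linear_ident bounded_linear_scaleR_const
          bounded_linear_const_mult bounded_linear_sub bounded_linear_inner_left bld[OF assms(3)])
  qed
  obtain U V \<Psi> \<Psi>' where UV: "open U" "U \<subseteq> S0" "p \<in> U" "open V" "\<Phi> p \<in> V" "homeomorphism U V \<Phi> \<Psi>"
    "\<And>y. y \<in> V \<Longrightarrow> (\<Psi> has_derivative (\<Psi>' y)) (at y)"
    "\<And>y. y \<in> V \<Longrightarrow> \<Psi>' y = inv (blinfun_apply (f' (\<Psi> y)))"
    "\<And>y. y \<in> V \<Longrightarrow> bij (blinfun_apply (f' (\<Psi> y)))"
  proof (rule inverse_function_theorem[OF \<open>open S0\<close>, of \<Phi> f' p "Blinfun (k p)"])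
    show "(\<Phi> has_derivative blinfun_apply (f' x)) (at x)" if "x \<in> S0" for x
    proof -
      have "x \<in> S" using that S0_def by auto
      show ?thesis unfolding f'[OF \<open>x \<in> S\<close>] \<Phi>_def
        by (auto intro!: derivative_eq_intros hd[OF \<open>x \<in> S\<close>])
    qed
    show "continuous_on S0 f'"
    proof (rule continuous_on_blinfun_componentwise)
      fix i :: 'a
      have "continuous_on S0 (\<lambda>x. i + (d x i - i \<bullet> b) *\<^sub>R b)"
        by (intro continuous_intros continuous_on_subset[OF contd]) (auto simp: S0_def)
      then show "continuous_on S0 (\<lambda>x. blinfun_apply (f' x) i)"
        by (rule continuous_on_eq) (auto simp: f' S0_def)
    qed
    show "Blinfun (k p) o\<^sub>L f' p = id_blinfun"
      by (rule blinfun_eqI) (simp add: bounded_linear_Blinfun_apply[OF blk] kf[OF \<open>p \<in> S0\<close>])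
  qed (use \<open>p \<in> S0\<close> in auto)
  have \<Psi>U: "\<Psi> ` V \<subseteq> U" using UV(6) unfolding homeomorphism_def by auto
  have \<Psi>': "\<Psi>' y = k (\<Psi> y)" if "y \<in> V" for y
  proof
    fix v
    have "\<Psi> y \<in> S0" using \<Psi>U UV(2) that by blast
    show "\<Psi>' y v = k (\<Psi> y) v"
      unfolding UV(8)[OF that] using kf(2)[OF \<open>\<Psi> y \<in> S0\<close>, of v] bij_is_inj[OF UV(9)[OF that]]
      by (simp add: inv_f_eq)
  qed
  have der: "(\<Psi> has_derivative k (\<Psi> y)) (at y)" if "y \<in> V" for y
    using UV(7)[OF that] \<Psi>'[OF that] by simp
  have "kdiff n V \<Psi>" for n
  proof (induction n)
    case (Suc n)
    have dk: "kdiff n V (\<lambda>y. d (\<Psi> y) v)" for v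
    proof (rule kdiff_compose[OF \<open>open V\<close> _ Suc, of S "\<lambda>x. d x v"])
      show "kdiff n S (\<lambda>x. d x v)"
        using smooth_on_directional_derivative[OF assms(2), of v]
        unfolding d_def smooth_on_iff_kdiff by (rule spec)
      show "\<Psi> ` V \<subseteq> S" using \<Psi>U UV(2) S0_def by auto
    qed
    have nz: "d (\<Psi> y) b \<noteq> 0" if "y \<in> V" for y
      using \<Psi>U UV(2) S0_def that by auto
    show ?case
    proof (rule kdiff_Suc_intro[OF \<open>open V\<close> der])
      show "kdiff n V (\<lambda>y. k (\<Psi> y) v)" for v
        unfolding k_def divide_inverse
        by (intro kdiff_add kdiff_scaleR kdiff_mult kdiff_diff kdiff_const kdiff_inverse dk nz \<open>open V\<close>)
    qed
  qed simp
  then have sm: "smooth_on V \<Psi>" unfolding smooth_on_iff_kdiff by blast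
  show ?thesis
  proof (rule that[OF UV(1,3) _ UV(4) \<Psi>U sm])
    show "U \<subseteq> S" using UV(2) S0_def by auto
    show "x + (w x - x \<bullet> b) *\<^sub>R b \<in> V \<and> \<Psi> (x + (w x - x \<bullet> b) *\<^sub>R b) = x" if "x \<in> U" for x
      using UV(6) that unfolding homeomorphism_def \<Phi>_def by auto
    show "(\<Psi> has_derivative
       (\<lambda>v. v + ((v \<bullet> b - frechet_derivative w (at (\<Psi> y)) v) / frechet_derivative w (at (\<Psi> y)) b) *\<^sub>R b)) (at y)"
      if "y \<in> V" for y
      using der[OF that] unfolding k_def d_def .
  qed
qed

lemma negligible_locally:
  fixes f :: "'a::euclidean_space \<Rightarrow> real"
  assumes "\<And>p. p \<in> X \<Longrightarrow> \<exists>U. open U \<and> p \<in> U \<and> negligible (f ` (X \<inter> U))"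
  shows "negligible (f ` X)"
proof -
  obtain U where U: "\<And>p. p \<in> X \<Longrightarrow> open (U p) \<and> p \<in> U p \<and> negligible (f ` (X \<inter> U p))"
    using assms by metis
  obtain F where F: "F \<subseteq> U ` X" "countable F" "\<Union>F = \<Union>(U ` X)"
    using Lindelof[of "U ` X"] U by blast
  have "negligible (\<Union>((\<lambda>V. f ` (X \<inter> V)) ` F))"
    using F U by (intro negligible_countable_Union) auto
  moreover have "f ` X \<subseteq> \<Union>((\<lambda>V. f ` (X \<inter> V)) ` F)"
  proof
    fix z assume "z \<in> f ` X"
    then obtain x where x: "x \<in> X" "z = f x" by blast
    then have "x \<in> \<Union>F" using F(3) U by blast
    then show "z \<in> \<Union>((\<lambda>V. f ` (X \<inter> V)) ` F)" using x by blast
  qed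
  ultimately show ?thesis using negligible_subset by blast
qed

text \<open>The induction is on the dimension of a coordinate plane, with \<open>f\<close> varying. A critical point of \<open>f\<close> on
  the plane spanned by \<open>B\<close> is of one of two kinds. Either all derivatives up to order \<open>DIM('a)\<close> along
  the plane vanish there, and these points have a null image by Taylor's bound. Or some iterated derivative
  \<open>w\<close> of positive order vanishes there while its derivative along some \<open>b\<close> in \<open>B\<close> does not. The points of the latter
  kind lie on the hypersurface \<open>w = 0\<close>, which straightening turns into the plane
  spanned by \<open>B - {b}\<close>; they remain critical for \<open>f\<close> in the new coordinates.\<close>
lemma sard_coordinate_plane:
  fixes f :: "'a::euclidean_space \<Rightarrow> real"
  assumes "finite B" "B \<subseteq> Basis" "open S" "smooth_on S f"
  shows "negligible (f ` {x\<in>S. (\<forall>b\<in>Basis - B. x \<bullet> b = 0) \<and> (\<forall>b\<in>B. frechet_derivative f (at x) b = 0)})"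
  using assms
proof (induction B arbitrary: S f rule: finite_psubset_induct)
  case (psubset B)
  define Cr where "Cr = {x\<in>S. (\<forall>b\<in>Basis - B. x \<bullet> b = 0) \<and> (\<forall>b\<in>B. frechet_derivative f (at x) b = 0)}"
  define N where "N = DIM('a)"
  define Fl where "Fl = {x\<in>Cr. \<forall>bs. set bs \<subseteq> B \<and> bs \<noteq> [] \<and> length bs \<le> N \<longrightarrow> iter_deriv bs f x = 0}"
  define A where "A bs b = {x\<in>Cr. iter_deriv bs f x = 0 \<and> frechet_derivative (iter_deriv bs f) (at x) b \<noteq> 0}" for bs b
  have fl: "negligible (f ` Fl)"
  proof (rule negligible_locally)
    fix p assume "p \<in> Fl"
    then have "p \<in> S" unfolding Fl_def Cr_def by auto
    then obtain e where e: "e > 0" "cball p e \<subseteq> S"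
      using \<open>open S\<close> open_contains_cball by blast
    obtain M where M: "M \<ge> 0" "\<And>x y. x \<in> cball p e \<Longrightarrow> y \<in> cball p e \<Longrightarrow> (\<forall>b\<in>Basis - B. (y - x) \<bullet> b = 0) \<Longrightarrow>
     (\<forall>bs. set bs \<subseteq> B \<and> bs \<noteq> [] \<and> length bs \<le> N \<longrightarrow> iter_deriv bs f x = 0) \<Longrightarrow>
     \<bar>f y - f x\<bar> \<le> M * norm (y - x) ^ (N + 1)"
      using taylor_bound_coordinate_plane[OF psubset.prems(3) compact_cball convex_cball e(2) psubset.prems(1), of N]
      by blast
    have "negligible (f ` (Fl \<inter> ball p e))"
    proof (rule negligible_image_flat)
      show "\<bar>f y - f x\<bar> \<le> M * norm (y - x) ^ (DIM('a) + 1)" if "x \<in> Fl \<inter> ball p e" "y \<in> Fl \<inter> ball p e" for x y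
        using M(2)[of x y] that unfolding Fl_def Cr_def N_def by (auto simp: inner_diff_left)
    qed (simp add: bounded_Int)
    then show "\<exists>U. open U \<and> p \<in> U \<and> negligible (f ` (Fl \<inter> U))"
      using e(1) by (intro exI[of _ "ball p e"]) auto
  qed
  have nondeg: "negligible (f ` A bs b)" if b: "b \<in> B" for bs b
  proof (rule negligible_locally)
    fix p assume p: "p \<in> A bs b"
    define w where "w = iter_deriv bs f"
    have smw: "smooth_on S w" unfolding w_def by (rule smooth_on_iter_deriv[OF psubset.prems(3)])
    have pS: "p \<in> S" "frechet_derivative w (at p) b \<noteq> 0" using p unfolding A_def Cr_def w_def by auto
    have bB: "b \<in> Basis" using b psubset.prems by auto
    obtain U V \<Psi> where UV: "open U" "p \<in> U" "U \<subseteq> S" "open V" "\<Psi> ` V \<subseteq> U" "smooth_on V \<Psi>"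
      and inv: "\<And>x. x \<in> U \<Longrightarrow> x + (w x - x \<bullet> b) *\<^sub>R b \<in> V \<and> \<Psi> (x + (w x - x \<bullet> b) *\<^sub>R b) = x"
      and der: "\<And>y v. y \<in> V \<Longrightarrow> (\<Psi> has_derivative
       (\<lambda>v. v + ((v \<bullet> b - frechet_derivative w (at (\<Psi> y)) v) / frechet_derivative w (at (\<Psi> y)) b) *\<^sub>R b)) (at y)"
      using smooth_local_straightening[OF psubset.prems(2) smw pS(1) bB pS(2)] by blast
    define h where "h y = f (\<Psi> y)" for y
    have smh: "smooth_on V h"
      unfolding h_def using UV by (intro smooth_on_compose[OF UV(4) psubset.prems(3) UV(6)]) auto
    let ?X = "{y\<in>V. (\<forall>c\<in>Basis - (B - {b}). y \<bullet> c = 0) \<and> (\<forall>c\<in>B - {b}. frechet_derivative h (at y) c = 0)}"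
    have "negligible (h ` ?X)"
      by (rule psubset.IH) (use b psubset.prems UV smh in auto)
    moreover have "f ` (A bs b \<inter> U) \<subseteq>
      h ` ?X"
    proof
      fix z assume "z \<in> f ` (A bs b \<inter> U)"
      then obtain x where x: "x \<in> A bs b" "x \<in> U" "z = f x" by blast
      define y where "y = x + (w x - x \<bullet> b) *\<^sub>R b"
      have y: "y \<in> V" "\<Psi> y = x" using inv[OF x(2)] unfolding y_def by auto
      have "w x = 0" using x(1) unfolding A_def w_def by auto
      then have yb: "y \<bullet> b = 0" unfolding y_def using bB by (simp add: inner_add_left inner_diff_left)
      have yc: "y \<bullet> c = 0" if "c \<in> Basis - (B - {b})" for c
      proof (cases "c = b")
        case False
        then have "x \<bullet> c = 0" using that x(1) unfolding A_def Cr_def by auto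
        then show ?thesis unfolding y_def using that bB False by (auto simp: inner_add_left inner_not_same_Basis)
      qed (use yb in simp)
      have xS: "x \<in> S" using x UV by auto
      have df: "(f has_derivative frechet_derivative f (at x)) (at x)"
        by (rule smooth_on_has_derivative[OF psubset.prems(3) xS])
      have crit: "frechet_derivative f (at x) c = 0" if "c \<in> B" for c
        using x(1) that unfolding A_def Cr_def by auto
      have "frechet_derivative h (at y) c = 0" if c: "c \<in> B - {b}" for c
      proof -
        let ?F = "\<lambda>v. frechet_derivative f (at x) (v + ((v \<bullet> b - frechet_derivative w (at (\<Psi> y)) v) / frechet_derivative w (at (\<Psi> y)) b) *\<^sub>R b)"
        have "((\<lambda>y. f (\<Psi> y)) has_derivative ?F) (at y)"
          by (rule has_derivative_compose[OF der[OF y(1)]]) (use df y in simp)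
        then have "frechet_derivative h (at y) = ?F"
          unfolding h_def by (rule frechet_derivative_at[symmetric])
        moreover have "linear (frechet_derivative f (at x))" using df has_derivative_linear by blast
        ultimately show ?thesis using crit b c by (simp add: linear_add linear_scale)
      qed
      then show "z \<in> h ` ?X"
        using y yc x(3) unfolding h_def by (intro image_eqI[of _ _ y]) auto
    qed
    ultimately have "negligible (f ` (A bs b \<inter> U))" using negligible_subset by blast
    then show "\<exists>U. open U \<and> p \<in> U \<and> negligible (f ` (A bs b \<inter> U))" using UV by blast
  qed
  define L where "L = {bs. set bs \<subseteq> B \<and> length bs \<le> N}"
  have finL: "finite L" unfolding L_def by (rule finite_lists_length_le[OF psubset.hyps])
  have "Cr \<subseteq> Fl \<union> (\<Union>(bs, b)\<in>L \<times> B. A bs b)"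
  proof
    fix x assume x: "x \<in> Cr"
    show "x \<in> Fl \<union> (\<Union>(bs, b)\<in>L \<times> B. A bs b)"
    proof (cases "x \<in> Fl")
      case False
      \<comment> \<open>A nonzero iterated derivative of least order: dropping the last differentiation gives \<open>w\<close>.\<close>
      define P where "P n \<longleftrightarrow> (\<exists>bs. set bs \<subseteq> B \<and> bs \<noteq> [] \<and> length bs = n \<and> n \<le> N \<and> iter_deriv bs f x \<noteq> 0)" for n
      have "\<exists>n. P n" using False x unfolding Fl_def P_def by blast
      then obtain n where n: "P n" "\<And>m. m < n \<Longrightarrow> \<not> P m" using exists_least_iff[of P] by blast
      obtain bs0 where bs0: "set bs0 \<subseteq> B" "bs0 \<noteq> []" "length bs0 = n" "n \<le> N" "iter_deriv bs0 f x \<noteq> 0"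
        using n(1) unfolding P_def by blast
      then obtain b bs where eq: "bs0 = b # bs" by (cases bs0) auto
      have "bs \<noteq> []"
      proof
        assume "bs = []"
        then have "frechet_derivative f (at x) b \<noteq> 0" using bs0 eq by simp
        then show False using x bs0 eq unfolding Cr_def by auto
      qed
      moreover have "\<not> P (length bs)" using n(2)[of "length bs"] bs0 eq by simp
      ultimately have "iter_deriv bs f x = 0" using bs0 eq unfolding P_def by auto
      then have "x \<in> A bs b" using x bs0 eq unfolding A_def by auto
      moreover have "(bs, b) \<in> L \<times> B" using bs0 eq unfolding L_def by auto
      ultimately show ?thesis by blast
    qed simp
  qed
  then have "f ` Cr \<subseteq> f ` Fl \<union> (\<Union>(bs, b)\<in>L \<times> B. f ` A bs b)" by blast
  moreover have "negligible (f ` Fl \<union> (\<Union>(bs, b)\<in>L \<times> B. f ` A bs b))"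
    using fl nondeg finL psubset.hyps by (intro negligible_Un negligible_Union) auto
  ultimately have "negligible (f ` Cr)" using negligible_subset by blast
  then show ?case unfolding Cr_def .
qed

theorem sard_real_valued:
  fixes f :: "'a::euclidean_space \<Rightarrow> real"
  assumes "open S" "smooth_on S f"
  shows "negligible (f ` {x\<in>S. \<forall>v. frechet_derivative f (at x) v = 0})"
  by (rule negligible_subset[OF sard_coordinate_plane[OF finite_Basis order_refl assms]]) auto

text \<open>Smoothness of the function replaces differentiability of the path: for functions of low
  differentiability the statement fails, by Whitney's example of a \<open>C\<^sup>1\<close> function that is not constant on an
  arc of critical points.\<close>
corollary smooth_constant_on_critical_path:
  fixes f :: "'a::euclidean_space \<Rightarrow> real" and \<gamma> :: "'b::topological_space \<Rightarrow> 'a"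
  assumes "open S" "smooth_on S f" "connected J" "continuous_on J \<gamma>" "\<gamma> ` J \<subseteq> S"
    and "\<And>t v. t \<in> J \<Longrightarrow> frechet_derivative f (at (\<gamma> t)) v = 0"
    and "s \<in> J" "t \<in> J"
  shows "f (\<gamma> s) = f (\<gamma> t)"
proof (rule ccontr)
  assume ne: "f (\<gamma> s) \<noteq> f (\<gamma> t)"
  let ?I = "(\<lambda>t. f (\<gamma> t)) ` J"
  have "continuous_on J (\<lambda>t. f (\<gamma> t))"
    using continuous_on_compose2[OF smooth_on_continuous[OF assms(2)] assms(4,5)] .
  then have "connected ?I" using assms(3) by (rule connected_continuous_image)
  then have "cbox (min (f (\<gamma> s)) (f (\<gamma> t))) (max (f (\<gamma> s)) (f (\<gamma> t))) \<subseteq> ?I"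
    using assms(7,8) connected_contains_Icc[of ?I] by (auto simp: min_def max_def)
  moreover have "negligible ?I"
    by (rule negligible_subset[OF sard_real_valued[OF assms(1,2)]]) (use assms in auto)
  ultimately have "negligible (cbox (min (f (\<gamma> s)) (f (\<gamma> t))) (max (f (\<gamma> s)) (f (\<gamma> t))))"
    using negligible_subset by blast
  then show False using ne by (simp only: negligible_interval) (auto simp: min_def max_def split: if_splits)
qed

section \<open>Orthonormal frames\<close>

definition inner_form :: "('e::real_vector \<Rightarrow> 'e \<Rightarrow> real) \<Rightarrow> bool" where
  "inner_form G \<longleftrightarrow> bilinear G \<and> (\<forall>u v. G u v = G v u) \<and> (\<forall>v. v \<noteq> 0 \<longrightarrow> 0 < G v v)"

lemma inner_form_linear:
  assumes "inner_form G" shows "linear (\<lambda>u. G u v)" "linear (G u)"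
  using assms unfolding inner_form_def bilinear_def by auto

lemma inner_form_commute: "inner_form G \<Longrightarrow> G u v = G v u"
  unfolding inner_form_def by auto

lemma inner_form_eq_0: "inner_form G \<Longrightarrow> G v v = 0 \<longleftrightarrow> v = 0"
  unfolding inner_form_def by (metis bilinear_lzero order_less_irrefl)

lemmas inner_form_simps =
  linear_add[OF inner_form_linear(1)] linear_add[OF inner_form_linear(2)]
  linear_diff[OF inner_form_linear(1)] linear_diff[OF inner_form_linear(2)]
  linear_scale[OF inner_form_linear(1)] linear_scale[OF inner_form_linear(2)]
  linear_sum[OF inner_form_linear(1)] linear_sum[OF inner_form_linear(2)]
  linear_0[OF inner_form_linear(1)] linear_0[OF inner_form_linear(2)]

lemma linear_sum_list:
  assumes "linear f" shows "f (\<Sum>x\<leftarrow>xs. h x) = (\<Sum>x\<leftarrow>xs. f (h x))"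
  by (induction xs) (auto simp: linear_0[OF assms] linear_add[OF assms])

text \<open>The orthogonal projection to the span of \<open>es\<close>, if \<open>es\<close> is orthonormal.\<close>
definition proj :: "('e::real_vector \<Rightarrow> 'e \<Rightarrow> real) \<Rightarrow> 'e list \<Rightarrow> 'e \<Rightarrow> 'e" where
  "proj G es v = (\<Sum>e\<leftarrow>es. G v e *\<^sub>R e)"

definition normalized :: "('e::real_vector \<Rightarrow> 'e \<Rightarrow> real) \<Rightarrow> 'e \<Rightarrow> 'e" where
  "normalized G v = inverse (sqrt (G v v)) *\<^sub>R v"

text \<open>The list \<open>es\<close> accumulates the vectors that are already orthonormal.\<close>
primrec gram_schmidt :: "('e::real_vector \<Rightarrow> 'e \<Rightarrow> real) \<Rightarrow> 'e list \<Rightarrow> 'e list \<Rightarrow> 'e list" where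
  "gram_schmidt G es [] = es"
| "gram_schmidt G es (v # vs) = gram_schmidt G (es @ [normalized G (v - proj G es v)]) vs"

lemma proj_in_span: "proj G es v \<in> span (set es)"
  unfolding proj_def by (induction es) (auto intro: span_add span_scale span_base span_mono[THEN subsetD, of "set _"])

lemma sum_list_single:
  assumes "j < length es"
  shows "(\<Sum>i<length es. (if i = j then h (es ! i) else (0::real))) = h (es ! j)"
  using assms by (simp add: sum.delta)

lemma inner_proj:
  assumes G: "inner_form G" and on: "orthonormal_list G es" and "e \<in> set es"
  shows "G (proj G es v) e = G v e"
proof -
  obtain j where j: "j < length es" "e = es ! j" using \<open>e \<in> set es\<close> by (metis in_set_conv_nth)
  have "G (proj G es v) e = (\<Sum>x\<leftarrow>es. G v x * G x e)"
    unfolding proj_def by (subst linear_sum_list[OF inner_form_linear(1)[OF G]]) (simp add: inner_form_simps[OF G])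
  also have "\<dots> = (\<Sum>i<length es. G v (es ! i) * G (es ! i) e)"
    by (simp add: sum_list_sum_nth atLeast0LessThan)
  also have "\<dots> = (\<Sum>i<length es. (if i = j then G v (es ! i) else 0))"
    using on j unfolding orthonormal_list_def by (intro sum.cong) auto
  also have "\<dots> = G v e" using sum_list_single[OF j(1), of "G v"] j(2) by simp
  finally show ?thesis .
qed

lemma proj_eq:
  assumes G: "inner_form G" and on: "orthonormal_list G es" and u: "u \<in> span (set es)"
  shows "proj G es u = u"
proof -
  have "G (u - proj G es u) x = 0" if "x \<in> span (set es)" for x
    using that
  proof (induction rule: span_induct_alt)
    case (step c x y)
    then show ?case using inner_proj[OF G on step(1)] by (simp add: inner_form_simps[OF G])
  qed (simp add: inner_form_simps[OF G])
  moreover have "u - proj G es u \<in> span (set es)" using u proj_in_span span_diff by blast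
  ultimately show ?thesis using inner_form_eq_0[OF G, of "u - proj G es u"] by auto
qed

lemma orthonormal_list_snoc:
  assumes "inner_form G" "orthonormal_list G es" "\<And>e. e \<in> set es \<Longrightarrow> G u e = 0" "G u u = 1"
  shows "orthonormal_list G (es @ [u])"
  unfolding orthonormal_list_def
proof (intro allI impI)
  fix i j assume ij: "i < length (es @ [u])" "j < length (es @ [u])"
  have c: "G (es ! k) u = 0" "G u (es ! k) = 0" if "k < length es" for k
    using assms(3)[of "es ! k"] that inner_form_commute[OF assms(1), of "es ! k" u] by auto
  show "G ((es @ [u]) ! i) ((es @ [u]) ! j) = (if i = j then 1 else 0)"
  proof (cases "i < length es")
    case i: True
    show ?thesis
    proof (cases "j < length es")
      case True
      then show ?thesis using i assms(2) by (simp add: nth_append orthonormal_list_def)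
    next
      case False
      then have "j = length es" using ij by simp
      then show ?thesis using i c by (simp add: nth_append)
    qed
  next
    case False
    then have i: "i = length es" using ij by simp
    show ?thesis
    proof (cases "j < length es")
      case True
      then show ?thesis using i c by (simp add: nth_append)
    next
      case False
      then have "j = length es" using ij by simp
      then show ?thesis using i assms(4) by (simp add: nth_append)
    qed
  qed
qed

lemma basis_list_length: "basis_list T vs \<Longrightarrow> length vs = dim T"
  unfolding basis_list_def using distinct_card[of vs] dim_span[of "set vs"] dim_eq_card_independent[of "set vs"] by auto

lemma basis_listI:
  assumes "span (set vs) = T" "length vs = dim T" shows "basis_list T vs"
proof -
  have "card (set vs) \<ge> dim T"
    using assms(1) dim_span[of "set vs"] dim_le_card'[of "set vs"] by auto
  with assms(2) card_length[of vs] have c: "card (set vs) = length vs" by linarith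
  then have "independent (set vs)"
    using assms card_le_dim_spanning[of "set vs" T] span_superset[of "set vs"] by auto
  then show ?thesis using assms card_distinct[OF c] unfolding basis_list_def by blast
qed

text \<open>One step keeps the invariant that the accumulated vectors are orthonormal and, with the
  remaining ones, form a basis of \<open>T\<close>. The last clause expresses the replaced vector through the new one,
  with a positive coefficient; signs of forms are compared through it.\<close>
lemma gram_schmidt_step:
  fixes v :: "'e::euclidean_space"
  assumes G: "inner_form G" and on: "orthonormal_list G es" and bl: "basis_list T (es @ v # vs)"
  defines "w \<equiv> v - proj G es v"
  shows "0 < G w w" "orthonormal_list G (es @ [normalized G w])" "basis_list T ((es @ [normalized G w]) @ vs)"
    "v = sqrt (G w w) *\<^sub>R normalized G w + proj G es v"
proof -
  have ind: "independent (set (es @ v # vs))" "distinct (es @ v # vs)" "span (set (es @ v # vs)) = T"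
    using bl unfolding basis_list_def by auto
  have "v \<notin> span (set es)"
  proof
    assume "v \<in> span (set es)"
    moreover have "set es \<subseteq> set (es @ v # vs) - {v}" using ind(2) by auto
    ultimately have "v \<in> span (set (es @ v # vs) - {v})" using span_mono by blast
    then show False using ind(1) unfolding dependent_def by auto
  qed
  then have "w \<noteq> 0" using proj_in_span[of G es v] unfolding w_def by auto
  then show pos: "0 < G w w" using G unfolding inner_form_def by blast
  let ?u = "normalized G w"
  show eq: "v = sqrt (G w w) *\<^sub>R ?u + proj G es v"
    using pos unfolding normalized_def by (simp add: w_def)
  have "G w e = 0" if "e \<in> set es" for e
    unfolding w_def using inner_proj[OF G on that] by (simp add: inner_form_simps[OF G])
  then show "orthonormal_list G (es @ [?u])"
  proof (intro orthonormal_list_snoc[OF G on])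
    have "G ?u ?u = inverse (sqrt (G w w)) * inverse (sqrt (G w w)) * G w w"
      unfolding normalized_def by (simp add: inner_form_simps[OF G])
    then show "G ?u ?u = 1" using pos by (simp add: field_simps)
  qed (simp add: normalized_def inner_form_simps[OF G])
  have s1: "proj G es v \<in> span (set (es @ v # vs))" "proj G es v \<in> span (set ((es @ [?u]) @ vs))"
    by (rule subsetD[OF span_mono proj_in_span], auto)+
  have "span (set ((es @ [?u]) @ vs)) = span (set (es @ v # vs))"
  proof (rule subset_antisym)
    show "span (set ((es @ [?u]) @ vs)) \<subseteq> span (set (es @ v # vs))"
    proof (rule span_minimal)
      have "?u \<in> span (set (es @ v # vs))"
        unfolding normalized_def w_def using s1 by (intro span_scale span_diff) (auto intro: span_base)
      then show "set ((es @ [?u]) @ vs) \<subseteq> span (set (es @ v # vs))"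
        by (auto intro: span_base)
    qed simp
    show "span (set (es @ v # vs)) \<subseteq> span (set ((es @ [?u]) @ vs))"
    proof (rule span_minimal)
      have "v \<in> span (set ((es @ [?u]) @ vs))"
        by (subst eq, intro span_add span_scale s1) (auto intro: span_base)
      then show "set (es @ v # vs) \<subseteq> span (set ((es @ [?u]) @ vs))"
        by (auto intro: span_base)
    qed simp
  qed
  then show "basis_list T ((es @ [?u]) @ vs)"
    using ind(3) basis_list_length[OF bl] by (intro basis_listI) auto
qed

lemma gram_schmidt_orthonormal:
  fixes vs :: "'e::euclidean_space list"
  assumes "inner_form G" "orthonormal_list G es" "basis_list T (es @ vs)"
  shows "orthonormal_list G (gram_schmidt G es vs) \<and> basis_list T (gram_schmidt G es vs)"
  using assms
proof (induction vs arbitrary: es)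
  case (Cons v vs)
  show ?case using Cons.IH[OF Cons.prems(1) gram_schmidt_step(2,3)[OF Cons.prems]] by simp
qed simp

lemma gram_schmidt_orthonormal_id:
  fixes vs :: "'e::euclidean_space list"
  assumes "inner_form G" "orthonormal_list G (es @ vs)"
  shows "gram_schmidt G es vs = es @ vs"
  using assms(2)
proof (induction vs arbitrary: es)
  case (Cons v vs)
  have at: "G ((es @ v # vs) ! i) ((es @ v # vs) ! j) = (if i = j then 1 else 0)"
    if "i < length (es @ v # vs)" "j < length (es @ v # vs)" for i j
    using Cons.prems that unfolding orthonormal_list_def by blast
  have "G v e = 0" if "e \<in> set es" for e
  proof -
    obtain j where j: "j < length es" "e = es ! j" using \<open>e \<in> set es\<close> unfolding in_set_conv_nth by blast
    then show ?thesis using at[of "length es" j] by (simp add: nth_append)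
  qed
  then have "proj G es v = 0" unfolding proj_def by (induction es) auto
  moreover have "G v v = 1"
    using at[of "length es" "length es"] by simp
  ultimately show ?case using Cons.IH[of "es @ [v]"] Cons.prems by (simp add: normalized_def)
qed simp

text \<open>Linear isometries commute with orthonormalisation, so that it makes sense independently of
  charts.\<close>
lemma gram_schmidt_map:
  assumes "linear \<tau>" "\<And>u v. G u v = G' (\<tau> u) (\<tau> v)"
  shows "map \<tau> (gram_schmidt G es vs) = gram_schmidt G' (map \<tau> es) (map \<tau> vs)"
proof (induction vs arbitrary: es)
  case (Cons v vs)
  have "\<tau> (proj G es v) = proj G' (map \<tau> es) (\<tau> v)"
    unfolding proj_def by (simp add: linear_sum_list[OF assms(1)] linear_scale[OF assms(1)] assms(2) o_def)
  then have "\<tau> (normalized G (v - proj G es v)) = normalized G' (\<tau> v - proj G' (map \<tau> es) (\<tau> v))"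
    unfolding normalized_def by (simp add: linear_scale[OF assms(1)] linear_diff[OF assms(1)] assms(2))
  then show ?case using Cons.IH[of "es @ [normalized G (v - proj G es v)]"] by simp
qed simp

section \<open>Alternating forms\<close>

lemma alternating_linear:
  assumes alt: "alternating_form_on UNIV l \<omega>" and "length xs + Suc (length ys) = l"
  shows "linear (\<lambda>x. \<omega> (xs @ x # ys))"
proof -
  have 1: "\<omega> ((xs @ 0 # ys)[length xs := a *\<^sub>R u + b *\<^sub>R v]) =
      a * \<omega> ((xs @ 0 # ys)[length xs := u]) + b * \<omega> ((xs @ 0 # ys)[length xs := v])" for a b u v
  proof -
    have "length (xs @ 0 # ys) = l \<and> set (xs @ 0 # ys) \<subseteq> UNIV" "length xs < l" using assms(2) by auto
    then show ?thesis using alt unfolding alternating_form_on_def by blast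
  qed
  show ?thesis
  proof (rule linearI)
    show "\<omega> (xs @ (u + v) # ys) = \<omega> (xs @ u # ys) + \<omega> (xs @ v # ys)" for u v using 1[of 1 u 1 v] by simp
    show "\<omega> (xs @ (a *\<^sub>R u) # ys) = a *\<^sub>R \<omega> (xs @ u # ys)" for a u using 1[of a u 0 u] by simp
  qed
qed

lemma alternating_not_distinct:
  assumes alt: "alternating_form_on UNIV l \<omega>" and "length vs = l" "\<not> distinct vs"
  shows "\<omega> vs = 0"
proof -
  obtain i j where "i < l" "j < l" "i \<noteq> j" "vs ! i = vs ! j"
    using assms(2,3) distinct_conv_nth by blast
  then obtain i j where "i < j" "j < l" "vs ! i = vs ! j" by (metis linorder_neqE_nat)
  then show ?thesis using alt assms(2) unfolding alternating_form_on_def by blast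
qed

lemma alternating_swap_first:
  assumes alt: "alternating_form_on UNIV l \<omega>" and len: "length xs + length ys + 2 = l"
  shows "\<omega> (a # xs @ b # ys) = - \<omega> (b # xs @ a # ys)"
proof -
  have 1: "\<omega> ((u + v) # xs @ c # ys) = \<omega> (u # xs @ c # ys) + \<omega> (v # xs @ c # ys)" for u v c
    using linear_add[OF alternating_linear[OF alt, of "[]" "xs @ c # ys"]] len by simp
  have 2: "\<omega> (c # xs @ (u + v) # ys) = \<omega> (c # xs @ u # ys) + \<omega> (c # xs @ v # ys)" for u v c
    using linear_add[OF alternating_linear[OF alt, of "c # xs" ys]] len by simp
  have 3: "\<omega> (c # xs @ c # ys) = 0" for c
    by (rule alternating_not_distinct[OF alt]) (use len in auto)
  have "\<omega> ((a + b) # xs @ (a + b) # ys) = \<omega> (a # xs @ b # ys) + \<omega> (b # xs @ a # ys)"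
    by (simp only: 1 2) (simp add: 3)
  then show ?thesis using 3[of "a + b"] by linarith
qed

text \<open>In each step the subtracted projection is a combination of vectors that occur in the list
  already, so an alternating form only sees the division by a positive length.\<close>
lemma alternating_gram_schmidt:
  fixes vs :: "'e::euclidean_space list"
  assumes "alternating_form_on UNIV l \<omega>" "inner_form G" "orthonormal_list G es" "basis_list T (es @ vs)"
    "length (es @ vs) = l"
  shows "\<exists>\<kappa>>0. \<omega> (es @ vs) = \<kappa> * \<omega> (gram_schmidt G es vs)"
  using assms(3-5)
proof (induction vs arbitrary: es)
  case Nil
  then show ?case by (intro exI[of _ 1]) simp
next
  case (Cons v vs)
  define w where "w = v - proj G es v"
  note st = gram_schmidt_step[OF assms(2) Cons.prems(1,2), folded w_def]
  have lin: "linear (\<lambda>x. \<omega> (es @ x # vs))" by (rule alternating_linear[OF assms(1)]) (use Cons.prems in auto)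
  have "\<omega> (es @ proj G es v # vs) = (\<Sum>e\<leftarrow>es. G v e * \<omega> (es @ e # vs))"
    unfolding proj_def by (subst linear_sum_list[OF lin]) (simp add: linear_scale[OF lin])
  also have "\<dots> = (\<Sum>e\<leftarrow>es. 0)"
    by (intro arg_cong[of _ _ sum_list] map_cong refl)
      (use Cons.prems(3) in \<open>auto intro!: alternating_not_distinct[OF assms(1)]\<close>)
  finally have "\<omega> (es @ proj G es v # vs) = 0" by simp
  then have "\<omega> (es @ v # vs) = sqrt (G w w) * \<omega> (es @ normalized G w # vs)"
    by (subst st(4)) (simp add: linear_add[OF lin] linear_scale[OF lin])
  moreover obtain \<kappa> where "\<kappa> > 0" "\<omega> ((es @ [normalized G w]) @ vs) = \<kappa> * \<omega> (gram_schmidt G (es @ [normalized G w]) vs)"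
    using Cons.IH[OF st(2,3)] Cons.prems(3) by auto
  ultimately show ?case using st(1)
    by (intro exI[of _ "sqrt (G w w) * \<kappa>"]) (simp add: w_def)
qed

text \<open>Orthonormalisation divides by lengths that are positive throughout, because the vectors stay
  linearly independent. The metric and the plane \<open>T\<close> vary with \<open>t\<close>.\<close>
lemma continuous_gram_schmidt:
  fixes vs :: "('t::topological_space \<Rightarrow> 'e::euclidean_space) list"
  assumes G: "\<And>t. t \<in> J \<Longrightarrow> inner_form (G t)"
    and cont: "\<And>u v. continuous_on J u \<Longrightarrow> continuous_on J v \<Longrightarrow> continuous_on J (\<lambda>t. G t (u t) (v t))"
    and "\<And>f. f \<in> set es \<union> set vs \<Longrightarrow> continuous_on J f"
    and "\<And>t. t \<in> J \<Longrightarrow> orthonormal_list (G t) (map (\<lambda>f. f t) es)"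
    and "\<And>t. t \<in> J \<Longrightarrow> basis_list (T t) (map (\<lambda>f. f t) (es @ vs))"
  shows "\<exists>hs. length hs = length es + length vs \<and> (\<forall>h\<in>set hs. continuous_on J h) \<and>
    (\<forall>t\<in>J. gram_schmidt (G t) (map (\<lambda>f. f t) es) (map (\<lambda>f. f t) vs) = map (\<lambda>h. h t) hs)"
  using assms(3-5)
proof (induction vs arbitrary: es)
  case Nil
  then show ?case by (intro exI[of _ es]) auto
next
  case (Cons v vs)
  define w where "w t = v t - proj (G t) (map (\<lambda>f. f t) es) (v t)" for t
  define u where "u t = normalized (G t) (w t)" for t
  have cv: "continuous_on J v" using Cons.prems(1) by simp
  have "continuous_on J (\<lambda>t. proj (G t) (map (\<lambda>f. f t) fs) (v t))" if "\<forall>f\<in>set fs. continuous_on J f" for fs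
    using that
  proof (induction fs)
    case (Cons f fs)
    then have "continuous_on J (\<lambda>t. G t (v t) (f t) *\<^sub>R f t + proj (G t) (map (\<lambda>f. f t) fs) (v t))"
      by (intro continuous_intros cont cv) auto
    then show ?case by (simp add: proj_def)
  qed (simp add: proj_def)
  then have cw: "continuous_on J w"
    unfolding w_def using Cons.prems(1) by (intro continuous_on_diff cv) auto
  have st: "0 < G t (w t) (w t)" "orthonormal_list (G t) (map (\<lambda>f. f t) (es @ [u]))"
    "basis_list (T t) (map (\<lambda>f. f t) ((es @ [u]) @ vs))" if "t \<in> J" for t
    using gram_schmidt_step[OF G[OF that] Cons.prems(2)[OF that], of "T t" "v t" "map (\<lambda>f. f t) vs"]
      Cons.prems(3)[OF that] by (auto simp: u_def w_def)
  have cu: "continuous_on J u"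
    unfolding u_def normalized_def using st(1)
    by (intro continuous_intros cont cw) (force dest: order_less_imp_not_eq2)
  have prem: "continuous_on J f" if "f \<in> set (es @ [u]) \<union> set vs" for f
    using that Cons.prems(1) cu by auto
  obtain hs where "length hs = length (es @ [u]) + length vs" "\<forall>h\<in>set hs. continuous_on J h"
    "\<forall>t\<in>J. gram_schmidt (G t) (map (\<lambda>f. f t) (es @ [u])) (map (\<lambda>f. f t) vs) = map (\<lambda>h. h t) hs"
    using Cons.IH[OF prem st(2,3)] by blast
  then show ?case by (intro exI[of _ hs]) (auto simp: u_def w_def)
qed

section \<open>Planes preserved by \<open>\<phi>\<close>-hat\<close>

lemma orthonormal_basis_list:
  fixes es :: "'e::euclidean_space list"
  assumes G: "inner_form G" and on: "orthonormal_list G es" and "subspace T" "set es \<subseteq> T" "length es = dim T"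
  shows "basis_list T es"
proof -
  have one: "G (es ! i) (es ! j) = (if i = j then 1 else 0)" if "i < length es" "j < length es" for i j
    using on that unfolding orthonormal_list_def by blast
  have dist: "distinct es"
    unfolding distinct_conv_nth using one by (metis zero_neq_one)
  have "independent (set es)"
    unfolding dependent_def
  proof safe
    fix e assume e: "e \<in> set es" "e \<in> span (set es - {e})"
    obtain i where i: "i < length es" "e = es ! i" using e(1) unfolding in_set_conv_nth by blast
    have "G x e = 0" if "x \<in> span (set es - {e})" for x
      using that
    proof (induction rule: span_induct_alt)
      case (step c x y)
      have "x \<in> set es" using step(1) by blast
      then obtain j where j: "j < length es" "x = es ! j" unfolding in_set_conv_nth by blast
      have "x \<noteq> e" using step(1) by blast
      then have "j \<noteq> i" using j(2) i(2) by blast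
      then have "G x e = 0" using one[OF j(1) i(1)] unfolding j(2) i(2) by simp
      then show ?case using step(2) by (simp add: inner_form_simps[OF G])
    qed (simp add: inner_form_simps[OF G])
    from this[OF e(2)] have "G e e = 0" .
    then show False using one[OF i(1) i(1)] unfolding i(2) by simp
  qed
  moreover have "span (set es) = T"
  proof (rule subset_antisym)
    show "span (set es) \<subseteq> T" using assms(3,4) by (rule span_minimal[rotated])
    show "T \<subseteq> span (set es)"
      using card_ge_dim_independent[OF assms(4) \<open>independent (set es)\<close>] distinct_card[OF dist] assms(5) by simp
  qed
  ultimately show ?thesis using dist unfolding basis_list_def by blast
qed

lemma orthonormal_list_Nil: "orthonormal_list G []"
  unfolding orthonormal_list_def by simp

lemma orthonormal_frame:
  fixes G :: "'e::euclidean_space \<Rightarrow> 'e \<Rightarrow> real"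
  assumes G: "inner_form G"
  shows "orthonormal_list G (orthonormal_frame G)" "basis_list UNIV (orthonormal_frame G)"
proof -
  obtain bs :: "'e list" where bs: "set bs = Basis" "distinct bs"
    using finite_distinct_list[OF finite_Basis] by blast
  then have "basis_list UNIV bs" unfolding basis_list_def using independent_Basis span_Basis by auto
  then have "orthonormal_list G (gram_schmidt G [] bs) \<and> basis_list (UNIV :: 'e set) (gram_schmidt G [] bs)"
    by (intro gram_schmidt_orthonormal[OF G orthonormal_list_Nil]) simp
  moreover from this have "length (gram_schmidt G [] bs) = DIM('e)"
    using basis_list_length[of UNIV "gram_schmidt G [] bs"] by simp
  ultimately have "\<exists>es :: 'e list. length es = DIM('e) \<and> orthonormal_list G es" by blast
  then have *: "length (orthonormal_frame G) = DIM('e) \<and> orthonormal_list G (orthonormal_frame G)"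
    unfolding orthonormal_frame_def by (rule someI_ex)
  then show "orthonormal_list G (orthonormal_frame G)" by blast
  show "basis_list UNIV (orthonormal_frame G)"
    by (rule orthonormal_basis_list[OF G]) (use * in simp_all)
qed

lemma orthonormal_frame_expansion:
  assumes "inner_form G" shows "(\<Sum>e\<leftarrow>orthonormal_frame G. G v e *\<^sub>R e) = v"
  using proj_eq[OF assms orthonormal_frame(1)[OF assms], of v] orthonormal_frame(2)[OF assms]
  unfolding proj_def basis_list_def by auto

text \<open>This characterises \<open>\<phi>\<close>-hat without a frame: it is \<open>\<phi>\<close> with its first argument raised by the
  metric.\<close>
lemma form_hat_inner:
  assumes G: "inner_form (g c x)" and alt: "alternating_form_on UNIV l (\<phi> c x)" and "Suc (length ws) = l"
  shows "g c x (form_hat g \<phi> c x ws) n = \<phi> c x (n # ws)"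
proof -
  have lin: "linear (\<lambda>u. \<phi> c x (u # ws))" using alternating_linear[OF alt, of "[]" ws] assms(3) by simp
  have "\<phi> c x (n # ws) = \<phi> c x ((\<Sum>e\<leftarrow>orthonormal_frame (g c x). g c x n e *\<^sub>R e) # ws)"
    by (simp only: orthonormal_frame_expansion[OF G])
  also have "\<dots> = (\<Sum>e\<leftarrow>orthonormal_frame (g c x). \<phi> c x (e # ws) * g c x n e)"
    by (subst linear_sum_list[OF lin]) (simp add: linear_scale[OF lin] mult.commute)
  also have "\<dots> = g c x (form_hat g \<phi> c x ws) n"
    unfolding form_hat_def
    by (subst linear_sum_list[OF inner_form_linear(1)[OF G]])
      (simp add: inner_form_simps[OF G] inner_form_commute[OF G, of n])
  finally show ?thesis by simp
qed

text \<open>The first-order condition for \<open>T\<close> to be critical for \<open>\<phi>\<close> on the Grassmannian. Split \<open>u\<close> into its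
  projection to \<open>T\<close> and a normal part. In the projection only the multiple of \<open>es ! i\<close> survives alternation. The
  normal part contributes nothing: moved to the first slot it is paired by the metric with a value of \<open>\<phi>\<close>-hat,
  which is tangent.\<close>
lemma form_hat_critical:
  fixes es :: "'e::euclidean_space list"
  assumes G: "inner_form (g c x)" and alt: "alternating_form_on UNIV l (\<phi> c x)"
    and on: "orthonormal_list (g c x) es" and bl: "basis_list T es" and len: "length es = l"
    and hat: "\<And>ws. Suc (length ws) = l \<Longrightarrow> set ws \<subseteq> T \<Longrightarrow> form_hat g \<phi> c x ws \<in> T"
    and i: "i < l"
  shows "\<phi> c x (es[i := u]) = \<phi> c x es * g c x (es ! i) u"
proof -
  define xs ys where "xs = take i es" and "ys = drop (Suc i) es"
  have T: "T = span (set es)" using bl unfolding basis_list_def by simp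
  have lens: "length xs + Suc (length ys) = l" using i len unfolding xs_def ys_def by simp
  have upd: "es[i := v] = xs @ v # ys" for v
    unfolding xs_def ys_def using i len by (simp add: upd_conv_take_nth_drop)
  have es: "es = xs @ es ! i # ys" using upd[of "es ! i"] by simp
  have sub: "set xs \<subseteq> T" "set ys \<subseteq> T" unfolding T xs_def ys_def
    using set_take_subset[of i es] set_drop_subset[of "Suc i" es] by (auto intro: span_base)
  have lin: "linear (\<lambda>v. \<phi> c x (xs @ v # ys))" by (rule alternating_linear[OF alt lens])
  define n where "n = u - proj (g c x) es u"
  have nT: "g c x t n = 0" if "t \<in> T" for t
    using that unfolding T
  proof (induction rule: span_induct_alt)
    case (step a e y)
    have "g c x e n = 0"
      unfolding n_def using inner_proj[OF G on step(1), of u] inner_form_commute[OF G, of e]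
      by (simp add: inner_form_simps[OF G])
    then show ?case using step(2) by (simp add: inner_form_simps[OF G])
  qed (simp add: inner_form_simps[OF G])
  have first: "\<phi> c x (n # ws) = 0" if "Suc (length ws) = l" "set ws \<subseteq> T" for ws
    using form_hat_inner[where g = g and c = c and x = x and \<phi> = \<phi>, OF G alt that(1), of n] nT[OF hat[OF that]] by simp
  have norm0: "\<phi> c x (xs @ n # ys) = 0"
  proof (cases xs)
    case Nil
    then show ?thesis using first[of ys] lens sub by simp
  next
    case (Cons a xs')
    have "\<phi> c x (xs @ n # ys) = - \<phi> c x (n # xs' @ a # ys)"
      unfolding Cons using alternating_swap_first[OF alt, of xs' ys a n] lens Cons by simp
    then show ?thesis using first[of "xs' @ a # ys"] lens sub Cons by simp
  qed
  have "\<phi> c x (xs @ proj (g c x) es u # ys) = (\<Sum>e\<leftarrow>es. g c x u e * \<phi> c x (xs @ e # ys))"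
    unfolding proj_def by (subst linear_sum_list[OF lin]) (simp add: linear_scale[OF lin])
  also have "\<dots> = (\<Sum>j<length es. g c x u (es ! j) * \<phi> c x (xs @ es ! j # ys))"
    by (simp add: sum_list_sum_nth atLeast0LessThan)
  also have "\<dots> = (\<Sum>j<length es. (if j = i then g c x u (es ! j) * \<phi> c x es else 0))"
  proof (rule sum.cong)
    fix j assume j: "j \<in> {..<length es}"
    show "g c x u (es ! j) * \<phi> c x (xs @ es ! j # ys) = (if j = i then g c x u (es ! j) * \<phi> c x es else 0)"
    proof (cases "j = i")
      case False
      have "\<phi> c x (es[i := es ! j]) = 0"
      proof (rule alternating_not_distinct[OF alt])
        show "\<not> distinct (es[i := es ! j])"
          using nth_eq_iff_index_eq[of "es[i := es ! j]" i j] False i j len by auto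
      qed (simp add: len)
      then show ?thesis using False upd by simp
    qed (use es in simp)
  qed simp
  also have "\<dots> = g c x u (es ! i) * \<phi> c x es" using i len by (simp add: sum.delta)
  finally have "\<phi> c x (xs @ proj (g c x) es u # ys) = g c x u (es ! i) * \<phi> c x es" .
  moreover have "u = n + proj (g c x) es u" unfolding n_def by simp
  ultimately have "\<phi> c x (xs @ u # ys) = g c x u (es ! i) * \<phi> c x es"
    using norm0 linear_add[OF lin, of n "proj (g c x) es u"] by simp
  then show ?thesis using upd inner_form_commute[OF G, of u] by (simp add: mult.commute)
qed

section \<open>The Levi-Civita connection in a chart\<close>

lemma frechet_derivative_bilinear_family:
  fixes g :: "'e::euclidean_space \<Rightarrow> 'e \<Rightarrow> 'e \<Rightarrow> real"
  assumes "open S" "x \<in> S" and G: "\<And>y. y \<in> S \<Longrightarrow> inner_form (g y)"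
    and sm: "\<And>u v. smooth_on S (\<lambda>y. g y u v)"
  defines "D \<equiv> \<lambda>w u v. frechet_derivative (\<lambda>y. g y u v) (at x) w"
  shows "linear (\<lambda>w. D w u v)" "linear (\<lambda>u. D w u v)" "D w u v = D w v u"
proof -
  have d: "((\<lambda>y. g y u v) has_derivative (\<lambda>w. D w u v)) (at x)" for u v
    using smooth_on_has_derivative[OF sm assms(2)] unfolding D_def .
  show "linear (\<lambda>w. D w u v)" using has_derivative_linear[OF d] .
  have eq: "D w a b = F w" if "((\<lambda>y. h y) has_derivative F) (at x)" "\<And>y. y \<in> S \<Longrightarrow> g y a b = h y" for a b w F h
  proof -
    have "frechet_derivative (\<lambda>y. g y a b) (at x) = frechet_derivative h (at x)"
      by (rule frechet_derivative_cong_open[OF assms(1,2)]) (use that in auto)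
    then show ?thesis using frechet_derivative_at[OF that(1)] unfolding D_def by simp
  qed
  show "linear (\<lambda>u. D w u v)"
  proof (rule linearI)
    show "D w (a + b) v = D w a v + D w b v" for a b
      by (rule eq[OF has_derivative_add[OF d d]]) (simp add: inner_form_simps[OF G])
    show "D w (r *\<^sub>R a) v = r *\<^sub>R D w a v" for r a
      by (rule eq[OF has_derivative_scaleR_right[OF d]]) (simp add: inner_form_simps[OF G])
  qed
  show "D w u v = D w v u"
    by (rule eq[OF d]) (use inner_form_commute[OF G] in auto)
qed

text \<open>Christoffel symbols are a definite description, so their compatibility with the metric
  requires the fundamental theorem of Riemannian geometry: Koszul's formula yields
  the only symmetric compatible solution.\<close>
lemma christoffel_metric:
  fixes g :: "('m, 'e::euclidean_space) metric"
  assumes "open S" "x \<in> S" and G: "\<And>y. y \<in> S \<Longrightarrow> inner_form (g c y)"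
    and sm: "\<And>u v. smooth_on S (\<lambda>y. g c y u v)"
  shows "frechet_derivative (\<lambda>y. g c y u v) (at x) w =
     g c x (christoffel g c x w u) v + g c x u (christoffel g c x w v)"
proof -
  define D where "D w u v = frechet_derivative (\<lambda>y. g c y u v) (at x) w" for w u v
  note fam = frechet_derivative_bilinear_family[where g = "g c" and S = S and x = x, OF assms(1,2) G sm, folded D_def]
  note Gx = G[OF assms(2)]
  have lin1: "linear (\<lambda>w. D w u v)" for u v by (rule fam(1))
  have lin2: "linear (\<lambda>u. D w u v)" for w v by (rule fam(2))
  have sym: "D w u v = D w v u" for w u v by (rule fam(3))
  have lin3: "linear (\<lambda>v. D w u v)" for w u using lin2[of w u] unfolding sym[of w _ u] .
  \<comment> \<open>Koszul's formula for \<open>g (\<Gamma> u v) z\<close> on constant vector fields.\<close>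
  define K where "K u v z = (D u v z + D v u z - D z u v) / 2" for u v z
  have K1: "linear (\<lambda>u. K u v z)" for v z
    unfolding K_def by (rule linearI)
      (simp_all add: linear_add[OF lin1] linear_add[OF lin2] linear_add[OF lin3] linear_scale[OF lin1] linear_scale[OF lin2] linear_scale[OF lin3] field_simps)
  have K3: "linear (\<lambda>z. K u v z)" for u v
    unfolding K_def by (rule linearI)
      (simp_all add: linear_add[OF lin1] linear_add[OF lin2] linear_add[OF lin3] linear_scale[OF lin1] linear_scale[OF lin2] linear_scale[OF lin3] field_simps)
  have Ksym: "K u v z = K v u z" for u v z
    unfolding K_def using sym[of z u v] by simp
  define fr where "fr = orthonormal_frame (g c x)"
  define \<Gamma> where "\<Gamma> u v = (\<Sum>e\<leftarrow>fr. K u v e *\<^sub>R e)" for u v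
  have \<Gamma>K: "g c x (\<Gamma> u v) z = K u v z" for u v z
  proof -
    have "g c x (\<Gamma> u v) z = (\<Sum>e\<leftarrow>fr. g c x z e * K u v e)"
      unfolding \<Gamma>_def by (subst linear_sum_list[OF inner_form_linear(1)[OF Gx]])
        (simp add: inner_form_simps[OF Gx] inner_form_commute[OF Gx, of z] mult.commute)
    also have "\<dots> = K u v (\<Sum>e\<leftarrow>fr. g c x z e *\<^sub>R e)"
      by (subst linear_sum_list[OF K3]) (simp add: linear_scale[OF K3])
    finally show ?thesis unfolding fr_def orthonormal_frame_expansion[OF Gx] .
  qed
  have nondeg: "a = b" if "\<And>z. g c x a z = g c x b z" for a b
    using inner_form_eq_0[OF Gx, of "a - b"] that[of "a - b"] by (simp add: inner_form_simps[OF Gx])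
  have "bilinear \<Gamma>"
  proof -
    have l: "linear (\<lambda>u. \<Gamma> u v)" for v
      by (rule linearI; rule nondeg)
        (simp_all add: inner_form_simps[OF Gx] \<Gamma>K linear_add[OF K1] linear_scale[OF K1])
    moreover have s: "\<Gamma> u v = \<Gamma> v u" for u v unfolding \<Gamma>_def using Ksym[of u v] by simp
    have "linear (\<lambda>v. \<Gamma> u v)" for u using l[of u] unfolding s[of _ u] .
    ultimately show ?thesis unfolding bilinear_def by blast
  qed
  moreover have "\<Gamma> u v = \<Gamma> v u" for u v unfolding \<Gamma>_def using Ksym[of u v] by simp
  moreover have compat: "D w u v = g c x (\<Gamma> w u) v + g c x u (\<Gamma> w v)" for w u v
  proof -
    have "g c x u (\<Gamma> w v) = K w v u"
      unfolding \<Gamma>K[symmetric] by (rule inner_form_commute[OF Gx])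
    moreover have "D w u v = K w u v + K w v u" unfolding K_def sym[of w v u] by (simp add: field_simps)
    ultimately show ?thesis by (simp only: \<Gamma>K)
  qed
  ultimately have ex: "bilinear \<Gamma> \<and> (\<forall>u v. \<Gamma> u v = \<Gamma> v u) \<and>
        (\<forall>w u v. frechet_derivative (\<lambda>y. g c y u v) (at x) w = g c x (\<Gamma> w u) v + g c x u (\<Gamma> w v))"
    unfolding D_def by blast
  have uniq: "\<Gamma>' = \<Gamma>" if P: "bilinear \<Gamma>' \<and> (\<forall>u v. \<Gamma>' u v = \<Gamma>' v u) \<and>
        (\<forall>w u v. frechet_derivative (\<lambda>y. g c y u v) (at x) w = g c x (\<Gamma>' w u) v + g c x u (\<Gamma>' w v))" for \<Gamma>'
  proof (intro ext)
    fix u v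
    have s: "\<Gamma>' a b = \<Gamma>' b a" for a b using P by blast
    have cp: "D w a b = g c x (\<Gamma>' w a) b + g c x (\<Gamma>' w b) a" for w a b
      using P inner_form_commute[OF Gx, of a "\<Gamma>' w b"] unfolding D_def by simp
    show "\<Gamma>' u v = \<Gamma> u v"
    proof (rule nondeg)
      fix z
      show "g c x (\<Gamma>' u v) z = g c x (\<Gamma> u v) z"
        unfolding \<Gamma>K K_def cp s[of v u] s[of z u] s[of z v] by simp
    qed
  qed
  have "christoffel g c x = \<Gamma>"
    unfolding christoffel_def by (rule the_equality[where P = "\<lambda>\<Gamma>. bilinear \<Gamma> \<and> (\<forall>u v. \<Gamma> u v = \<Gamma> v u) \<and>
        (\<forall>w u v. frechet_derivative (\<lambda>y. g c y u v) (at x) w =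
                 g c x (\<Gamma> w u) v + g c x u (\<Gamma> w v))", OF ex uniq])
  then show ?thesis using compat unfolding D_def by simp
qed

section \<open>The Lagrangian of a form on orthonormal frames\<close>

text \<open>A form is smooth in the point for constant arguments. Expanding one argument after the other in the
  standard basis gives smoothness when the arguments vary too; \<open>us\<close> are the arguments that are
  already constant.\<close>
lemma smooth_on_form_evaluation:
  fixes \<omega> :: "'e::euclidean_space \<Rightarrow> 'e list \<Rightarrow> real" and \<pi> :: "'q::euclidean_space \<Rightarrow> 'e"
  assumes "open \<Omega>" "smooth_on \<Omega> \<pi>" "\<pi> ` \<Omega> \<subseteq> S"
    and alt: "\<And>x. x \<in> S \<Longrightarrow> alternating_form_on UNIV l (\<omega> x)"
    and sm: "\<And>vs. length vs = l \<Longrightarrow> smooth_on S (\<lambda>x. \<omega> x vs)"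
    and "\<And>f. f \<in> set fs \<Longrightarrow> smooth_on \<Omega> f" and "length us + length fs = l"
  shows "smooth_on \<Omega> (\<lambda>q. \<omega> (\<pi> q) (us @ map (\<lambda>f. f q) fs))"
  using assms(6,7)
proof (induction fs arbitrary: us)
  case Nil
  then show ?case
    using smooth_on_compose[OF assms(1) sm[of us] assms(2,3)] by simp
next
  case (Cons f fs)
  have "smooth_on \<Omega> (\<lambda>q. \<Sum>b\<in>Basis. (f q \<bullet> b) * \<omega> (\<pi> q) ((us @ [b]) @ map (\<lambda>f. f q) fs))"
    using Cons.prems by (intro smooth_on_sum smooth_on_mult smooth_on_inner smooth_on_const Cons.IH assms(1)) auto
  then show ?case
  proof (rule smooth_on_cong[OF assms(1)])
    fix q assume "q \<in> \<Omega>"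
    then have "linear (\<lambda>v. \<omega> (\<pi> q) (us @ v # map (\<lambda>f. f q) fs))"
      using assms(3) Cons.prems(2) by (intro alternating_linear[OF alt]) auto
    from linear_Basis_expand[OF this, of "f q"]
    show "(\<Sum>b\<in>Basis. (f q \<bullet> b) * \<omega> (\<pi> q) ((us @ [b]) @ map (\<lambda>f. f q) fs)) = \<omega> (\<pi> q) (us @ map (\<lambda>f. f q) (f # fs))"
      by simp
  qed
qed

lemma inner_form_Basis_expand:
  fixes u v :: "'e::euclidean_space"
  assumes "inner_form G" shows "G u v = (\<Sum>a\<in>Basis. \<Sum>b\<in>Basis. (u \<bullet> a) * ((v \<bullet> b) * G a b))"
proof -
  have "G u v = (\<Sum>a\<in>Basis. (u \<bullet> a) * G a v)"
    using linear_Basis_expand[OF inner_form_linear(1)[OF assms], of u v] by simp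
  moreover have "G a v = (\<Sum>b\<in>Basis. (v \<bullet> b) * G a b)" for a
    using linear_Basis_expand[OF inner_form_linear(2)[OF assms], of a v] by simp
  ultimately show ?thesis by (simp add: sum_distrib_left)
qed

lemma smooth_on_metric_evaluation:
  fixes g :: "'e::euclidean_space \<Rightarrow> 'e \<Rightarrow> 'e \<Rightarrow> real" and \<pi> :: "'q::euclidean_space \<Rightarrow> 'e"
  assumes "open \<Omega>" "smooth_on \<Omega> \<pi>" "\<pi> ` \<Omega> \<subseteq> S"
    and G: "\<And>x. x \<in> S \<Longrightarrow> inner_form (g x)"
    and sm: "\<And>u v. smooth_on S (\<lambda>x. g x u v)"
    and "smooth_on \<Omega> f" "smooth_on \<Omega> h"
  shows "smooth_on \<Omega> (\<lambda>q. g (\<pi> q) (f q) (h q))"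
proof (rule smooth_on_cong[OF assms(1)])
  show "smooth_on \<Omega> (\<lambda>q. \<Sum>a\<in>Basis. \<Sum>b\<in>Basis. (f q \<bullet> a) * ((h q \<bullet> b) * g (\<pi> q) a b))"
    using assms(6,7)
    by (intro smooth_on_sum smooth_on_mult smooth_on_inner smooth_on_const smooth_on_compose[OF assms(1) sm assms(2,3)] assms(1))
qed (use inner_form_Basis_expand[OF G] assms(3) in auto)

lemma continuous_on_metric_evaluation:
  fixes g :: "'e::euclidean_space \<Rightarrow> 'e \<Rightarrow> 'e \<Rightarrow> real" and x :: "'t::topological_space \<Rightarrow> 'e"
  assumes "continuous_on J x" "x ` J \<subseteq> S"
    and G: "\<And>x. x \<in> S \<Longrightarrow> inner_form (g x)"
    and sm: "\<And>u v. smooth_on S (\<lambda>x. g x u v)"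
    and "continuous_on J u" "continuous_on J v"
  shows "continuous_on J (\<lambda>t. g (x t) (u t) (v t))"
proof (rule continuous_on_eq)
  show "continuous_on J (\<lambda>t. \<Sum>a\<in>Basis. \<Sum>b\<in>Basis. (u t \<bullet> a) * ((v t \<bullet> b) * g (x t) a b))"
    using assms(5,6) by (intro continuous_intros continuous_on_compose2[OF smooth_on_continuous[OF sm] assms(1,2)])
qed (use inner_form_Basis_expand[OF G] assms(2) in auto)

text \<open>An argument is \<open>((x, v), \<lambda>)\<close> with a point \<open>x\<close>, a family of vectors \<open>v\<close> and a multiplier \<open>\<lambda>\<close>. Families of \<open>l\<close>
  vectors are indexed by a finite type, so that they form a Euclidean space; the list \<open>ix\<close> orders the index type. Only the
  lengths of the vectors are constrained: one multiplier for them suffices at critical planes,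
  since all diagonal conditions have the same multiplier \<open>\<phi>\<^sub>x(v)\<close> and the off-diagonal ones have multiplier
  zero there.\<close>
definition lagrangian ::
  "('m, 'e::euclidean_space) metric \<Rightarrow> ('m, 'e) dform \<Rightarrow> ('m, 'e) chart \<Rightarrow> 'n::finite list \<Rightarrow> ('e \<times> ('e ^ 'n)) \<times> real \<Rightarrow> real" where
  "lagrangian g \<phi> c ix q =
     \<phi> c (fst (fst q)) (map (\<lambda>i. snd (fst q) $ i) ix) -
     snd q / 2 * (\<Sum>j<length ix. g c (fst (fst q)) (snd (fst q) $ (ix ! j)) (snd (fst q) $ (ix ! j)) - 1)"

lemma smooth_on_lagrangian:
  fixes g :: "('m, 'e::euclidean_space) metric" and ix :: "'n::finite list"
  assumes "open S" and G: "\<And>y. y \<in> S \<Longrightarrow> inner_form (g c y)"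
    and smg: "\<And>u v. smooth_on S (\<lambda>y. g c y u v)"
    and alt: "\<And>y. y \<in> S \<Longrightarrow> alternating_form_on UNIV l (\<phi> c y)"
    and sm: "\<And>vs. length vs = l \<Longrightarrow> smooth_on S (\<lambda>y. \<phi> c y vs)"
    and "length ix = l"
  shows "open ((S \<times> (UNIV :: ('e ^ 'n) set)) \<times> (UNIV :: real set))"
    and "smooth_on ((S \<times> UNIV) \<times> UNIV) (lagrangian g \<phi> c ix)"
proof -
  let ?\<Omega> = "(S \<times> (UNIV :: ('e ^ 'n) set)) \<times> (UNIV :: real set)"
  show op: "open ?\<Omega>" using assms(1) by (intro open_Times) auto
  have bl1: "bounded_linear (\<lambda>q :: ('e \<times> ('e ^ 'n)) \<times> real. fst (fst q))"
    by (intro bounded_linear_compose[OF bounded_linear_fst] bounded_linear_fst)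
  have bl2: "bounded_linear (\<lambda>q :: ('e \<times> ('e ^ 'n)) \<times> real. snd (fst q) $ i)" for i
    by (intro bounded_linear_compose[OF bounded_linear_vec_nth] bounded_linear_compose[OF bounded_linear_snd] bounded_linear_fst)
  have bl3: "bounded_linear (\<lambda>q :: ('e \<times> ('e ^ 'n)) \<times> real. snd q / 2)"
    by (rule bounded_linear_compose[OF bounded_linear_divide]) (rule bounded_linear_snd)
  have "smooth_on ?\<Omega> (\<lambda>q. \<phi> c (fst (fst q)) ([] @ map (\<lambda>f. f q) (map (\<lambda>i q. snd (fst q) $ i) ix)))"
    by (rule smooth_on_form_evaluation[where S = S and l = l and \<omega> = "\<phi> c", OF op smooth_on_linear[OF bl1 op] _ alt sm])
      (use assms(6) in \<open>auto intro: smooth_on_linear[OF bl2 op]\<close>)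
  then have "smooth_on ?\<Omega> (\<lambda>q. \<phi> c (fst (fst q)) (map (\<lambda>i. snd (fst q) $ i) ix))"
    by (simp add: o_def)
  moreover have "smooth_on ?\<Omega> (\<lambda>q. g c (fst (fst q)) (snd (fst q) $ i) (snd (fst q) $ i))" for i
    by (rule smooth_on_metric_evaluation[where S = S and g = "g c", OF op smooth_on_linear[OF bl1 op] _ G smg
        smooth_on_linear[OF bl2 op] smooth_on_linear[OF bl2 op]]) auto
  ultimately show "smooth_on ?\<Omega> (lagrangian g \<phi> c ix)"
    unfolding lagrangian_def[abs_def]
    by (intro smooth_on_diff smooth_on_mult smooth_on_sum smooth_on_const smooth_on_linear[OF bl3 op] op) auto
qed

lemma line_derivative:
  fixes h :: "'a::real_normed_vector \<Rightarrow> real"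
  assumes "(h has_derivative h') (at x)"
  shows "((\<lambda>s. h (x + s *\<^sub>R w)) has_real_derivative h' w) (at 0)"
proof -
  have "((\<lambda>s::real. x + s *\<^sub>R w) has_derivative (\<lambda>s. s *\<^sub>R w)) (at 0)"
    by (auto intro!: derivative_eq_intros)
  from has_derivative_compose[OF this, of h h'] assms
  have "((\<lambda>s. h (x + s *\<^sub>R w)) has_derivative (\<lambda>s. h' (s *\<^sub>R w))) (at 0)" by simp
  moreover have "(\<lambda>s. h' (s *\<^sub>R w)) = (*) (h' w)"
    using has_derivative_linear[OF assms] by (auto simp: linear_scale)
  ultimately show ?thesis unfolding has_field_derivative_def by simp
qed

text \<open>Moving one vector of the frame, the derivative vanishes by the first-order condition \<open>crit\<close>. Moving the
  multiplier, it vanishes because the frame is normalised. Moving the base point along \<open>w\<close>, both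
  terms of the Lagrangian change as if each \<open>v\<^sub>i\<close> were moved by \<open>\<Gamma> w v\<^sub>i\<close>, since \<open>\<phi>\<close> and \<open>g\<close> are
  parallel, and this reduces to the first case.\<close>
lemma lagrangian_critical:
  fixes g :: "('m, 'e::euclidean_space) metric" and ix :: "'n::finite list" and v :: "'e ^ 'n"
  assumes "open S" and G: "\<And>y. y \<in> S \<Longrightarrow> inner_form (g c y)"
    and smg: "\<And>u v. smooth_on S (\<lambda>y. g c y u v)"
    and alt: "\<And>y. y \<in> S \<Longrightarrow> alternating_form_on UNIV l (\<phi> c y)"
    and sm: "\<And>vs. length vs = l \<Longrightarrow> smooth_on S (\<lambda>y. \<phi> c y vs)"
    and par: "\<And>w vs. length vs = l \<Longrightarrow> cov_deriv g \<phi> c x w vs = 0"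
    and ix: "length ix = l" "distinct ix" "set ix = UNIV"
    and x: "x \<in> S" and vs: "vs = map (\<lambda>i. v $ i) ix"
    and on: "orthonormal_list (g c x) vs" and lam: "\<kappa> = \<phi> c x vs"
    and crit: "\<And>i u. i < l \<Longrightarrow> \<phi> c x (vs[i := u]) = \<kappa> * g c x (vs ! i) u"
  shows "frechet_derivative (lagrangian g \<phi> c ix) (at ((x, v), \<kappa>)) d = 0"
proof -
  let ?L = "lagrangian g \<phi> c ix" and ?z = "((x, v), \<kappa>)"
  define D where "D = frechet_derivative ?L (at ?z)"
  note Gx = G[OF x]
  have len: "length vs = l" using vs ix by simp
  have vsj: "vs ! j = v $ (ix ! j)" if "j < l" for j using vs ix that by simp
  have unit: "g c x (vs ! j) (vs ! j) = 1" if "j < l" for j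
    using on that len unfolding orthonormal_list_def by simp
  have hD: "(?L has_derivative D) (at ?z)"
    unfolding D_def
    by (rule smooth_on_has_derivative[OF smooth_on_lagrangian(2)[where S = S and l = l and g = g and c = c and \<phi> = \<phi>, OF assms(1) G smg alt sm ix(1)]])
      (use x in auto)
  then have linD: "linear D" by (rule has_derivative_linear)
  have dir: "D e = m" if "((\<lambda>s. ?L (?z + s *\<^sub>R e)) has_real_derivative m) (at 0)" for e m
    using DERIV_unique[OF line_derivative[OF hD] that] .
  have horizontal: "D ((w, 0), 0) = 0" for w
  proof (rule dir)
    define A where "A = frechet_derivative (\<lambda>y. \<phi> c y vs) (at x) w"
    define B where "B j = frechet_derivative (\<lambda>y. g c y (vs ! j) (vs ! j)) (at x) w" for j
    define \<Gamma> where "\<Gamma> = christoffel g c x"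
    have 1: "((\<lambda>s. \<phi> c (x + s *\<^sub>R w) vs) has_real_derivative A) (at 0)"
      unfolding A_def by (rule line_derivative[OF smooth_on_has_derivative[OF sm[OF len] x]])
    have 2: "((\<lambda>s. g c (x + s *\<^sub>R w) (vs ! j) (vs ! j)) has_real_derivative B j) (at 0)" for j
      unfolding B_def by (rule line_derivative[OF smooth_on_has_derivative[OF smg[of "vs ! j" "vs ! j"] x]])
    have "((\<lambda>s. \<phi> c (x + s *\<^sub>R w) vs - \<kappa> / 2 * (\<Sum>j<l. g c (x + s *\<^sub>R w) (vs ! j) (vs ! j) - 1))
        has_real_derivative A - \<kappa> / 2 * (\<Sum>j<l. B j - 0)) (at 0)"
      by (intro DERIV_diff DERIV_cmult DERIV_sum DERIV_const 1 2)
    moreover have "?L (?z + s *\<^sub>R ((w, 0), 0)) =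
        \<phi> c (x + s *\<^sub>R w) vs - \<kappa> / 2 * (\<Sum>j<l. g c (x + s *\<^sub>R w) (vs ! j) (vs ! j) - 1)" for s
    proof -
      have "(\<Sum>j<l. g c (x + s *\<^sub>R w) (v $ (ix ! j)) (v $ (ix ! j)) - 1) =
          (\<Sum>j<l. g c (x + s *\<^sub>R w) (vs ! j) (vs ! j) - 1)"
        by (rule sum.cong) (auto simp: vsj)
      then show ?thesis unfolding lagrangian_def ix(1) by (simp add: vs[symmetric])
    qed
    moreover have "A - \<kappa> / 2 * (\<Sum>j<l. B j - 0) = 0"
    proof -
      have "A = (\<Sum>i<l. \<phi> c x (vs[i := \<Gamma> w (vs ! i)]))"
        using par[OF len, of w] len unfolding cov_deriv_def A_def \<Gamma>_def by simp
      also have "\<dots> = (\<Sum>i<l. \<kappa> * g c x (vs ! i) (\<Gamma> w (vs ! i)))"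
        by (rule sum.cong) (use crit in auto)
      finally have "A = (\<Sum>i<l. \<kappa> * g c x (vs ! i) (\<Gamma> w (vs ! i)))" .
      moreover have "B j = 2 * g c x (vs ! j) (\<Gamma> w (vs ! j))" for j
        unfolding B_def \<Gamma>_def
        using christoffel_metric[where S = S and g = g and c = c and x = x, OF assms(1) x G smg, of "vs ! j" "vs ! j" w]
          inner_form_commute[OF Gx, of "christoffel g c x w (vs ! j)" "vs ! j"] by simp
      ultimately show ?thesis by (simp add: sum_distrib_left)
    qed
    ultimately show "((\<lambda>s. ?L (?z + s *\<^sub>R ((w, 0), 0))) has_real_derivative 0) (at 0)" by (simp only:)
  qed
  have vertical: "D ((0, axis k u), 0) = 0" for k u
  proof (rule dir)
    have "k \<in> set ix" using ix(3) by simp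
    then obtain j0 where "j0 < length ix" "ix ! j0 = k" unfolding in_set_conv_nth by blast
    then have j0: "j0 < l" "ix ! j0 = k" using ix(1) by auto
    have nthk: "ix ! j = k \<longleftrightarrow> j = j0" if "j < l" for j
      using j0 that ix(1,2) nth_eq_iff_index_eq by metis
    have lin: "linear (\<lambda>a. \<phi> c x (vs[j0 := a]))"
    proof -
      have "linear (\<lambda>a. \<phi> c x (take j0 vs @ a # drop (Suc j0) vs))"
        by (rule alternating_linear[OF alt[OF x]]) (use j0 len in simp)
      then show ?thesis using j0 len by (simp add: upd_conv_take_nth_drop)
    qed
    have "map (\<lambda>i. (v + s *\<^sub>R axis k u) $ i) ix = vs[j0 := vs ! j0 + s *\<^sub>R u]" for s
      by (rule nth_equalityI) (auto simp: ix(1) len nth_list_update vsj nthk axis_def)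
    then have phi: "\<phi> c x (map (\<lambda>i. (v + s *\<^sub>R axis k u) $ i) ix) = \<kappa> + s * (\<kappa> * g c x (vs ! j0) u)" for s
      using crit[OF j0(1), of u] by (simp add: linear_add[OF lin] linear_scale[OF lin] lam)
    have sumg: "(\<Sum>j<l. g c x ((v + s *\<^sub>R axis k u) $ (ix ! j)) ((v + s *\<^sub>R axis k u) $ (ix ! j)) - 1) =
        2 * s * g c x (vs ! j0) u + s * s * g c x u u" for s
    proof -
      have "(\<Sum>j<l. g c x ((v + s *\<^sub>R axis k u) $ (ix ! j)) ((v + s *\<^sub>R axis k u) $ (ix ! j)) - 1) =
        (\<Sum>j<l. if j = j0 then 2 * s * g c x (vs ! j0) u + s * s * g c x u u else 0)"
      proof (rule sum.cong)
        fix j assume "j \<in> {..<l}"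
        then have j: "j < l" by simp
        show "g c x ((v + s *\<^sub>R axis k u) $ (ix ! j)) ((v + s *\<^sub>R axis k u) $ (ix ! j)) - 1 =
          (if j = j0 then 2 * s * g c x (vs ! j0) u + s * s * g c x u u else 0)"
        proof (cases "j = j0")
          case True
          have "(v + s *\<^sub>R axis k u) $ (ix ! j) = vs ! j0 + s *\<^sub>R u"
            using j0 True by (simp add: vsj axis_def)
          then show ?thesis
            using True unit[OF j0(1)] inner_form_commute[OF Gx, of u "vs ! j0"] by (simp add: inner_form_simps[OF Gx] algebra_simps)
        next
          case False
          then have "(v + s *\<^sub>R axis k u) $ (ix ! j) = vs ! j" using j nthk by (simp add: vsj axis_def)
          then show ?thesis using False unit[OF j] by simp
        qed
      qed simp
      then show ?thesis using j0 by simp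
    qed
    have "?L (?z + s *\<^sub>R ((0, axis k u), 0)) = \<kappa> + s * (\<kappa> * g c x (vs ! j0) u) -
        \<kappa> / 2 * (2 * s * g c x (vs ! j0) u + s * s * g c x u u)" for s
    proof -
      have z: "?z + s *\<^sub>R ((0, axis k u), 0) = ((x, v + s *\<^sub>R axis k u), \<kappa>)" by simp
      show ?thesis unfolding z lagrangian_def ix(1) fst_conv snd_conv phi sumg by (rule refl)
    qed
    moreover have "((\<lambda>s. \<kappa> + s * (\<kappa> * g c x (vs ! j0) u) - \<kappa> / 2 * (2 * s * g c x (vs ! j0) u + s * s * g c x u u))
        has_real_derivative 0) (at 0)"
      by (auto intro!: derivative_eq_intros)
    ultimately show "((\<lambda>s. ?L (?z + s *\<^sub>R ((0, axis k u), 0))) has_real_derivative 0) (at 0)" by simp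
  qed
  have multiplier: "D ((0, 0), 1) = 0"
  proof (rule dir)
    have "(\<Sum>j<l. g c x (v $ (ix ! j)) (v $ (ix ! j)) - 1) = 0"
      using unit vsj by (intro sum.neutral) auto
    then have "?L (?z + s *\<^sub>R ((0, 0), 1)) = \<kappa>" for s
      unfolding lagrangian_def ix(1) by (simp add: lam vs)
    then show "((\<lambda>s. ?L (?z + s *\<^sub>R ((0, 0), 1))) has_real_derivative 0) (at 0)" by simp
  qed
  obtain w y \<mu> where d: "d = ((w, y), \<mu>)" by (metis prod.exhaust)
  have vert: "D ((0, y), 0) = 0"
  proof -
    have "y = (\<Sum>k\<in>UNIV. axis k (y $ k))"
      by (simp add: vec_eq_iff axis_def sum.delta if_distrib cong: if_cong)
    moreover have "linear (\<lambda>y. D ((0, y), 0))"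
    proof (rule linearI)
      show "D ((0, a + b), 0) = D ((0, a), 0) + D ((0, b), 0)" for a b
        using linear_add[OF linD, of "((0, a), 0)" "((0, b), 0)"] by simp
      show "D ((0, r *\<^sub>R a), 0) = r *\<^sub>R D ((0, a), 0)" for r a
        using linear_scale[OF linD, of r "((0, a), 0)"] by simp
    qed
    ultimately have "D ((0, y), 0) = (\<Sum>k\<in>UNIV. D ((0, axis k (y $ k)), 0))"
      using linear_sum[of "\<lambda>y. D ((0, y), 0)"] by metis
    then show ?thesis by (simp add: vertical)
  qed
  have "d = ((w, 0), 0) + ((0, y), 0) + \<mu> *\<^sub>R ((0, 0), 1)" unfolding d by simp
  then have "D d = 0"
    by (simp only: linear_add[OF linD] linear_scale[OF linD]) (simp add: horizontal vert multiplier)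
  then show ?thesis unfolding D_def .
qed

text \<open>The value of \<open>\<phi>\<close> on the frame is the multiplier, and also the value of the Lagrangian.\<close>
lemma parallel_form_constant_on_critical_path:
  fixes g :: "('m, 'e::euclidean_space) metric" and ix :: "'n::finite list" and hs :: "('t::topological_space \<Rightarrow> 'e) list"
  assumes "open S" and G: "\<And>y. y \<in> S \<Longrightarrow> inner_form (g c y)"
    and smg: "\<And>u v. smooth_on S (\<lambda>y. g c y u v)"
    and alt: "\<And>y. y \<in> S \<Longrightarrow> alternating_form_on UNIV l (\<phi> c y)"
    and sm: "\<And>vs. length vs = l \<Longrightarrow> smooth_on S (\<lambda>y. \<phi> c y vs)"
    and par: "\<And>y w vs. y \<in> S \<Longrightarrow> length vs = l \<Longrightarrow> cov_deriv g \<phi> c y w vs = 0"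
    and ix: "length ix = l" "distinct ix" "set ix = UNIV"
    and "connected J" "continuous_on J x" "x ` J \<subseteq> S"
    and hs: "length hs = l" "\<And>h. h \<in> set hs \<Longrightarrow> continuous_on J h"
    and on: "\<And>t. t \<in> J \<Longrightarrow> orthonormal_list (g c (x t)) (map (\<lambda>h. h t) hs)"
    and crit: "\<And>t i u. t \<in> J \<Longrightarrow> i < l \<Longrightarrow>
      \<phi> c (x t) ((map (\<lambda>h. h t) hs)[i := u]) = \<phi> c (x t) (map (\<lambda>h. h t) hs) * g c (x t) (map (\<lambda>h. h t) hs ! i) u"
    and "s \<in> J" "t \<in> J"
  shows "\<phi> c (x s) (map (\<lambda>h. h s) hs) = \<phi> c (x t) (map (\<lambda>h. h t) hs)"
proof -
  define \<kappa> where "\<kappa> t = \<phi> c (x t) (map (\<lambda>h. h t) hs)" for t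
  \<comment> \<open>The frame as a vector-valued family: the index at position \<open>j\<close> of \<open>ix\<close> carries the vector at position
    \<open>j\<close> of \<open>hs\<close>.\<close>
  define v where "v t = (\<chi> i. (hs ! (SOME j. j < l \<and> ix ! j = i)) t)" for t
  have some: "(SOME j'. j' < l \<and> ix ! j' = ix ! j) = j" if "j < l" for j
    by (rule some_equality) (use that ix nth_eq_iff_index_eq in auto)
  have vix: "map (\<lambda>i. v t $ i) ix = map (\<lambda>h. h t) hs" for t
    by (rule nth_equalityI) (auto simp: v_def ix(1) hs(1) some)
  have cv: "continuous_on J (\<lambda>t. v t)"
    unfolding v_def
  proof (intro continuous_on_vec_lambda hs(2))
    fix i :: 'n
    have "i \<in> set ix" using ix(3) by simp
    then obtain j where "j < length ix" "ix ! j = i" unfolding in_set_conv_nth by blast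
    then show "hs ! (SOME j. j < l \<and> ix ! j = i) \<in> set hs"
      using some[of j] ix(1) hs(1) by auto
  qed
  note lag = smooth_on_lagrangian[where S = S and l = l and g = g and c = c and \<phi> = \<phi>, OF assms(1) G smg alt sm ix(1)]
  have c\<kappa>: "continuous_on J \<kappa>"
  proof -
    have "continuous_on J (\<lambda>t. lagrangian g \<phi> c ix ((x t, v t), 0))"
      by (rule continuous_on_compose2[OF smooth_on_continuous[OF lag(2)]])
        (use assms(11,12) cv in \<open>auto intro!: continuous_on_Pair\<close>)
    then show ?thesis unfolding \<kappa>_def[abs_def] lagrangian_def by (simp add: vix)
  qed
  have val: "lagrangian g \<phi> c ix ((x t, v t), \<kappa> t) = \<kappa> t" if "t \<in> J" for t
  proof -
    have "g c (x t) (v t $ (ix ! j)) (v t $ (ix ! j)) = 1" if "j < l" for j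
    proof -
      have "v t $ (ix ! j) = map (\<lambda>h. h t) hs ! j" using vix[of t] that ix(1) by (metis nth_map)
      then show ?thesis using on[OF \<open>t \<in> J\<close>] that hs(1) unfolding orthonormal_list_def by simp
    qed
    then have "(\<Sum>j<l. g c (x t) (v t $ (ix ! j)) (v t $ (ix ! j)) - 1) = 0"
      by (intro sum.neutral) auto
    then show ?thesis unfolding lagrangian_def ix(1) by (simp add: vix \<kappa>_def)
  qed
  have "lagrangian g \<phi> c ix ((x s, v s), \<kappa> s) = lagrangian g \<phi> c ix ((x t, v t), \<kappa> t)"
  proof (rule smooth_constant_on_critical_path[where J = J and \<gamma> = "\<lambda>t. ((x t, v t), \<kappa> t)",
        OF lag assms(10)])
    show "continuous_on J (\<lambda>t. ((x t, v t), \<kappa> t))"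
      by (intro continuous_on_Pair assms(11) cv c\<kappa>)
    show "(\<lambda>t. ((x t, v t), \<kappa> t)) ` J \<subseteq> (S \<times> UNIV) \<times> UNIV" using assms(12) by auto
    fix t d assume t: "t \<in> J"
    then have xt: "x t \<in> S" using assms(12) by auto
    show "frechet_derivative (lagrangian g \<phi> c ix) (at ((x t, v t), \<kappa> t)) d = 0"
      by (rule lagrangian_critical[where S = S and l = l and g = g and c = c and \<phi> = \<phi> and vs = "map (\<lambda>h. h t) hs", OF assms(1) G smg alt sm par[OF xt] ix xt vix[symmetric] on[OF t] _ ])
        (use crit[OF t] in \<open>auto simp: \<kappa>_def\<close>)
  qed (use assms in auto)
  then show ?thesis using val assms(17,18) unfolding \<kappa>_def by simp
qed

section \<open>Charts and transition maps\<close>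

lemma atlas_chart:
  assumes "smooth_atlas A" "c \<in> A"
  shows "open (fst c)" "open (snd c ` fst c)" "continuous_on (fst c) (snd c)" "inj_on (snd c) (fst c)"
    "\<And>p. p \<in> fst c \<Longrightarrow> inv_into (fst c) (snd c) (snd c p) = p"
    "continuous_on (snd c ` fst c) (inv_into (fst c) (snd c))"
proof -
  have *: "open (fst c)" "open (snd c ` fst c)" "homeomorphism (fst c) (snd c ` fst c) (snd c) (inv_into (fst c) (snd c))"
    using assms unfolding smooth_atlas_def by blast+
  then show "open (fst c)" "open (snd c ` fst c)" "continuous_on (fst c) (snd c)"
    "continuous_on (snd c ` fst c) (inv_into (fst c) (snd c))"
    "\<And>p. p \<in> fst c \<Longrightarrow> inv_into (fst c) (snd c) (snd c p) = p"
    unfolding homeomorphism_def by auto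
  then show "inj_on (snd c) (fst c)" by (metis inj_onI)
qed

lemma smooth_into_preimage_open:
  assumes "smooth_atlas A" "c \<in> A" "open S" "smooth_into A S F"
  shows "open {x \<in> S. F x \<in> fst c}"
proof -
  have "open (S \<inter> F -` fst c)"
    using continuous_open_preimage[of S F "fst c"] assms atlas_chart(1) unfolding smooth_into_def by blast
  moreover have "S \<inter> F -` fst c = {x \<in> S. F x \<in> fst c}" by auto
  ultimately show ?thesis by simp
qed

lemma smooth_into_has_derivative:
  assumes "smooth_into A S F" "c \<in> A" "x \<in> S" "F x \<in> fst c"
  shows "((snd c \<circ> F) has_derivative frechet_derivative (snd c \<circ> F) (at x)) (at x)"
  using assms unfolding smooth_into_def
  by (intro smooth_on_has_derivative[of "{x \<in> S. F x \<in> fst c}"]) auto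

lemma immersion_smooth: "immersion_into A W F \<Longrightarrow> smooth_into A W F"
  unfolding immersion_into_def by blast

lemma immersion_inj:
  "immersion_into A W F \<Longrightarrow> c \<in> A \<Longrightarrow> x \<in> W \<Longrightarrow> F x \<in> fst c \<Longrightarrow> inj (frechet_derivative (snd c \<circ> F) (at x))"
  unfolding immersion_into_def by blast

abbreviation transition_deriv ::
  "('m, 'e::euclidean_space) chart \<Rightarrow> ('m, 'e) chart \<Rightarrow> 'm \<Rightarrow> 'e \<Rightarrow> 'e" where
  "transition_deriv c d p \<equiv> frechet_derivative (transition c d) (at (snd c p))"

lemma transition_chart:
  assumes "smooth_atlas A" "c \<in> A" "p \<in> fst c"
  shows "transition c d (snd c p) = snd d p"
  using atlas_chart(5)[OF assms] unfolding transition_def by simp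

lemma transition_domain_open:
  assumes "smooth_atlas A" "c \<in> A" "d \<in> A"
  shows "open (snd c ` (fst c \<inter> fst d))"
proof -
  have "snd c ` (fst c \<inter> fst d) = snd c ` fst c \<inter> inv_into (fst c) (snd c) -` fst d"
    using atlas_chart(5)[OF assms(1,2)] by force
  then show ?thesis
    using continuous_open_preimage[OF atlas_chart(6,2)[OF assms(1,2)] atlas_chart(1)[OF assms(1,3)]] by simp
qed

lemma transition_has_derivative:
  assumes "smooth_atlas A" "c \<in> A" "d \<in> A" "p \<in> fst c" "p \<in> fst d"
  shows "(transition c d has_derivative transition_deriv c d p) (at (snd c p))"
  using assms unfolding smooth_atlas_def
  by (intro smooth_on_has_derivative[of "snd c ` (fst c \<inter> fst d)"]) auto

lemma transition_derivative_inverse: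
  assumes "smooth_atlas A" "c \<in> A" "d \<in> A" "p \<in> fst c" "p \<in> fst d"
  shows "transition_deriv d c p (transition_deriv c d p v) = v"
proof -
  have "((\<lambda>y. transition d c (transition c d y)) has_derivative
      (\<lambda>v. transition_deriv d c p (transition_deriv c d p v))) (at (snd c p))"
    by (rule has_derivative_compose[OF transition_has_derivative[OF assms]])
      (use transition_has_derivative[OF assms(1,3,2,5,4)] transition_chart[OF assms(1,2,4)] in simp)
  then have "((\<lambda>y. y) has_derivative
      (\<lambda>v. transition_deriv d c p (transition_deriv c d p v))) (at (snd c p))"
  proof (rule has_derivative_transform_within_open[OF _ transition_domain_open[OF assms(1-3)]])
    show "transition d c (transition c d y) = y" if y: "y \<in> snd c ` (fst c \<inter> fst d)" for y
    proof -
      obtain q where q: "y = snd c q" "q \<in> fst c" "q \<in> fst d" using y by blast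
      then show ?thesis
        using transition_chart[OF assms(1,2) q(2), of d] transition_chart[OF assms(1,3) q(3), of c] by simp
    qed
  qed (use assms in auto)
  from has_derivative_unique[OF this has_derivative_ident] show ?thesis by metis
qed

lemma transition_derivative_iso:
  assumes "smooth_atlas A" "c \<in> A" "d \<in> A" "p \<in> fst c" "p \<in> fst d"
  shows "linear (transition_deriv c d p)"
    "inj (transition_deriv c d p)"
  using has_derivative_linear[OF transition_has_derivative[OF assms]] transition_derivative_inverse[OF assms]
  by (auto intro: inj_on_inverseI)

lemma chart_change_derivative:
  fixes F :: "'k::euclidean_space \<Rightarrow> 'm::{t2_space,second_countable_topology}"
  assumes "smooth_atlas A" "c \<in> A" "d \<in> A" "open S" "smooth_into A S F" "x \<in> S" "F x \<in> fst c" "F x \<in> fst d"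
  shows "frechet_derivative (snd d \<circ> F) (at x) v =
    transition_deriv c d (F x) (frechet_derivative (snd c \<circ> F) (at x) v)"
proof -
  have "((\<lambda>y. transition c d ((snd c \<circ> F) y)) has_derivative
      (\<lambda>v. transition_deriv c d (F x) (frechet_derivative (snd c \<circ> F) (at x) v))) (at x)"
    by (rule has_derivative_compose[OF smooth_into_has_derivative[OF assms(5,2,6,7)]])
      (use transition_has_derivative[OF assms(1-3,7,8)] in simp)
  then have "((snd d \<circ> F) has_derivative
      (\<lambda>v. transition_deriv c d (F x) (frechet_derivative (snd c \<circ> F) (at x) v))) (at x)"
  proof (rule has_derivative_transform_within_open[OF _ smooth_into_preimage_open[OF assms(1,2,4,5)]])
    show "transition c d ((snd c \<circ> F) y) = (snd d \<circ> F) y" if "y \<in> {x \<in> S. F x \<in> fst c}" for y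
      using that transition_chart[OF assms(1,2)] by simp
  qed (use assms in auto)
  then show ?thesis using frechet_derivative_at by metis
qed

section \<open>Tangent spaces\<close>

text \<open>A continuous curve \<open>\<xi>\<close> is differentiable if its image under an immersion is. Composing with a left
  inverse of \<open>D\<close> makes the derivative of the immersion the identity; then increments of \<open>\<xi>\<close> are at
  most twice those of the image for small \<open>t\<close>, and so of order \<open>t\<close>, which turns the error term
  of the immersion into \<open>o(t)\<close>.\<close>
lemma lift_vector_derivative:
  fixes f :: "'k::euclidean_space \<Rightarrow> 'e::euclidean_space" and \<xi> :: "real \<Rightarrow> 'k"
  assumes f: "(f has_derivative D) (at (\<xi> 0))" and "inj D" and cont: "isCont \<xi> 0"
    and v: "((\<lambda>t. f (\<xi> t)) has_vector_derivative v) (at 0)"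
  shows "\<exists>k. (\<xi> has_vector_derivative k) (at 0)"
proof -
  have linD: "linear D" by (rule has_derivative_linear[OF f])
  obtain D' where D': "linear D'" "D' \<circ> D = id"
    using linear_injective_left_inverse[OF linD \<open>inj D\<close>] by blast
  have blD': "bounded_linear D'" using D'(1) linear_conv_bounded_linear by blast
  define k where "k = D' v"
  define h where "h x = D' (f x)" for x
  have h: "(h has_derivative (\<lambda>x. x)) (at (\<xi> 0))"
  proof -
    have "(h has_derivative (\<lambda>x. D' (D x))) (at (\<xi> 0))"
      unfolding h_def by (rule bounded_linear.has_derivative[OF blD' f])
    moreover have "D' (D x) = x" for x using fun_cong[OF D'(2), of x] by simp
    ultimately show ?thesis by simp
  qed
  have hv: "((\<lambda>t. h (\<xi> t)) has_derivative (\<lambda>t. t *\<^sub>R k)) (at 0)"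
    using bounded_linear.has_vector_derivative[OF blD' v] unfolding h_def k_def has_vector_derivative_def .
  have "(\<xi> has_derivative (\<lambda>t. t *\<^sub>R k)) (at 0)"
    unfolding has_derivative_at_alt
  proof (intro conjI allI impI)
    show "bounded_linear (\<lambda>t. t *\<^sub>R k)" by (rule bounded_linear_scaleR_left)
    fix e :: real assume e: "e > 0"
    \<comment> \<open>The bound \<open>1/2\<close> lets the error of \<open>h\<close> be absorbed, which gives \<open>norm a \<le> 2 * (norm k + 1) * \<bar>t\<bar>\<close> below;
      the second bound makes \<open>e1\<close> times this at most \<open>e / 2 * \<bar>t\<bar>\<close>.\<close>
    define e1 where "e1 = min (1/2) (e / (2 * (norm k + 1) * 2))"
    have e1: "e1 > 0" "e1 \<le> 1/2" "e1 * (2 * (norm k + 1)) \<le> e / 2"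
    proof -
      show "e1 > 0" using e unfolding e1_def by (auto intro!: divide_pos_pos mult_pos_pos add_nonneg_pos)
      show "e1 \<le> 1/2" unfolding e1_def by (rule min.cobounded1)
      have pos: "norm k + 1 > 0" by (simp add: add_nonneg_pos)
      have "e1 * (2 * (norm k + 1)) \<le> e / (2 * (norm k + 1) * 2) * (2 * (norm k + 1))"
        by (rule mult_right_mono) (use pos in \<open>auto simp: e1_def\<close>)
      also have "\<dots> = e / 2"
      proof -
        have "e / (2 * K * 2) * (2 * K) = e / 2" if "K > 0" for K using that by (simp add: field_simps)
        from this[OF pos] show ?thesis .
      qed
      finally show "e1 * (2 * (norm k + 1)) \<le> e / 2" .
    qed
    obtain d1 where d1: "d1 > 0" "\<And>y. norm (y - \<xi> 0) < d1 \<Longrightarrow> norm (h y - h (\<xi> 0) - (y - \<xi> 0)) \<le> e1 * norm (y - \<xi> 0)"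
      using h e1(1) unfolding has_derivative_at_alt by blast
    obtain d2 where d2: "d2 > 0" "\<And>t. norm (t - 0) < d2 \<Longrightarrow> norm (h (\<xi> t) - h (\<xi> 0) - (t - 0) *\<^sub>R k) \<le> min 1 (e / 2) * norm (t - 0)"
      using hv e unfolding has_derivative_at_alt by (metis half_gt_zero min_less_iff_conj zero_less_one)
    obtain d3 where d3: "d3 > 0" "\<And>t. dist t 0 < d3 \<Longrightarrow> dist (\<xi> t) (\<xi> 0) < d1"
      using cont d1(1) unfolding continuous_at_eps_delta by blast
    show "\<exists>d>0. \<forall>y. norm (y - 0) < d \<longrightarrow> norm (\<xi> y - \<xi> 0 - (y - 0) *\<^sub>R k) \<le> e * norm (y - 0)"
    proof (intro exI[of _ "min d2 d3"] conjI allI impI)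
      fix t :: real assume t: "norm (t - 0) < min d2 d3"
      define a where "a = \<xi> t - \<xi> 0"
      define b where "b = h (\<xi> t) - h (\<xi> 0)"
      have 1: "norm (b - a) \<le> e1 * norm a"
        unfolding a_def b_def by (rule d1(2)) (use d3(2)[of t] t in \<open>auto simp: dist_norm\<close>)
      have 2: "norm (b - t *\<^sub>R k) \<le> min 1 (e / 2) * \<bar>t\<bar>"
        unfolding b_def using d2(2)[of t] t by simp
      have "min 1 (e / 2) * \<bar>t\<bar> \<le> \<bar>t\<bar>" using mult_right_mono[of "min 1 (e/2)" 1 "\<bar>t\<bar>"] by simp
      then have "norm b \<le> norm k * \<bar>t\<bar> + \<bar>t\<bar>"
        using 2 norm_triangle_sub[of b "t *\<^sub>R k"] by (simp add: mult.commute)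
      moreover have "norm a \<le> norm b + norm (b - a)"
        using norm_triangle_sub[of a b] by (simp add: norm_minus_commute)
      moreover have "e1 * norm a \<le> 1/2 * norm a" by (rule mult_right_mono) (use e1 in auto)
      ultimately have a: "norm a \<le> 2 * (norm k + 1) * \<bar>t\<bar>" using 1 by (simp add: algebra_simps)
      have "norm (a - t *\<^sub>R k) \<le> norm (b - a) + norm (b - t *\<^sub>R k)"
        using norm_triangle_ineq[of "a - b" "b - t *\<^sub>R k"] by (simp add: norm_minus_commute)
      also have "\<dots> \<le> e1 * (2 * (norm k + 1) * \<bar>t\<bar>) + e / 2 * \<bar>t\<bar>"
      proof (rule add_mono)
        show "norm (b - a) \<le> e1 * (2 * (norm k + 1) * \<bar>t\<bar>)"
          using e1(1) by (intro order_trans[OF 1 mult_left_mono[OF a]]) simp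
        show "norm (b - t *\<^sub>R k) \<le> e / 2 * \<bar>t\<bar>"
          by (rule order_trans[OF 2 mult_right_mono]) (auto simp: min.cobounded2)
      qed
      also have "\<dots> \<le> e * \<bar>t\<bar>"
        using mult_right_mono[OF e1(3), of "\<bar>t\<bar>"] by (simp add: algebra_simps)
      finally show "norm (\<xi> t - \<xi> 0 - (t - 0) *\<^sub>R k) \<le> e * norm (t - 0)" unfolding a_def by simp
    qed (use d2 d3 in auto)
  qed
  then show ?thesis unfolding has_vector_derivative_def by blast
qed

text \<open>Tangent vectors are velocities of arbitrary smooth curves in \<open>L\<close>. A local parametrization has a continuous inverse
  on an open part of \<open>L\<close>, so each curve lifts to its domain, continuously and then differentiably.\<close>
lemma curve_lift:
  fixes \<rho> :: "'k::euclidean_space \<Rightarrow> 'm::{t2_space,second_countable_topology}"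
    and A :: "('m, 'e::euclidean_space) chart set"
  assumes atl: "smooth_atlas A" and lp: "local_param A L W \<rho>" and x0: "x0 \<in> W" and cv: "curve_in A L (\<rho> x0) \<gamma>"
  shows "\<exists>\<xi> k. \<xi> 0 = x0 \<and> (\<xi> has_vector_derivative k) (at 0) \<and> (\<exists>\<delta>>0. \<forall>t. \<bar>t\<bar> < \<delta> \<longrightarrow> \<xi> t \<in> W \<and> \<gamma> t = \<rho> (\<xi> t))"
proof -
  obtain c where c: "c \<in> A" "\<rho> x0 \<in> fst c" using atl unfolding smooth_atlas_def by blast
  obtain \<epsilon> where \<epsilon>: "\<epsilon> > 0" "\<gamma> ` {-\<epsilon><..<\<epsilon>} \<subseteq> L" "smooth_into A {-\<epsilon><..<\<epsilon>} \<gamma>" and \<gamma>0: "\<gamma> 0 = \<rho> x0"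
    using cv unfolding curve_in_def by blast
  have W: "open W" "immersion_into A W \<rho>" "openin (top_of_set L) (\<rho> ` W)"
    using lp unfolding local_param_def by auto
  obtain \<sigma> where \<sigma>: "homeomorphism W (\<rho> ` W) \<rho> \<sigma>" using lp unfolding local_param_def by blast
  obtain U where U: "open U" "\<rho> ` W = L \<inter> U" using W(3) unfolding openin_open by blast
  have cont\<gamma>: "continuous_on {-\<epsilon><..<\<epsilon>} \<gamma>" using \<epsilon>(3) unfolding smooth_into_def by blast
  have "open ({-\<epsilon><..<\<epsilon>} \<inter> \<gamma> -` U)" by (rule continuous_open_preimage[OF cont\<gamma> _ U(1)]) simp
  moreover have "0 \<in> {-\<epsilon><..<\<epsilon>} \<inter> \<gamma> -` U" using \<epsilon>(1) \<gamma>0 U(2) x0 by auto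
  ultimately obtain \<delta> where \<delta>: "\<delta> > 0" "ball 0 \<delta> \<subseteq> {-\<epsilon><..<\<epsilon>} \<inter> \<gamma> -` U"
    using open_contains_ball by blast
  define \<xi> where "\<xi> t = \<sigma> (\<gamma> t)" for t
  have in\<rho>: "\<gamma> t \<in> \<rho> ` W" if "\<bar>t\<bar> < \<delta>" for t
  proof -
    have "t \<in> ball 0 \<delta>" using that by simp
    then show ?thesis using \<delta>(2) \<epsilon>(2) U(2) by blast
  qed
  have lift: "\<xi> t \<in> W \<and> \<gamma> t = \<rho> (\<xi> t)" if "\<bar>t\<bar> < \<delta>" for t
    using in\<rho>[OF that] \<sigma> unfolding homeomorphism_def \<xi>_def by auto
  have \<xi>0: "\<xi> 0 = x0" using \<sigma> x0 \<gamma>0 unfolding homeomorphism_def \<xi>_def by auto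
  have "continuous_on (ball 0 \<delta>) \<xi>"
    unfolding \<xi>_def
  proof (rule continuous_on_compose2[of "\<rho> ` W" \<sigma>])
    show "continuous_on (\<rho> ` W) \<sigma>" using \<sigma> unfolding homeomorphism_def by blast
    show "continuous_on (ball 0 \<delta>) \<gamma>" using cont\<gamma> \<delta>(2) continuous_on_subset by blast
    show "\<gamma> ` ball 0 \<delta> \<subseteq> \<rho> ` W" using in\<rho> by auto
  qed
  then have "isCont \<xi> 0" using \<delta>(1) by (simp add: continuous_on_eq_continuous_at)
  moreover have "((snd c \<circ> \<rho>) has_derivative frechet_derivative (snd c \<circ> \<rho>) (at x0)) (at (\<xi> 0))"
    unfolding \<xi>0 by (rule smooth_into_has_derivative[OF immersion_smooth[OF W(2)] c(1) x0 c(2)])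
  moreover have "inj (frechet_derivative (snd c \<circ> \<rho>) (at x0))"
    by (rule immersion_inj[OF W(2) c(1) x0 c(2)])
  moreover have "\<exists>v. ((\<lambda>t. (snd c \<circ> \<rho>) (\<xi> t)) has_vector_derivative v) (at 0)"
  proof -
    have "((snd c \<circ> \<gamma>) has_derivative frechet_derivative (snd c \<circ> \<gamma>) (at 0)) (at 0)"
      by (rule smooth_into_has_derivative[OF \<epsilon>(3) c(1)]) (use \<epsilon> c \<gamma>0 in auto)
    then have "(snd c \<circ> \<gamma>) differentiable (at 0)" unfolding differentiable_def by blast
    then obtain v where "((snd c \<circ> \<gamma>) has_vector_derivative v) (at 0)"
      using vector_derivative_works by blast
    then have "((\<lambda>t. (snd c \<circ> \<rho>) (\<xi> t)) has_vector_derivative v) (at 0)"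
      by (rule has_vector_derivative_transform_within_open[of _ _ _ "ball 0 \<delta>"]) (use \<delta>(1) lift in auto)
    then show ?thesis by blast
  qed
  ultimately obtain k where "(\<xi> has_vector_derivative k) (at 0)"
    using lift_vector_derivative by blast
  then show ?thesis using \<xi>0 \<delta>(1) lift by blast
qed

lemma velocity_lifted_curve:
  fixes F :: "'k::euclidean_space \<Rightarrow> 'm::topological_space" and A :: "('m, 'e::euclidean_space) chart set"
  assumes "smooth_into A W F" "c \<in> A" "\<xi> 0 \<in> W" "F (\<xi> 0) \<in> fst c" "(\<xi> has_vector_derivative k) (at 0)"
    and "\<delta> > 0" "\<And>t. \<bar>t\<bar> < \<delta> \<Longrightarrow> \<gamma> t = F (\<xi> t)"
  shows "velocity c \<gamma> = frechet_derivative (snd c \<circ> F) (at (\<xi> 0)) k"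
proof -
  let ?D = "frechet_derivative (snd c \<circ> F) (at (\<xi> 0))"
  have D: "((snd c \<circ> F) has_derivative ?D) (at (\<xi> 0))"
    by (rule smooth_into_has_derivative[OF assms(1-4)])
  have "((\<lambda>t. (snd c \<circ> F) (\<xi> t)) has_derivative (\<lambda>t. ?D (t *\<^sub>R k))) (at 0)"
    by (rule has_derivative_compose[OF assms(5)[unfolded has_vector_derivative_def] D])
  then have "((\<lambda>t. (snd c \<circ> F) (\<xi> t)) has_vector_derivative ?D k) (at 0)"
    unfolding has_vector_derivative_def using linear_scale[OF has_derivative_linear[OF D]] by simp
  then have "((snd c \<circ> \<gamma>) has_vector_derivative ?D k) (at 0)"
    by (rule has_vector_derivative_transform_within_open[of _ _ _ "ball 0 \<delta>"]) (use assms in auto)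
  then show ?thesis unfolding velocity_def by (rule vector_derivative_at)
qed

lemma line_curve:
  fixes \<rho> :: "'k::euclidean_space \<Rightarrow> 'm::{t2_space,second_countable_topology}"
    and A :: "('m, 'e::euclidean_space) chart set"
  assumes atl: "smooth_atlas A" and lp: "local_param A L W \<rho>" and x0: "x0 \<in> W"
  shows "curve_in A L (\<rho> x0) (\<lambda>t. \<rho> (x0 + t *\<^sub>R k))" "\<exists>\<delta>>0. \<forall>t. \<bar>t\<bar> < \<delta> \<longrightarrow> x0 + t *\<^sub>R k \<in> W"
proof -
  let ?a = "\<lambda>t::real. x0 + t *\<^sub>R k"
  have W: "open W" "smooth_into A W \<rho>" "\<rho> ` W \<subseteq> L"
    using lp immersion_smooth openin_imp_subset unfolding local_param_def by blast+
  have "open (?a -` W)" by (rule open_vimage[OF W(1)]) (intro continuous_intros)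
  moreover have "0 \<in> ?a -` W" using x0 by simp
  ultimately obtain \<epsilon> where \<epsilon>: "\<epsilon> > 0" "ball 0 \<epsilon> \<subseteq> ?a -` W" using open_contains_ball by blast
  have ball: "{-\<epsilon><..<\<epsilon>} = ball 0 \<epsilon>" by (auto simp: dist_real_def)
  have aW: "?a t \<in> W" if "t \<in> {-\<epsilon><..<\<epsilon>}" for t using \<epsilon>(2) that unfolding ball by blast
  then show "\<exists>\<delta>>0. \<forall>t. \<bar>t\<bar> < \<delta> \<longrightarrow> ?a t \<in> W" using \<epsilon>(1) by (intro exI[of _ \<epsilon>]) (auto simp: abs_less_iff)
  have "smooth_into A {-\<epsilon><..<\<epsilon>} (\<lambda>t. \<rho> (?a t))"
    unfolding smooth_into_def
  proof (intro conjI ballI)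
    show cont: "continuous_on {-\<epsilon><..<\<epsilon>} (\<lambda>t. \<rho> (?a t))"
      by (rule continuous_on_compose2[of W \<rho>]) (use W(2) aW in \<open>auto simp: smooth_into_def intro!: continuous_intros\<close>)
    fix c assume c: "c \<in> A"
    let ?S = "{t \<in> {-\<epsilon><..<\<epsilon>}. \<rho> (?a t) \<in> fst c}"
    have op: "open ?S"
    proof -
      have "open ({-\<epsilon><..<\<epsilon>} \<inter> (\<lambda>t. \<rho> (?a t)) -` fst c)"
        by (rule continuous_open_preimage[OF cont _ atlas_chart(1)[OF atl c]]) simp
      moreover have "{-\<epsilon><..<\<epsilon>} \<inter> (\<lambda>t. \<rho> (?a t)) -` fst c = ?S" by auto
      ultimately show ?thesis by simp
    qed
    have sa: "smooth_on ?S ?a"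
      by (intro smooth_on_add[OF op] smooth_on_const[OF op] smooth_on_linear[OF _ op] bounded_linear_scaleR_left)
    have "smooth_on ?S (\<lambda>t. (snd c \<circ> \<rho>) (?a t))"
    proof (rule smooth_on_compose[OF op _ sa])
      show "smooth_on {x \<in> W. \<rho> x \<in> fst c} (snd c \<circ> \<rho>)" using W(2) c unfolding smooth_into_def by blast
    qed (use aW in auto)
    then show "smooth_on ?S (snd c \<circ> (\<lambda>t. \<rho> (?a t)))" by (simp add: o_def)
  qed
  then show "curve_in A L (\<rho> x0) (\<lambda>t. \<rho> (?a t))"
    unfolding curve_in_def using \<epsilon>(1) aW W(3) by (intro conjI exI[of _ \<epsilon>]) auto
qed

lemma line_has_vector_derivative:
  "((\<lambda>t. x0 + t *\<^sub>R k) has_vector_derivative k) (at 0)"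
  by (auto intro!: derivative_eq_intros)

text \<open>In a local parametrization the differential of \<open>f\<close> is given by the derivatives of \<open>\<rho>\<close> and \<open>f \<circ> \<rho>\<close> on a common
  vector \<open>k\<close> of the parameter space.\<close>
lemma differential_rel_local_param:
  fixes \<rho> :: "'k::euclidean_space \<Rightarrow> 'm::{t2_space,second_countable_topology}"
    and A :: "('m, 'e::euclidean_space) chart set"
  assumes atl: "smooth_atlas A" and lp: "local_param A L W \<rho>" and x0: "x0 \<in> W"
    and c: "c \<in> A" "\<rho> x0 \<in> fst c" and d: "d \<in> A" "f (\<rho> x0) \<in> fst d" and sm: "smooth_into A W (f \<circ> \<rho>)"
  shows "differential_rel A L f c d (\<rho> x0) u v \<longleftrightarrow>
    (\<exists>k. u = frechet_derivative (snd c \<circ> \<rho>) (at x0) k \<and> v = frechet_derivative (snd d \<circ> (f \<circ> \<rho>)) (at x0) k)"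
proof
  have sm\<rho>: "smooth_into A W \<rho>" using lp immersion_smooth unfolding local_param_def by blast
  {
    assume "differential_rel A L f c d (\<rho> x0) u v"
    then obtain \<gamma> where \<gamma>: "curve_in A L (\<rho> x0) \<gamma>" "velocity c \<gamma> = u" "velocity d (f \<circ> \<gamma>) = v"
      unfolding differential_rel_def by blast
    obtain \<xi> k \<delta> where \<xi>: "\<xi> 0 = x0" "(\<xi> has_vector_derivative k) (at 0)" "\<delta> > 0"
      "\<And>t. \<bar>t\<bar> < \<delta> \<Longrightarrow> \<gamma> t = \<rho> (\<xi> t)"
      using curve_lift[OF atl lp x0 \<gamma>(1)] by blast
    have "velocity c \<gamma> = frechet_derivative (snd c \<circ> \<rho>) (at (\<xi> 0)) k"
      by (rule velocity_lifted_curve[OF sm\<rho> c(1) _ _ \<xi>(2,3,4)]) (use \<xi>(1) x0 c in auto)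
    moreover have "velocity d (f \<circ> \<gamma>) = frechet_derivative (snd d \<circ> (f \<circ> \<rho>)) (at (\<xi> 0)) k"
      by (rule velocity_lifted_curve[OF sm d(1) _ _ \<xi>(2,3)]) (use \<xi>(1,4) x0 d in auto)
    ultimately show "\<exists>k. u = frechet_derivative (snd c \<circ> \<rho>) (at x0) k \<and> v = frechet_derivative (snd d \<circ> (f \<circ> \<rho>)) (at x0) k"
      using \<gamma> \<xi>(1) by auto
  }
  assume "\<exists>k. u = frechet_derivative (snd c \<circ> \<rho>) (at x0) k \<and> v = frechet_derivative (snd d \<circ> (f \<circ> \<rho>)) (at x0) k"
  then obtain k where k: "u = frechet_derivative (snd c \<circ> \<rho>) (at x0) k" "v = frechet_derivative (snd d \<circ> (f \<circ> \<rho>)) (at x0) k"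
    by blast
  let ?\<xi> = "\<lambda>t::real. x0 + t *\<^sub>R k"
  have "velocity c (\<lambda>t. \<rho> (?\<xi> t)) = frechet_derivative (snd c \<circ> \<rho>) (at (?\<xi> 0)) k"
    by (rule velocity_lifted_curve[OF sm\<rho> c(1) _ _ line_has_vector_derivative zero_less_one]) (use x0 c in auto)
  moreover have "velocity d (f \<circ> (\<lambda>t. \<rho> (?\<xi> t))) = frechet_derivative (snd d \<circ> (f \<circ> \<rho>)) (at (?\<xi> 0)) k"
    by (rule velocity_lifted_curve[OF sm d(1) _ _ line_has_vector_derivative zero_less_one]) (use x0 d in auto)
  ultimately show "differential_rel A L f c d (\<rho> x0) u v"
    unfolding differential_rel_def using line_curve(1)[OF atl lp x0, of k] k
    by (intro exI[of _ "\<lambda>t. \<rho> (?\<xi> t)"]) simp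
qed

lemma tangent_space_local_param:
  fixes \<rho> :: "'k::euclidean_space \<Rightarrow> 'm::{t2_space,second_countable_topology}"
    and A :: "('m, 'e::euclidean_space) chart set"
  assumes atl: "smooth_atlas A" and lp: "local_param A L W \<rho>" and x0: "x0 \<in> W"
    and c: "c \<in> A" "\<rho> x0 \<in> fst c"
  shows "tangent_space A L c (\<rho> x0) = range (frechet_derivative (snd c \<circ> \<rho>) (at x0))"
proof -
  have sm: "smooth_into A W (id \<circ> \<rho>)" using lp immersion_smooth unfolding local_param_def by auto
  have "u \<in> tangent_space A L c (\<rho> x0) \<longleftrightarrow> differential_rel A L id c c (\<rho> x0) u u" for u
    unfolding tangent_space_def differential_rel_def by auto
  then show ?thesis
    using differential_rel_local_param[OF atl lp x0 c c(1) _ sm] c(2) by (auto simp: o_def)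
qed

lemma local_param_embedding:
  fixes \<rho> :: "'k::euclidean_space \<Rightarrow> 'm::topological_space" and K :: "'k itself"
  assumes emb: "smooth_embedding K A L f" and lp: "local_param A L W \<rho>"
  shows "local_param A (f ` L) W (f \<circ> \<rho>)"
proof -
  obtain h where h: "homeomorphism L (f ` L) f h" using emb unfolding smooth_embedding_def by blast
  obtain \<sigma> where \<sigma>: "homeomorphism W (\<rho> ` W) \<rho> \<sigma>" using lp unfolding local_param_def by blast
  have op: "openin (top_of_set L) (\<rho> ` W)" and "open W" using lp unfolding local_param_def by auto
  then have sub: "\<rho> ` W \<subseteq> L" using openin_imp_subset by blast
  have h2: "homeomorphism (\<rho> ` W) (f ` \<rho> ` W) f h"
    by (rule homeomorphism_of_subsets[OF h sub]) (use sub in auto)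
  have "immersion_into A W (f \<circ> \<rho>)" using emb lp unfolding smooth_embedding_def by blast
  moreover have "openin (top_of_set (f ` L)) ((f \<circ> \<rho>) ` W)"
    using homeomorphism_imp_open_map[OF h op] by (simp add: image_comp)
  moreover have "homeomorphism W ((f \<circ> \<rho>) ` W) (f \<circ> \<rho>) (\<sigma> \<circ> h)"
    using homeomorphism_compose[OF \<sigma> h2] by (simp add: image_comp)
  ultimately show ?thesis unfolding local_param_def using \<open>open W\<close> by blast
qed

section \<open>Bases and volume forms\<close>

text \<open>A finite type with as many elements as the dimension of \<open>'k\<close>; it indexes the frames of the
  Lagrangian.\<close>
typedef (overloaded) ('k::euclidean_space) basis_index = "Basis :: 'k set"
  by (rule exI[of _ "SOME b. b \<in> Basis"], rule SOME_Basis)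

instance basis_index :: (euclidean_space) finite
proof
  have "(UNIV :: 'a basis_index set) = Abs_basis_index ` (Basis :: 'a set)"
    by (metis type_definition.Abs_image type_definition_basis_index)
  then show "finite (UNIV :: 'a basis_index set)" using finite_imageI[OF finite_Basis] by metis
qed

lemma card_basis_index: "CARD('k::euclidean_space basis_index) = DIM('k)"
  by (rule type_definition.card[OF type_definition_basis_index])

lemma basis_list_iff: "basis_list T vs \<longleftrightarrow> span (set vs) = T \<and> length vs = dim T"
  using basis_list_length basis_listI unfolding basis_list_def by blast

lemma basis_list_map:
  fixes \<tau> :: "'a::euclidean_space \<Rightarrow> 'b::euclidean_space"
  assumes "linear \<tau>" "inj \<tau>"
  shows "basis_list (\<tau> ` T) (map \<tau> vs) \<longleftrightarrow> basis_list T vs"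
proof -
  have "span (set (map \<tau> vs)) = \<tau> ` T \<longleftrightarrow> span (set vs) = T"
    using linear_span_image[OF assms(1)] assms(2) by (simp add: inj_image_eq_iff)
  moreover have "dim (\<tau> ` T) = dim T"
    by (rule dim_image_eq[OF assms(1)]) (use assms(2) inj_on_subset in blast)
  ultimately show ?thesis unfolding basis_list_iff by simp
qed

lemma list_all2_joint_map:
  "list_all2 (\<lambda>u v. \<exists>k. u = a k \<and> v = b k) us vs \<longleftrightarrow> (\<exists>ks. us = map a ks \<and> vs = map b ks)"
proof
  show "\<exists>ks. us = map a ks \<and> vs = map b ks" if "list_all2 (\<lambda>u v. \<exists>k. u = a k \<and> v = b k) us vs"
    using that
  proof (induction rule: list_all2_induct)
    case (Cons u us v vs)
    then obtain k ks where "u = a k" "v = b k" "us = map a ks" "vs = map b ks" by blast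
    then show ?case by (intro exI[of _ "k # ks"]) simp
  qed simp
qed (auto simp: list_all2_conv_all_nth)

lemma gram_schmidt_sign:
  fixes vs :: "'e::euclidean_space list"
  assumes "alternating_form_on UNIV l \<omega>" "inner_form G" "basis_list T vs" "length vs = l"
  shows "0 < \<omega> vs \<longleftrightarrow> 0 < \<omega> (gram_schmidt G [] vs)" "\<omega> vs = 0 \<longleftrightarrow> \<omega> (gram_schmidt G [] vs) = 0"
proof -
  obtain \<kappa> where "\<kappa> > 0" "\<omega> ([] @ vs) = \<kappa> * \<omega> (gram_schmidt G [] vs)"
    using alternating_gram_schmidt[OF assms(1,2) orthonormal_list_Nil, of T vs] assms(3,4) by auto
  then show "0 < \<omega> vs \<longleftrightarrow> 0 < \<omega> (gram_schmidt G [] vs)" "\<omega> vs = 0 \<longleftrightarrow> \<omega> (gram_schmidt G [] vs) = 0"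
    by (auto simp: zero_less_mult_iff)
qed

text \<open>Here \<open>\<omega>\<close> defines the orientation \<open>P\<close>, and \<open>\<phi>\<close> is the volume form. By orthonormalisation it is enough
  to treat an orthonormal basis: if it is not positive, it becomes so when its first vector is reversed,
  which changes the sign of both forms.\<close>
lemma volume_form_sign:
  fixes T :: "'e::euclidean_space set"
  assumes \<omega>: "alternating_form_on UNIV l \<omega>" and \<phi>: "alternating_form_on UNIV l \<phi>" and G: "inner_form G"
    and T: "dim T = l" "0 < l"
    and ne: "\<And>vs. basis_list T vs \<Longrightarrow> \<omega> vs \<noteq> 0"
    and P: "\<And>vs. P vs \<longleftrightarrow> basis_list T vs \<and> 0 < \<omega> vs"
    and vol: "\<And>es. P es \<Longrightarrow> orthonormal_list G es \<Longrightarrow> \<phi> es = 1"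
    and us: "basis_list T us"
  shows "P us \<longleftrightarrow> 0 < \<phi> us" "\<bar>\<phi> (gram_schmidt G [] us)\<bar> = 1"
proof -
  define es where "es = gram_schmidt G [] us"
  have len: "length us = l" using basis_list_length[OF us] T by simp
  have es: "orthonormal_list G es" "basis_list T es"
    using gram_schmidt_orthonormal[OF G orthonormal_list_Nil, of T us] us unfolding es_def by auto
  have lenes: "length es = l" using basis_list_length[OF es(2)] T by simp
  obtain e es' where ees: "es = e # es'" using lenes T(2) by (cases es) auto
  have pos: "\<phi> es = 1" if "0 < \<omega> es" using vol[of es] P[of es] es that by blast
  have neg: "\<phi> es = -1" if "\<omega> es < 0"
  proof -
    define fs where "fs = (- e) # es'"
    have sign: "\<psi> fs = - \<psi> es" if "alternating_form_on UNIV l \<psi>" for \<psi>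
    proof -
      have "linear (\<lambda>x. \<psi> (x # es'))"
        using alternating_linear[OF that, of "[]" es'] lenes ees by simp
      then show ?thesis unfolding fs_def ees by (rule linear_neg)
    qed
    have "basis_list T fs"
    proof (rule basis_listI)
      have "span (set fs) = span (set es)"
      proof (rule subset_antisym; rule span_minimal)
        show "set fs \<subseteq> span (set es)" unfolding fs_def ees
          by (auto intro: span_base span_neg)
        have "- (- e) \<in> span (set fs)" by (rule span_neg) (auto simp: fs_def intro: span_base)
        then show "set es \<subseteq> span (set fs)" unfolding ees by (auto simp: fs_def intro: span_base)
      qed auto
      then show "span (set fs) = T" using es(2) unfolding basis_list_def by blast
      show "length fs = dim T" using lenes T(1) unfolding fs_def ees by simp
    qed
    moreover have "orthonormal_list G fs"
      unfolding orthonormal_list_def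
    proof (intro allI impI)
      fix i j assume ij: "i < length fs" "j < length fs"
      have on: "G (es ! i) (es ! j) = (if i = j then 1 else 0)"
        using es(1) ij unfolding orthonormal_list_def fs_def ees by simp
      have "fs ! n = (if n = 0 then - es ! n else es ! n)" for n
        unfolding fs_def ees by (cases n) auto
      then show "G (fs ! i) (fs ! j) = (if i = j then 1 else 0)"
        using on by (auto simp: linear_neg[OF inner_form_linear(1)[OF G]] linear_neg[OF inner_form_linear(2)[OF G]])
    qed
    moreover have "0 < \<omega> fs" using sign[OF \<omega>] that by simp
    ultimately have "\<phi> fs = 1" using vol[of fs] P[of fs] by blast
    then show ?thesis using sign[OF \<phi>] by simp
  qed
  have "\<omega> es \<noteq> 0" by (rule ne[OF es(2)])
  then show "\<bar>\<phi> (gram_schmidt G [] us)\<bar> = 1" using pos neg unfolding es_def[symmetric] by fastforce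
  have "0 < \<phi> es \<longleftrightarrow> 0 < \<omega> es" using \<open>\<omega> es \<noteq> 0\<close> pos neg by (cases "0 < \<omega> es") auto
  then show "P us \<longleftrightarrow> 0 < \<phi> us"
    using P[of us] us gram_schmidt_sign(1)[OF \<omega> G us len] gram_schmidt_sign(1)[OF \<phi> G us len]
    unfolding es_def by blast
qed

section \<open>Deformations through submanifolds preserved by \<open>\<phi>\<close>-hat\<close>

locale parallel_form_deformation =
  fixes A :: "('m::{t2_space,second_countable_topology}, 'e::euclidean_space) chart set"
    and g :: "('m, 'e) metric" and l :: nat and \<phi> :: "('m, 'e) dform"
    and K :: "'k::euclidean_space itself"
    and L :: "'m set" and f :: "real \<Rightarrow> 'm \<Rightarrow> 'm"
  assumes atl: "smooth_atlas A" and met: "riemannian_metric A g" and form: "differential_form A l \<phi>"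
    and par: "parallel_form A g l \<phi>" and dimK: "DIM('k) = l"
    and emb: "t \<in> {0..1} \<Longrightarrow> smooth_embedding K A L (f t)"
    and start: "p \<in> L \<Longrightarrow> f 0 p = p"
    and cont: "Cinf_continuous_family K A L f"
    and hat: "t \<in> {0..1} \<Longrightarrow> form_hat_submanifold K A g l \<phi> (f t ` L)"
begin

lemma inner: "c \<in> A \<Longrightarrow> x \<in> snd c ` fst c \<Longrightarrow> inner_form (g c x)"
  using met unfolding riemannian_metric_def inner_form_def by blast

lemma smooth_metric: "c \<in> A \<Longrightarrow> smooth_on (snd c ` fst c) (\<lambda>x. g c x u v)"
  using met unfolding riemannian_metric_def by blast

lemma metric_transition:
  assumes "c \<in> A" "d \<in> A" "p \<in> fst c" "p \<in> fst d"
  shows "g c (snd c p) u v = g d (snd d p) (transition_deriv c d p u)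
    (transition_deriv c d p v)"
proof -
  have "snd c p \<in> snd c ` (fst c \<inter> fst d)" using assms by blast
  then show ?thesis using met assms(1,2) unfolding riemannian_metric_def
    by (metis transition_chart[OF atl assms(1,3), of d])
qed

lemma alternating: "c \<in> A \<Longrightarrow> x \<in> snd c ` fst c \<Longrightarrow> alternating_form_on UNIV l (\<phi> c x)"
  using form unfolding differential_form_def by blast

lemma smooth_form: "c \<in> A \<Longrightarrow> length vs = l \<Longrightarrow> smooth_on (snd c ` fst c) (\<lambda>x. \<phi> c x vs)"
  using form unfolding differential_form_def by blast

lemma form_transition:
  assumes "c \<in> A" "d \<in> A" "p \<in> fst c" "p \<in> fst d" "length vs = l"
  shows "\<phi> c (snd c p) vs = \<phi> d (snd d p) (map (transition_deriv c d p) vs)"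
proof -
  have "snd c p \<in> snd c ` (fst c \<inter> fst d)" using assms by blast
  then show ?thesis using form assms(1,2,5) unfolding differential_form_def
    by (metis transition_chart[OF atl assms(1,3), of d])
qed

lemma l_pos: "0 < l" using dimK by auto

text \<open>The derivative at \<open>x\<close> of the moved parametrization \<open>f t \<circ> \<rho>\<close>, read in the chart \<open>c\<close>. It carries bases of the
  parameter space to bases of the tangent space of \<open>f t ` L\<close>.\<close>
definition frame :: "('k \<Rightarrow> 'm) \<Rightarrow> 'k \<Rightarrow> ('m, 'e) chart \<Rightarrow> real \<Rightarrow> 'k \<Rightarrow> 'e" where
  "frame \<rho> x c t = frechet_derivative (snd c \<circ> (f t \<circ> \<rho>)) (at x)"

text \<open>The function \<open>\<lambda>(t)\<close> of the introduction, for the basis \<open>ks\<close> of the parameter space.\<close>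
definition frame_value :: "('k \<Rightarrow> 'm) \<Rightarrow> 'k \<Rightarrow> 'k list \<Rightarrow> ('m, 'e) chart \<Rightarrow> real \<Rightarrow> real" where
  "frame_value \<rho> x ks c t =
     \<phi> c (snd c (f t (\<rho> x))) (gram_schmidt (g c (snd c (f t (\<rho> x)))) [] (map (frame \<rho> x c t) ks))"

context
  fixes W :: "'k set" and \<rho> :: "'k \<Rightarrow> 'm" and x :: 'k
  assumes lp: "local_param A L W \<rho>" and x: "x \<in> W"
begin

lemma open_W: "open W" using lp unfolding local_param_def by blast

lemma point_in: "\<rho> x \<in> L"
  using lp x openin_imp_subset unfolding local_param_def by blast

lemma moved_param: "t \<in> {0..1} \<Longrightarrow> local_param A (f t ` L) W (f t \<circ> \<rho>)"
  using local_param_embedding[OF emb lp] .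

lemma moved_immersion: "t \<in> {0..1} \<Longrightarrow> immersion_into A W (f t \<circ> \<rho>)"
  using moved_param unfolding local_param_def by blast

lemma frame_derivative:
  assumes "t \<in> {0..1}" "c \<in> A" "f t (\<rho> x) \<in> fst c"
  shows "linear (frame \<rho> x c t)" "inj (frame \<rho> x c t)"
    "tangent_space A (f t ` L) c (f t (\<rho> x)) = range (frame \<rho> x c t)"
proof -
  have "((snd c \<circ> (f t \<circ> \<rho>)) has_derivative frame \<rho> x c t) (at x)"
    unfolding frame_def
    by (rule smooth_into_has_derivative[OF immersion_smooth[OF moved_immersion[OF assms(1)]] assms(2) x])
      (use assms in simp)
  then show "linear (frame \<rho> x c t)" by (rule has_derivative_linear)
  show "inj (frame \<rho> x c t)"
    unfolding frame_def by (rule immersion_inj[OF moved_immersion[OF assms(1)] assms(2) x]) (use assms in simp)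
  show "tangent_space A (f t ` L) c (f t (\<rho> x)) = range (frame \<rho> x c t)"
    using tangent_space_local_param[OF atl moved_param[OF assms(1)] x assms(2)] assms(3) unfolding frame_def by simp
qed

lemma frame_transition:
  assumes "t \<in> {0..1}" "c \<in> A" "d \<in> A" "f t (\<rho> x) \<in> fst c" "f t (\<rho> x) \<in> fst d"
  shows "frame \<rho> x d t k = transition_deriv c d (f t (\<rho> x)) (frame \<rho> x c t k)"
  using chart_change_derivative[OF atl assms(2,3) open_W immersion_smooth[OF moved_immersion[OF assms(1)]] x]
    assms(4,5) unfolding frame_def by simp

lemma frame_start:
  assumes "c \<in> A" "\<rho> x \<in> fst c"
  shows "frame \<rho> x c 0 = frechet_derivative (snd c \<circ> \<rho>) (at x)"
  unfolding frame_def
proof (rule frechet_derivative_cong_open[OF open_W x])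
  show "(snd c \<circ> (f 0 \<circ> \<rho>)) y = (snd c \<circ> \<rho>) y" if "y \<in> W" for y
  proof -
    have "\<rho> y \<in> L" using lp that openin_imp_subset unfolding local_param_def by blast
    then show ?thesis using start by simp
  qed
qed

lemma frame_basis:
  assumes "t \<in> {0..1}" "c \<in> A" "f t (\<rho> x) \<in> fst c"
  shows "basis_list (tangent_space A (f t ` L) c (f t (\<rho> x))) (map (frame \<rho> x c t) ks) \<longleftrightarrow> basis_list UNIV ks"
  unfolding frame_derivative(3)[OF assms] by (rule basis_list_map[OF frame_derivative(1,2)[OF assms]])

lemma frame_value_chart_independent:
  assumes "t \<in> {0..1}" "c \<in> A" "d \<in> A" "f t (\<rho> x) \<in> fst c" "f t (\<rho> x) \<in> fst d" and ks: "basis_list UNIV ks"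
  shows "frame_value \<rho> x ks c t = frame_value \<rho> x ks d t"
proof -
  let ?p = "f t (\<rho> x)" and ?\<tau> = "transition_deriv c d (f t (\<rho> x))"
  let ?es = "gram_schmidt (g c (snd c ?p)) [] (map (frame \<rho> x c t) ks)"
  have "basis_list (tangent_space A (f t ` L) c ?p) ?es"
    using gram_schmidt_orthonormal[OF inner[OF assms(2)] orthonormal_list_Nil, of "snd c ?p" _ "map (frame \<rho> x c t) ks"]
      frame_basis[OF assms(1,2,4)] ks assms(4) by auto
  moreover have "basis_list (tangent_space A (f t ` L) c ?p) (map (frame \<rho> x c t) ks)"
    using frame_basis[OF assms(1,2,4)] ks by simp
  ultimately have "length ?es = length ks" using basis_list_length by (metis length_map)
  then have len: "length ?es = l" using basis_list_length[OF ks] dimK by simp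
  have "map ?\<tau> ?es = gram_schmidt (g d (snd d ?p)) (map ?\<tau> []) (map ?\<tau> (map (frame \<rho> x c t) ks))"
    by (rule gram_schmidt_map[where G = "g c (snd c ?p)" and G' = "g d (snd d ?p)", OF transition_derivative_iso(1)[OF atl assms(2-5)] metric_transition[OF assms(2-5)]])
  also have "map ?\<tau> (map (frame \<rho> x c t) ks) = map (frame \<rho> x d t) ks"
    using frame_transition[OF assms(1-5)] by simp
  finally have "map ?\<tau> ?es = gram_schmidt (g d (snd d ?p)) [] (map (frame \<rho> x d t) ks)" by simp
  then show ?thesis unfolding frame_value_def using form_transition[OF assms(2-5) len] by simp
qed

text \<open>Only derivatives of order at most one at the single point \<open>x\<close> enter, so the subbasic
  neighbourhoods of the \<open>C\<^sup>\<infinity>\<close> topology are taken for the compact set \<open>{x}\<close> and the order \<open>1\<close>.\<close>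
lemma frame_continuous:
  assumes J: "J \<subseteq> {0..1}" and c: "c \<in> A" "\<And>t. t \<in> J \<Longrightarrow> f t (\<rho> x) \<in> fst c"
  shows "continuous_on J (\<lambda>t. snd c (f t (\<rho> x)))" "continuous_on J (\<lambda>t. frame \<rho> x c t k)"
proof -
  have near: "\<forall>\<^sub>F t in at s within J. \<forall>vs. length vs \<le> 1 \<and> set vs \<subseteq> Basis \<longrightarrow>
      dist (iter_deriv vs (snd c \<circ> (f t \<circ> \<rho>)) x) (iter_deriv vs (snd c \<circ> (f s \<circ> \<rho>)) x) < \<epsilon>"
    if s: "s \<in> J" and "\<epsilon> > 0" for s \<epsilon>
  proof -
    have "s \<in> {0..1}" using s J by blast
    have "\<forall>\<^sub>F t in at s within {0..1}. f t ` \<rho> ` {x} \<subseteq> fst c \<and>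
      (\<forall>y\<in>{x}. \<forall>vs. length vs \<le> 1 \<and> set vs \<subseteq> Basis \<longrightarrow>
        dist (iter_deriv vs (snd c \<circ> f t \<circ> \<rho>) y) (iter_deriv vs (snd c \<circ> f s \<circ> \<rho>) y) < \<epsilon>)"
      using cont[unfolded Cinf_continuous_family_def, rule_format, OF \<open>s \<in> {0..1}\<close> c(1) \<open>\<epsilon> > 0\<close>, of W \<rho> "{x}"] lp x c(2)[OF s] by simp
    then have "\<forall>\<^sub>F t in at s within J. f t ` \<rho> ` {x} \<subseteq> fst c \<and>
      (\<forall>y\<in>{x}. \<forall>vs. length vs \<le> 1 \<and> set vs \<subseteq> Basis \<longrightarrow>
        dist (iter_deriv vs (snd c \<circ> f t \<circ> \<rho>) y) (iter_deriv vs (snd c \<circ> f s \<circ> \<rho>) y) < \<epsilon>)"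
      using at_le[OF J] by (rule filter_leD[rotated])
    then show ?thesis by (rule eventually_mono) (auto simp: o_assoc)
  qed
  show "continuous_on J (\<lambda>t. snd c (f t (\<rho> x)))"
    unfolding continuous_on_def tendsto_iff
  proof (intro ballI allI impI)
    fix s and \<epsilon> :: real assume s: "s \<in> J" "\<epsilon> > 0"
    show "\<forall>\<^sub>F t in at s within J. dist (snd c (f t (\<rho> x))) (snd c (f s (\<rho> x))) < \<epsilon>"
      using near[OF s]
    proof (rule eventually_mono)
      fix t assume "\<forall>vs. length vs \<le> 1 \<and> set vs \<subseteq> Basis \<longrightarrow>
        dist (iter_deriv vs (snd c \<circ> (f t \<circ> \<rho>)) x) (iter_deriv vs (snd c \<circ> (f s \<circ> \<rho>)) x) < \<epsilon>"
      from this[rule_format, of "[]"] show "dist (snd c (f t (\<rho> x))) (snd c (f s (\<rho> x))) < \<epsilon>" by simp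
    qed
  qed
  have basis: "continuous_on J (\<lambda>t. frame \<rho> x c t b)" if b: "b \<in> Basis" for b
    unfolding continuous_on_def tendsto_iff
  proof (intro ballI allI impI)
    fix s and \<epsilon> :: real assume s: "s \<in> J" "\<epsilon> > 0"
    show "\<forall>\<^sub>F t in at s within J. dist (frame \<rho> x c t b) (frame \<rho> x c s b) < \<epsilon>"
      using near[OF s]
    proof (rule eventually_mono)
      fix t assume "\<forall>vs. length vs \<le> 1 \<and> set vs \<subseteq> Basis \<longrightarrow>
        dist (iter_deriv vs (snd c \<circ> (f t \<circ> \<rho>)) x) (iter_deriv vs (snd c \<circ> (f s \<circ> \<rho>)) x) < \<epsilon>"
      from this[rule_format, of "[b]"] show "dist (frame \<rho> x c t b) (frame \<rho> x c s b) < \<epsilon>"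
        using b unfolding frame_def by simp
    qed
  qed
  have "continuous_on J (\<lambda>t. \<Sum>b\<in>Basis. (k \<bullet> b) *\<^sub>R frame \<rho> x c t b)"
    by (intro continuous_intros basis)
  then show "continuous_on J (\<lambda>t. frame \<rho> x c t k)"
  proof (rule continuous_on_eq)
    fix t assume "t \<in> J"
    then have "linear (frame \<rho> x c t)" using frame_derivative(1) J c by blast
    from linear_Basis_expand[OF this, of k]
    show "(\<Sum>b\<in>Basis. (k \<bullet> b) *\<^sub>R frame \<rho> x c t b) = frame \<rho> x c t k" by simp
  qed
qed

lemma chart_persists:
  assumes "s \<in> {0..1}" "c \<in> A" "f s (\<rho> x) \<in> fst c"
  obtains \<delta> where "\<delta> > 0" "\<And>t. t \<in> {0..1} \<inter> ball s \<delta> \<Longrightarrow> f t (\<rho> x) \<in> fst c"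
proof -
  have "\<forall>\<^sub>F t in at s within {0..1}. f t ` \<rho> ` {x} \<subseteq> fst c \<and>
      (\<forall>y\<in>{x}. \<forall>vs. length vs \<le> 0 \<and> set vs \<subseteq> Basis \<longrightarrow>
        dist (iter_deriv vs (snd c \<circ> f t \<circ> \<rho>) y) (iter_deriv vs (snd c \<circ> f s \<circ> \<rho>) y) < 1)"
    using cont[unfolded Cinf_continuous_family_def, rule_format, OF assms(1,2) zero_less_one, of W \<rho> "{x}" 0] lp x assms(3) by simp
  then have "\<forall>\<^sub>F t in at s within {0..1}. f t (\<rho> x) \<in> fst c" by (rule eventually_mono) simp
  then obtain \<delta> where "\<delta> > 0" "\<And>t. t \<in> {0..1} \<Longrightarrow> t \<noteq> s \<Longrightarrow> dist t s < \<delta> \<Longrightarrow> f t (\<rho> x) \<in> fst c"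
    unfolding eventually_at by blast
  then show ?thesis using assms(3) by (intro that[of \<delta>]) (auto simp: dist_commute)
qed

text \<open>For \<open>t\<close> near \<open>s\<close> the point \<open>f t (\<rho> x)\<close> stays in the chart \<open>c\<close>. There the orthonormalised frames move
  continuously and each is a critical point of the Lagrangian, as \<open>f t ` L\<close> is preserved by \<open>\<phi>\<close>-hat.\<close>
lemma frame_value_locally_constant:
  assumes s: "s \<in> {0..1}" and c: "c \<in> A" "f s (\<rho> x) \<in> fst c" and ks: "basis_list UNIV ks"
  obtains \<delta> where "\<delta> > 0" "\<And>t. t \<in> {0..1} \<inter> ball s \<delta> \<Longrightarrow> f t (\<rho> x) \<in> fst c \<and> frame_value \<rho> x ks c t = frame_value \<rho> x ks c s"
proof -
  obtain \<delta> where \<delta>: "\<delta> > 0" "\<And>t. t \<in> {0..1} \<inter> ball s \<delta> \<Longrightarrow> f t (\<rho> x) \<in> fst c"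
    using chart_persists[OF s c] by blast
  define J where "J = {0..1} \<inter> ball s \<delta>"
  have J: "J \<subseteq> {0..1}" "\<And>t. t \<in> J \<Longrightarrow> f t (\<rho> x) \<in> fst c" "s \<in> J" "connected J"
    unfolding J_def using \<delta> s by (auto intro!: convex_connected convex_Int)
  define q where "q t = snd c (f t (\<rho> x))" for t
  have qS: "q t \<in> snd c ` fst c" if "t \<in> J" for t unfolding q_def using J(2)[OF that] by blast
  have cq: "continuous_on J q" unfolding q_def by (rule frame_continuous(1)[OF J(1) c(1) J(2)])
  have Gt: "inner_form (g c (q t))" if "t \<in> J" for t by (rule inner[OF c(1) qS[OF that]])
  define T where "T t = tangent_space A (f t ` L) c (f t (\<rho> x))" for t
  have tb: "basis_list (T t) (map (frame \<rho> x c t) ks)" if "t \<in> J" for t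
    using frame_basis[OF _ c(1) J(2)[OF that]] J(1) that ks unfolding T_def by blast
  have "\<exists>hs. length hs = length ([] :: (real \<Rightarrow> 'e) list) + length (map (\<lambda>k t. frame \<rho> x c t k) ks) \<and> (\<forall>h\<in>set hs. continuous_on J h) \<and>
    (\<forall>t\<in>J. gram_schmidt (g c (q t)) (map (\<lambda>f. f t) ([] :: (real \<Rightarrow> 'e) list)) (map (\<lambda>f. f t) (map (\<lambda>k t. frame \<rho> x c t k) ks)) = map (\<lambda>h. h t) hs)"
  proof (rule continuous_gram_schmidt[where T = T])
    show "continuous_on J (\<lambda>t. g c (q t) (u t) (v t))" if "continuous_on J u" "continuous_on J v" for u v
      by (rule continuous_on_metric_evaluation[where S = "snd c ` fst c" and g = "g c", OF cq _ inner[OF c(1)] smooth_metric[OF c(1)] that])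
        (use qS in auto)
    show "continuous_on J h" if "h \<in> set [] \<union> set (map (\<lambda>k t. frame \<rho> x c t k) ks)" for h
      using that frame_continuous(2)[OF J(1) c(1) J(2)] by auto
  qed (use Gt tb in \<open>auto simp: orthonormal_list_Nil o_def\<close>)
  then obtain hs where hs: "length hs = length ks" "\<And>h. h \<in> set hs \<Longrightarrow> continuous_on J h"
    "\<And>t. t \<in> J \<Longrightarrow> gram_schmidt (g c (q t)) [] (map (frame \<rho> x c t) ks) = map (\<lambda>h. h t) hs"
    by (auto simp: o_def)
  have lenks: "length ks = l" using basis_list_length[OF ks] dimK by simp
  have es: "orthonormal_list (g c (q t)) (map (\<lambda>h. h t) hs)" "basis_list (T t) (map (\<lambda>h. h t) hs)" if "t \<in> J" for t
    using gram_schmidt_orthonormal[OF Gt[OF that] orthonormal_list_Nil, of "T t" "map (frame \<rho> x c t) ks"] tb[OF that] hs(3)[OF that] by auto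
  obtain ix :: "'k basis_index list" where ix: "set ix = UNIV" "distinct ix"
    using finite_distinct_list[OF finite_class.finite_UNIV] by blast
  have lenix: "length ix = l" using distinct_card[OF ix(2)] ix(1) card_basis_index dimK by metis
  have const: "\<phi> c (q s) (map (\<lambda>h. h s) hs) = \<phi> c (q t) (map (\<lambda>h. h t) hs)" if "t \<in> J" for t
  proof (rule parallel_form_constant_on_critical_path[where S = "snd c ` fst c" and l = l and g = g and c = c and \<phi> = \<phi> and J = J and ix = ix,
        OF atlas_chart(2)[OF atl c(1)] inner[OF c(1)] smooth_metric[OF c(1)] alternating[OF c(1)] smooth_form[OF c(1)]])
    show "cov_deriv g \<phi> c y w vs = 0" if "y \<in> snd c ` fst c" "length vs = l" for y w vs
      using par c(1) that unfolding parallel_form_def by blast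
    show "\<phi> c (q t) ((map (\<lambda>h. h t) hs)[i := u]) = \<phi> c (q t) (map (\<lambda>h. h t) hs) * g c (q t) (map (\<lambda>h. h t) hs ! i) u"
      if t: "t \<in> J" and i: "i < l" for t i u
    proof (rule form_hat_critical[where T = "T t" and l = l and g = g and c = c and \<phi> = \<phi>, OF Gt[OF t] alternating[OF c(1) qS[OF t]] es[OF t] _ _ i])
      show "length (map (\<lambda>h. h t) hs) = l" using hs(1) lenks by simp
      show "form_hat g \<phi> c (q t) ws \<in> T t" if "Suc (length ws) = l" "set ws \<subseteq> T t" for ws
      proof -
        have "form_hat_submanifold K A g l \<phi> (f t ` L)" using hat J(1) t by blast
        moreover have "f t (\<rho> x) \<in> f t ` L \<inter> fst c" using J(2)[OF t] point_in by blast
        ultimately show ?thesis using that c(1) unfolding form_hat_submanifold_def T_def q_def by blast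
      qed
    qed
  qed (use lenix ix J(3,4) cq qS hs(1,2) lenks es(1) that in auto)
  have "frame_value \<rho> x ks c t = frame_value \<rho> x ks c s" if "t \<in> J" for t
    using const[OF that] hs(3)[OF that] hs(3)[OF J(3)] unfolding frame_value_def q_def by simp
  then show ?thesis using that[OF \<delta>(1)] \<delta>(2) unfolding J_def by blast
qed

text \<open>With a chart chosen for every \<open>t\<close>, the value is a locally constant function on \<open>[0,1]\<close>, whatever the
  choice.\<close>
lemma frame_value_constant:
  assumes t: "t \<in> {0..1}" "d \<in> A" "f t (\<rho> x) \<in> fst d" and c: "c \<in> A" "\<rho> x \<in> fst c" and ks: "basis_list UNIV ks"
  shows "frame_value \<rho> x ks d t = frame_value \<rho> x ks c 0"
proof -
  define ch where "ch t = (SOME c. c \<in> A \<and> f t (\<rho> x) \<in> fst c)" for t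
  have ch: "ch t \<in> A \<and> f t (\<rho> x) \<in> fst (ch t)" for t
  proof -
    have "\<exists>c. c \<in> A \<and> f t (\<rho> x) \<in> fst c" using atl unfolding smooth_atlas_def by blast
    then show ?thesis unfolding ch_def by (rule someI_ex)
  qed
  define \<Lambda> where "\<Lambda> t = frame_value \<rho> x ks (ch t) t" for t
  have \<Lambda>: "\<Lambda> t = frame_value \<rho> x ks c t" if "t \<in> {0..1}" "c \<in> A" "f t (\<rho> x) \<in> fst c" for t c
    unfolding \<Lambda>_def using frame_value_chart_independent[OF that(1) _ that(2) _ that(3) ks] ch by blast
  have "\<Lambda> constant_on {0..1}"
  proof (rule locally_constant_imp_constant)
    show "connected {0..1::real}" by simp
    fix s :: real assume s: "s \<in> {0..1}"
    obtain \<delta> where \<delta>: "\<delta> > 0" "\<And>t. t \<in> {0..1} \<inter> ball s \<delta> \<Longrightarrow>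
        f t (\<rho> x) \<in> fst (ch s) \<and> frame_value \<rho> x ks (ch s) t = frame_value \<rho> x ks (ch s) s"
      using frame_value_locally_constant[OF s _ _ ks, of "ch s"] ch by blast
    have near: "\<Lambda> t = \<Lambda> s" if "t \<in> {0..1} \<inter> ball s \<delta>" for t
      using \<delta>(2)[OF that] \<Lambda>[of t "ch s"] \<Lambda>[of s "ch s"] ch[of s] s that by auto
    then show "\<exists>T. openin (top_of_set {0..1}) T \<and> s \<in> T \<and> (\<forall>t\<in>T. \<Lambda> t = \<Lambda> s)"
    proof (intro exI[of _ "{0..1} \<inter> ball s \<delta>"] conjI ballI)
      show "openin (top_of_set {0..1}) ({0..1} \<inter> ball s \<delta>)" by (rule openin_open_Int) simp
      show "s \<in> {0..1} \<inter> ball s \<delta>" using s \<delta>(1) by simp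
      show "\<Lambda> t = \<Lambda> s" if "t \<in> {0..1} \<inter> ball s \<delta>" for t by (rule near[OF that])
    qed
  qed
  then have "\<Lambda> t = \<Lambda> 0" using t(1) unfolding constant_on_def by auto
  then show ?thesis using \<Lambda>[OF t] \<Lambda>[of 0 c] c start[OF point_in] by simp
qed

end

end

context parallel_form_deformation
begin

lemma submanifold_point:
  assumes "submanifold K A L" "p \<in> L"
  obtains W :: "'k set" and \<rho> x where "local_param A L W \<rho>" "x \<in> W" "\<rho> x = p"
  using assms unfolding submanifold_def by (metis imageE)

lemma start_image: "f 0 ` L = L"
  using start by force

lemma frame_positive_iff:
  fixes W :: "'k set"
  assumes lp: "local_param A L W \<rho>" "x \<in> W" and t: "t \<in> {0..1}" "c \<in> A" "f t (\<rho> x) \<in> fst c" and ks: "basis_list UNIV ks"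
  shows "0 < \<phi> c (snd c (f t (\<rho> x))) (map (frame \<rho> x c t) ks) \<longleftrightarrow> 0 < frame_value \<rho> x ks c t"
    "\<phi> c (snd c (f t (\<rho> x))) (map (frame \<rho> x c t) ks) = 0 \<longleftrightarrow> frame_value \<rho> x ks c t = 0"
proof -
  have b: "basis_list (tangent_space A (f t ` L) c (f t (\<rho> x))) (map (frame \<rho> x c t) ks)"
    using frame_basis[OF lp t] ks by simp
  have "length ks = l" using basis_list_length[OF ks] dimK by simp
  then have len: "length (map (frame \<rho> x c t) ks) = l" by simp
  have xc: "snd c (f t (\<rho> x)) \<in> snd c ` fst c" using t(3) by blast
  show "0 < \<phi> c (snd c (f t (\<rho> x))) (map (frame \<rho> x c t) ks) \<longleftrightarrow> 0 < frame_value \<rho> x ks c t"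
    "\<phi> c (snd c (f t (\<rho> x))) (map (frame \<rho> x c t) ks) = 0 \<longleftrightarrow> frame_value \<rho> x ks c t = 0"
    unfolding frame_value_def
    by (rule gram_schmidt_sign[OF alternating[OF t(2) xc] inner[OF t(2) xc] b len])+
qed

lemma tangent_basis_transition:
  fixes W :: "'k set"
  assumes lp: "local_param A L W \<rho>" "x \<in> W" and t: "t \<in> {0..1}"
    and c: "c \<in> A" "f t (\<rho> x) \<in> fst c" and d: "d \<in> A" "f t (\<rho> x) \<in> fst d"
  shows "basis_list (tangent_space A (f t ` L) d (f t (\<rho> x)))
      (map (transition_deriv c d (f t (\<rho> x))) vs) \<longleftrightarrow>
    basis_list (tangent_space A (f t ` L) c (f t (\<rho> x))) vs"
proof -
  let ?\<tau> = "transition_deriv c d (f t (\<rho> x))"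
  have "tangent_space A (f t ` L) d (f t (\<rho> x)) = ?\<tau> ` tangent_space A (f t ` L) c (f t (\<rho> x))"
    unfolding frame_derivative(3)[OF lp t c] frame_derivative(3)[OF lp t d]
    using frame_transition[OF lp t c(1) d(1) c(2) d(2)] by (auto simp: image_iff)
  then show ?thesis
    using basis_list_map[OF transition_derivative_iso[OF atl c(1) d(1) c(2) d(2)]] by simp
qed

lemma tangent_dim:
  fixes W :: "'k set"
  assumes lp: "local_param A L W \<rho>" "x \<in> W" and t: "t \<in> {0..1}" "c \<in> A" "f t (\<rho> x) \<in> fst c"
  shows "dim (tangent_space A (f t ` L) c (f t (\<rho> x))) = l"
  unfolding frame_derivative(3)[OF lp t]
  using dim_image_eq[OF frame_derivative(1)[OF lp t], of UNIV] frame_derivative(2)[OF lp t] dimK by simp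

lemma tangent_basis_frame:
  fixes W :: "'k set"
  assumes lp: "local_param A L W \<rho>" "x \<in> W" and t: "t \<in> {0..1}" "c \<in> A" "f t (\<rho> x) \<in> fst c"
    and vs: "basis_list (tangent_space A (f t ` L) c (f t (\<rho> x))) vs"
  obtains ks where "basis_list UNIV ks" "vs = map (frame \<rho> x c t) ks"
proof -
  have "set vs \<subseteq> range (frame \<rho> x c t)"
    using vs span_superset[of "set vs"] unfolding basis_list_def frame_derivative(3)[OF lp t] by blast
  then have eq: "vs = map (frame \<rho> x c t) (map (inv (frame \<rho> x c t)) vs)"
    by (intro nth_equalityI) (auto simp: f_inv_into_f subset_iff)
  then show ?thesis using that frame_basis[OF lp t] vs by metis
qed

text \<open>The orientation is described by a form \<open>\<omega>\<close> in one particular chart \<open>b\<close> around each point. There the volume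
  form has the sign of \<open>\<omega>\<close>; the transformation laws carry this to the chart \<open>c\<close>.\<close>
lemma calibrated_start:
  fixes W :: "'k set"
  assumes cal: "calibrated_submanifold K A g l \<phi> L Or"
    and lp: "local_param A L W \<rho>" "x \<in> W" and c: "c \<in> A" "\<rho> x \<in> fst c"
  shows "Or c (\<rho> x) us \<longleftrightarrow> basis_list (tangent_space A L c (\<rho> x)) us \<and> 0 < \<phi> c (snd c (\<rho> x)) us" (is ?or)
    and "basis_list UNIV ks \<Longrightarrow> \<bar>frame_value \<rho> x ks c 0\<bar> = 1"
proof -
  let ?p = "\<rho> x"
  have pL: "?p \<in> L" by (rule point_in[OF lp])
  have f0: "f 0 ?p = ?p" by (rule start[OF pL])
  have or: "orientation A l L Or" using cal unfolding calibrated_submanifold_def by blast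
  obtain b U \<omega> where b: "b \<in> A" "?p \<in> U" "U \<subseteq> fst b" "\<forall>y\<in>snd b ` U. alternating_form_on UNIV l (\<omega> y)"
    "\<forall>q\<in>L \<inter> U. \<forall>vs. (basis_list (tangent_space A L b q) vs \<longrightarrow> \<omega> (snd b q) vs \<noteq> 0) \<and>
           (Or b q vs \<longleftrightarrow> basis_list (tangent_space A L b q) vs \<and> 0 < \<omega> (snd b q) vs)"
    using or[unfolded orientation_def, THEN conjunct2, THEN bspec, OF pL] by (elim bexE exE conjE) (rule that)
  have pb: "?p \<in> fst b" using b by blast
  have sb: "snd b ?p \<in> snd b ` fst b" using pb by blast
  let ?T = "tangent_space A L b ?p"
  have zero: "(0::real) \<in> {0..1}" by simp
  note frame0 = tangent_dim[OF lp zero, unfolded f0 start_image] tangent_basis_transition[OF lp zero, unfolded f0 start_image]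
    frame_basis[OF lp zero, unfolded f0 start_image]
  have vol: "is_volume_form (g b (snd b ?p)) l ?T (Or b ?p) (\<phi> b (snd b ?p))"
    using cal pL pb b(1) unfolding calibrated_submanifold_def by blast
  have alt\<omega>: "alternating_form_on UNIV l (\<omega> (snd b ?p))" using b by blast
  have ne: "\<omega> (snd b ?p) vs \<noteq> 0" if "basis_list ?T vs" for vs
    using b(5)[THEN bspec, of ?p, THEN spec, of vs] pL b(2) that by simp
  have P: "Or b ?p vs \<longleftrightarrow> basis_list ?T vs \<and> 0 < \<omega> (snd b ?p) vs" for vs
    using b(5)[THEN bspec, of ?p, THEN spec, of vs] pL b(2) by simp
  have V: "\<phi> b (snd b ?p) es = 1" if "Or b ?p es" "orthonormal_list (g b (snd b ?p)) es" for es
    using vol that unfolding is_volume_form_def by blast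
  note sign = volume_form_sign[where P = "Or b ?p", OF alt\<omega> alternating[OF b(1) sb] inner[OF b(1) sb] frame0(1)[OF b(1) pb] l_pos ne P V]
  have orb: "Or b ?p vs \<longleftrightarrow> basis_list ?T vs \<and> 0 < \<phi> b (snd b ?p) vs" for vs
    using P[of vs] sign(1)[of vs] by blast
  show ?or
  proof -
    let ?\<tau> = "transition_deriv c b ?p"
    have "Or c ?p us \<longleftrightarrow> Or b ?p (map ?\<tau> us)"
      using or c b(1) pb pL unfolding orientation_def by blast
    also have "\<dots> \<longleftrightarrow> basis_list ?T (map ?\<tau> us) \<and> 0 < \<phi> b (snd b ?p) (map ?\<tau> us)" by (rule orb)
    also have "\<dots> \<longleftrightarrow> basis_list (tangent_space A L c ?p) us \<and> 0 < \<phi> c (snd c ?p) us"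
    proof -
      have "basis_list ?T (map ?\<tau> us) \<longleftrightarrow> basis_list (tangent_space A L c ?p) us"
        by (rule frame0(2)[OF c b(1) pb])
      moreover have "\<phi> b (snd b ?p) (map ?\<tau> us) = \<phi> c (snd c ?p) us" if "basis_list (tangent_space A L c ?p) us"
        using form_transition[OF c(1) b(1) c(2) pb, of us] basis_list_length[OF that] frame0(1)[OF c] by simp
      ultimately show ?thesis by auto
    qed
    finally show ?thesis .
  qed
  show "\<bar>frame_value \<rho> x ks c 0\<bar> = 1" if ks: "basis_list UNIV ks"
  proof -
    have "\<bar>frame_value \<rho> x ks b 0\<bar> = 1"
      unfolding frame_value_def f0 by (rule sign(2)[OF _ _ _ frame0(3)[OF b(1) pb, THEN iffD2, OF ks]])
    moreover have "frame_value \<rho> x ks c 0 = frame_value \<rho> x ks b 0"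
      by (rule frame_value_chart_independent[OF lp zero c(1) b(1) _ _ ks]) (use f0 c pb in auto)
    ultimately show ?thesis by simp
  qed
qed

text \<open>Corresponding bases at \<open>p\<close> and \<open>f t p\<close> come from the same basis \<open>ks\<close> of the parameter space, and
  the sign of \<open>\<phi>\<close> on either of them is the sign of the constant \<open>frame_value\<close>.\<close>
lemma transported_orientation_iff:
  assumes cal: "calibrated_submanifold K A g l \<phi> L Or" and t: "t \<in> {0..1}" "d \<in> A" "f t p \<in> fst d" and p: "p \<in> L"
  shows "transported_orientation A L (f t) Or d (f t p) vs \<longleftrightarrow>
    basis_list (tangent_space A (f t ` L) d (f t p)) vs \<and> 0 < \<phi> d (snd d (f t p)) vs"
proof -
  have sub: "submanifold K A L" using cal unfolding calibrated_submanifold_def by blast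
  obtain W :: "'k set" and \<rho> x where lp: "local_param A L W \<rho>" "x \<in> W" and px: "\<rho> x = p"
    using submanifold_point[OF sub p] by metis
  note t' = t[folded px]
  obtain h where "homeomorphism L (f t ` L) (f t) h" using emb[OF t(1)] unfolding smooth_embedding_def by blast
  then have inj: "inj_on (f t) L" unfolding homeomorphism_def by (metis inj_on_inverseI)
  have sm: "smooth_into A W (f t \<circ> \<rho>)" by (rule immersion_smooth[OF moved_immersion[OF lp t(1)]])
  have rel: "list_all2 (differential_rel A L (f t) c d p) us vs \<longleftrightarrow>
      (\<exists>ks. us = map (frame \<rho> x c 0) ks \<and> vs = map (frame \<rho> x d t) ks)" if c: "c \<in> A" "p \<in> fst c" for c us
  proof -
    have "differential_rel A L (f t) c d p = (\<lambda>u v. \<exists>k. u = frame \<rho> x c 0 k \<and> v = frame \<rho> x d t k)"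
      using differential_rel_local_param[OF atl lp c(1) _ t(2) _ sm] c t(3) px frame_start[OF lp c(1)]
      unfolding frame_def by (intro ext) auto
    then show ?thesis using list_all2_joint_map[of "frame \<rho> x c 0" "frame \<rho> x d t" us vs] by simp
  qed
  have zero: "(0::real) \<in> {0..1}" by simp
  have f0: "f 0 p = p" by (rule start[OF p])
  have pos: "0 < \<phi> c (snd c p) (map (frame \<rho> x c 0) ks) \<longleftrightarrow> 0 < \<phi> d (snd d (f t p)) (map (frame \<rho> x d t) ks)"
    if c: "c \<in> A" "p \<in> fst c" and ks: "basis_list UNIV ks" for c ks
    using frame_positive_iff(1)[OF lp zero c(1) _ ks] frame_positive_iff(1)[OF lp t' ks]
      frame_value_constant[OF lp t' c(1) _ ks] c(2) px f0 by simp
  have basis0: "basis_list (tangent_space A L c p) (map (frame \<rho> x c 0) ks) \<longleftrightarrow> basis_list UNIV ks"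
    if "c \<in> A" "p \<in> fst c" for c ks
    using frame_basis[OF lp zero that(1), of ks] that(2) px f0 start_image by simp
  note or = calibrated_start(1)[OF cal lp, unfolded px]
  show ?thesis
  proof
    assume "transported_orientation A L (f t) Or d (f t p) vs"
    then obtain p' c us where "p' \<in> L" "f t p' = f t p" "c \<in> A" "p' \<in> fst c" "Or c p' us"
      "list_all2 (differential_rel A L (f t) c d p') us vs"
      unfolding transported_orientation_def by blast
    moreover from this have "p' = p" using inj p by (auto dest: inj_onD)
    ultimately have c: "c \<in> A" "p \<in> fst c" and "Or c p us" "list_all2 (differential_rel A L (f t) c d p) us vs" by auto
    then obtain ks where ks: "us = map (frame \<rho> x c 0) ks" "vs = map (frame \<rho> x d t) ks"
      "basis_list (tangent_space A L c p) us" "0 < \<phi> c (snd c p) us"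
      using rel[OF c] or[OF c] by blast
    then have bk: "basis_list UNIV ks" using basis0[OF c] by simp
    then show "basis_list (tangent_space A (f t ` L) d (f t p)) vs \<and> 0 < \<phi> d (snd d (f t p)) vs"
      using pos[OF c bk] ks frame_basis[OF lp t'] px by simp
  next
    assume vs: "basis_list (tangent_space A (f t ` L) d (f t p)) vs \<and> 0 < \<phi> d (snd d (f t p)) vs"
    obtain ks where ks: "basis_list UNIV ks" "vs = map (frame \<rho> x d t) ks"
      using tangent_basis_frame[OF lp t', unfolded px] vs by blast
    obtain c where c: "c \<in> A" "p \<in> fst c" using atl unfolding smooth_atlas_def by blast
    have "Or c p (map (frame \<rho> x c 0) ks)"
      using or[OF c] basis0[OF c] pos[OF c ks(1)] ks vs by simp
    moreover have "list_all2 (differential_rel A L (f t) c d p) (map (frame \<rho> x c 0) ks) vs"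
      using rel[OF c] ks by blast
    ultimately show "transported_orientation A L (f t) Or d (f t p) vs"
      unfolding transported_orientation_def using p c by blast
  qed
qed

text \<open>The form \<open>\<phi>\<close> itself serves as the form required of an orientation.\<close>
lemma calibrated_deformation:
  assumes cal: "calibrated_submanifold K A g l \<phi> L Or" and t: "t \<in> {0..1}"
  shows "calibrated_submanifold K A g l \<phi> (f t ` L) (transported_orientation A L (f t) Or)"
proof -
  let ?L = "f t ` L" and ?Or = "transported_orientation A L (f t) Or"
  have sub: "submanifold K A L" using cal unfolding calibrated_submanifold_def by blast
  have char: "?Or d q vs \<longleftrightarrow> basis_list (tangent_space A ?L d q) vs \<and> 0 < \<phi> d (snd d q) vs"
    if "d \<in> A" "q \<in> ?L" "q \<in> fst d" for d q vs
    using transported_orientation_iff[OF cal t that(1)] that(2,3) by auto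
  have point: "\<exists>(W :: 'k set) \<rho> x. local_param A L W \<rho> \<and> x \<in> W \<and> f t (\<rho> x) = q" if qL: "q \<in> ?L" for q
  proof -
    obtain p where p: "p \<in> L" "q = f t p" using qL by blast
    obtain W :: "'k set" and \<rho> x where "local_param A L W \<rho>" "x \<in> W" "\<rho> x = p"
      by (rule submanifold_point[OF sub p(1)])
    then show ?thesis using p(2) by blast
  qed
  have unit: "\<bar>frame_value \<rho> x ks d t\<bar> = 1"
    if lp: "local_param A L W \<rho>" "x \<in> W" and d: "d \<in> A" "f t (\<rho> x) \<in> fst d" and ks: "basis_list UNIV ks"
    for W :: "'k set" and \<rho> x d ks
  proof -
    obtain c where c: "c \<in> A" "\<rho> x \<in> fst c" using atl unfolding smooth_atlas_def by blast
    show ?thesis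
      using calibrated_start(2)[OF cal lp c ks] frame_value_constant[OF lp t d c ks] by simp
  qed
  have nonzero: "\<phi> d (snd d q) vs \<noteq> 0"
    if d: "d \<in> A" "q \<in> ?L" "q \<in> fst d" and vs: "basis_list (tangent_space A ?L d q) vs" for d q vs
  proof -
    obtain W :: "'k set" and \<rho> x where lp: "local_param A L W \<rho>" "x \<in> W" and q: "f t (\<rho> x) = q"
      using point[OF d(2)] by blast
    note d' = d(1,3)[folded q]
    obtain ks where ks: "basis_list UNIV ks" "vs = map (frame \<rho> x d t) ks"
      using tangent_basis_frame[OF lp t d'] vs q by blast
    show ?thesis using frame_positive_iff(2)[OF lp t d' ks(1)] unit[OF lp d' ks(1)] ks(2) q by auto
  qed
  have "orientation A l ?L ?Or"
    unfolding orientation_def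
  proof (intro conjI ballI allI)
    fix c d q vs assume c: "c \<in> A" and d: "d \<in> A" and q: "q \<in> ?L \<inter> fst c \<inter> fst d"
    let ?\<tau> = "transition_deriv c d q"
    obtain W :: "'k set" and \<rho> x where lp: "local_param A L W \<rho>" "x \<in> W" and qx: "f t (\<rho> x) = q"
      using point q by blast
    have qc: "f t (\<rho> x) \<in> fst c" "f t (\<rho> x) \<in> fst d" using q qx by auto
    have "basis_list (tangent_space A ?L d q) (map ?\<tau> vs) \<longleftrightarrow> basis_list (tangent_space A ?L c q) vs"
      using tangent_basis_transition[OF lp t c qc(1) d qc(2)] qx by simp
    moreover have "\<phi> c (snd c q) vs = \<phi> d (snd d q) (map ?\<tau> vs)" if "basis_list (tangent_space A ?L c q) vs"
      using form_transition[OF c d, of q vs] q basis_list_length[OF that] tangent_dim[OF lp t c qc(1)] qx by simp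
    moreover have "?Or c q vs \<longleftrightarrow> basis_list (tangent_space A ?L c q) vs \<and> 0 < \<phi> c (snd c q) vs"
      by (rule char[OF c]) (use q in auto)
    moreover have "?Or d q (map ?\<tau> vs) \<longleftrightarrow> basis_list (tangent_space A ?L d q) (map ?\<tau> vs) \<and> 0 < \<phi> d (snd d q) (map ?\<tau> vs)"
      by (rule char[OF d]) (use q in auto)
    ultimately show "?Or c q vs \<longleftrightarrow> ?Or d q (map ?\<tau> vs)" by auto
  next
    fix q assume q: "q \<in> ?L"
    obtain c where c: "c \<in> A" "q \<in> fst c" using atl unfolding smooth_atlas_def by blast
    show "\<exists>c\<in>A. \<exists>U \<omega>. open U \<and> q \<in> U \<and> U \<subseteq> fst c \<and>
        (\<forall>x\<in>snd c ` U. alternating_form_on UNIV l (\<omega> x)) \<and>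
        (\<forall>vs. length vs = l \<longrightarrow> continuous_on (snd c ` U) (\<lambda>x. \<omega> x vs)) \<and>
        (\<forall>q\<in>?L \<inter> U. \<forall>vs.
           (basis_list (tangent_space A ?L c q) vs \<longrightarrow> \<omega> (snd c q) vs \<noteq> 0) \<and>
           (?Or c q vs \<longleftrightarrow> basis_list (tangent_space A ?L c q) vs \<and> 0 < \<omega> (snd c q) vs))"
    proof (rule bexI[OF _ c(1)], intro exI[of _ "fst c"] exI[of _ "\<phi> c"] conjI ballI allI impI)
      show "open (fst c)" by (rule atlas_chart(1)[OF atl c(1)])
      show "continuous_on (snd c ` fst c) (\<lambda>x. \<phi> c x vs)" if "length vs = l" for vs
        by (rule smooth_on_continuous[OF smooth_form[OF c(1) that]])
      fix r vs assume r: "r \<in> ?L \<inter> fst c"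
      show "\<phi> c (snd c r) vs \<noteq> 0" if "basis_list (tangent_space A ?L c r) vs"
        by (rule nonzero[OF c(1) _ _ that]) (use r in auto)
      show "?Or c r vs \<longleftrightarrow> basis_list (tangent_space A ?L c r) vs \<and> 0 < \<phi> c (snd c r) vs"
        by (rule char[OF c(1)]) (use r in auto)
    qed (use c alternating[OF c(1)] in auto)
  qed
  moreover have "is_volume_form (g d (snd d q)) l (tangent_space A ?L d q) (?Or d q) (\<phi> d (snd d q))"
    if d: "d \<in> A" "q \<in> ?L \<inter> fst d" for d q
    unfolding is_volume_form_def
  proof (intro conjI allI impI)
    have qd: "snd d q \<in> snd d ` fst d" using d by blast
    show "alternating_form_on (tangent_space A ?L d q) l (\<phi> d (snd d q))"
      using alternating[OF d(1) qd] unfolding alternating_form_on_def by simp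
    fix es assume es: "?Or d q es \<and> orthonormal_list (g d (snd d q)) es"
    then have pos: "basis_list (tangent_space A ?L d q) es" "0 < \<phi> d (snd d q) es"
      using char[OF d(1), of q es] d(2) by auto
    obtain W :: "'k set" and \<rho> x where lp: "local_param A L W \<rho>" "x \<in> W" and q: "f t (\<rho> x) = q"
      using point d(2) by blast
    have d': "d \<in> A" "f t (\<rho> x) \<in> fst d" using d q by auto
    obtain ks where ks: "basis_list UNIV ks" "es = map (frame \<rho> x d t) ks"
      using tangent_basis_frame[OF lp t d'] pos(1) q by blast
    have "gram_schmidt (g d (snd d q)) [] es = es"
      using gram_schmidt_orthonormal_id[OF inner[OF d(1) qd], of "[]" es] es by simp
    then have "frame_value \<rho> x ks d t = \<phi> d (snd d q) es" unfolding frame_value_def q ks(2)[symmetric] by simp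
    then show "\<phi> d (snd d q) es = 1" using unit[OF lp d' ks(1)] pos(2) by simp
  qed
  moreover have "submanifold K A ?L" using hat[OF t] unfolding form_hat_submanifold_def by blast
  ultimately show ?thesis unfolding calibrated_submanifold_def using dimK by blast
qed

end

theorem corollary3p6:
  fixes A :: "('m::{t2_space,second_countable_topology}, 'e::euclidean_space) chart set"
    and g :: "('m, 'e) metric" and l :: nat and \<phi> :: "('m, 'e) dform"
    and L\<^sub>0 :: "'m set" and Or :: "('m, 'e) orient" and f :: "real \<Rightarrow> 'm \<Rightarrow> 'm"
  assumes "smooth_atlas A" and "riemannian_metric A g"
    and "calibration A g l \<phi>" and "parallel_form A g l \<phi>"
    and "closed_submanifold TYPE('k::euclidean_space) A L\<^sub>0"
    and "calibrated_submanifold TYPE('k) A g l \<phi> L\<^sub>0 Or"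
    and "deformation TYPE('k) A L\<^sub>0 f"
    and "\<And>t. t \<in> {0..1} \<Longrightarrow> form_hat_submanifold TYPE('k) A g l \<phi> (f t ` L\<^sub>0)"
  shows "\<forall>t\<in>{0..1}.
    calibrated_submanifold TYPE('k) A g l \<phi> (f t ` L\<^sub>0) (transported_orientation A L\<^sub>0 (f t) Or)"
proof -
  interpret parallel_form_deformation A g l \<phi> "TYPE('k)" L\<^sub>0 f
    using assms by unfold_locales (auto simp: calibration_def deformation_def calibrated_submanifold_def)
  show ?thesis using calibrated_deformation[OF assms(6)] by blast
qed

end
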